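(* Let $M$ be a smooth manifold of any dimension, fix any signature and a constant $\Lambda\in\mathbb{R}$, and consider the vacuum Einstein equation $\mathcal{E}$ $$\operatorname{Ric}(g)-\tfrac12 R(g)\,g+\Lambda\,g=0$$ as a second order PDE system on the unknown pseudo-Riemannian metric $g$ of the given signature. Then (with $T=T_xM$) the only nonzero Spencer $\delta$-cohomology groups of $\mathcal{E}$, in any dimension and signature, are $$H^{0,0}(\mathcal{E})\simeq S^2T^*,\qquad H^{1,1}(\mathcal{E})\simeq S^2T^*,\qquad H^{1,2}(\mathcal{E})\simeq T^*.$$ Moreover, the equation $\mathcal{E}$ is involutive.
   Context: Ric and $R$ are the Ricci tensor and the scalar curvature of $g$. Formal theory of PDEs. A PDE system of order $k$ is a submanifold $\mathcal{E}=\mathcal{E}_k\subset J^k\pi$ of the space of $k$-jets of sections of a bundle $\pi:E\to M$ (here $k=2$ and sections of $\pi$ are metrics), such that $\mathcal{E}_k\to J^{k-1}\pi$ is a submersion. Its prolongations are $\mathcal{E}_l=\mathcal{E}_k^{(l-k)}\subset J^l\pi$, $l>k$ (the $l$-jets satisfying the equation together with its total derivatives up to order $l-k$). Let $T=T_xM$ and let $N$ be the tangent space to the fiber of $\pi$ (here $N=S^2T^*$). The symbol spaces at a point of $\mathcal{E}_k$ are: $\mathfrak{g}_t=S^tT^*\otimes N$ for $t<k$; $\mathfrak{g}_k\subset S^kT^*\otimes N$ is the tangent space to the fiber of $\mathcal{E}_k\to J^{k-1}\pi$; $\mathfrak{g}_t=(\mathfrak{g}_k\otimes S^{t-k}T^*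 )\cap(S^tT^*\otimes N)$ for $t>k$. The Spencer $\delta$-complex is $$0\to \mathfrak{g}_t\to \mathfrak{g}_{t-1}\otimes T^*\xrightarrow{\delta}\mathfrak{g}_{t-2}\otimes\Lambda^2T^*\xrightarrow{\delta}\cdots\xrightarrow{\delta}\mathfrak{g}_{t-i}\otimes\Lambda^iT^*\to\cdots,$$ where $\delta$ is the restriction of the symbol of the de Rham differential, $\delta(p^i\otimes v\otimes\omega)=i\,p^{i-1}\otimes v\otimes(p\wedge\omega)$ for $p\in T^*$, $v\in N$, $\omega\in\Lambda^jT^*$. Its cohomology at the term $\mathfrak{g}_i\otimes\Lambda^jT^*$ is denoted $H^{i,j}(\mathcal{E})$. The symbolic system $\oplus_t\mathfrak{g}_t$ of order $k$ is called involutive if $H^{i,j}=0$ for all $i\ne k-1$ with $i+j>0$. The equation $\mathcal{E}$ is called involutive if its symbolic system is involutive and the obstruction (curvature/structure tensor) $W_k\in H^{k-1,2}(\mathcal{E})$ vanishes; $W_k$ is the obstruction to surjectivity of the projection $\mathcal{E}_{k+1}\to\mathcal{E}_k$, i.e. it vanishes iff this projection is surjective.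
   Formalization: "Any dimension" is restricted to dimension at least 3: in dimensions 1 and 2, Ric - R g/2 vanishes identically, so for Λ = 0 every 2-jet is a solution and H^{1,1} = 0 (the claim fails), while for Λ ≠ 0 the equation is empty. *)

theory Defs
  imports "HOL-Analysis.Analysis" "HOL-Library.Function_Algebras" "HOL-Library.Set_Algebras"
begin

section \<open>Partial derivatives and smooth maps\<close>

definition partial_deriv ::
  "'n::finite \<Rightarrow> (real^'n \<Rightarrow> 'b::real_normed_vector) \<Rightarrow> real^'n \<Rightarrow> 'b" where
  "partial_deriv i f y = frechet_derivative f (at y) (axis i 1)"

primrec partial_derivs ::
  "'n::finite list \<Rightarrow> (real^'n \<Rightarrow> 'b::real_normed_vector) \<Rightarrow> real^'n \<Rightarrow> 'b" where
  "partial_derivs [] f = f"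
| "partial_derivs (i # I) f = partial_deriv i (partial_derivs I f)"

text \<open>To be used for open \<open>U\<close> only.\<close>

definition smooth_map_on ::
  "(real^'n::finite) set \<Rightarrow> (real^'n \<Rightarrow> 'b::real_normed_vector) \<Rightarrow> bool" where
  "smooth_map_on U f \<longleftrightarrow> (\<forall>I. \<forall>y\<in>U. partial_derivs I f differentiable (at y))"


section \<open>Smooth manifolds\<close>

text \<open>A chart is a domain together with its coordinate map; the latter is relevant on the
  domain only. The dimension of the manifold is \<open>CARD('n)\<close>.\<close>

type_synonym ('m, 'n) chart = "'m set \<times> ('m \<Rightarrow> real^'n)"

definition smooth_atlas :: "'m topology \<Rightarrow> ('m, 'n::finite) chart set \<Rightarrow> bool" where
  "smooth_atlas X A \<longleftrightarrow>
     (\<Union>c\<in>A. fst c) = topspace X \<and>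
     (\<forall>(U, \<phi>)\<in>A. openin X U \<and> open (\<phi> ` U) \<and>
        homeomorphic_map (subtopology X U) (top_of_set (\<phi> ` U)) \<phi>) \<and>
     (\<forall>(U, \<phi>)\<in>A. \<forall>(V, \<psi>)\<in>A. smooth_map_on (\<phi> ` (U \<inter> V)) (\<psi> \<circ> inv_into U \<phi>))"

definition smooth_manifold :: "'m topology \<Rightarrow> ('m, 'n::finite) chart set \<Rightarrow> bool" where
  "smooth_manifold X A \<longleftrightarrow> Hausdorff_space X \<and> second_countable X \<and> smooth_atlas X A"


section \<open>Pseudo-Riemannian metrics in a chart\<close>

text \<open>The values of sections of \<open>S\<^sup>2T\<^sup>*\<close> are given by their components in the coordinate
  frame of a chart.\<close>

definition sym_matrices :: "(real^'n::finite^'n) set" where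
  "sym_matrices = {B. transpose B = B}"

text \<open>Existence of an orthonormal basis with \<open>p\<close> vectors of square \<open>1\<close> and \<open>q\<close> vectors of
  square \<open>-1\<close> (orthonormality makes the family \<open>b\<close> a basis, so \<open>B\<close> is nondegenerate).\<close>

definition has_signature :: "real^'n::finite^'n \<Rightarrow> nat \<Rightarrow> nat \<Rightarrow> bool" where
  "has_signature B p q \<longleftrightarrow>
     (\<exists>b :: 'n \<Rightarrow> real^'n.
        (\<forall>i j. i \<noteq> j \<longrightarrow> b i \<bullet> (B *v b j) = 0) \<and>
        (\<forall>i. b i \<bullet> (B *v b i) \<in> {1, -1}) \<and>
        card {i. b i \<bullet> (B *v b i) = 1} = p \<and>
        card {i. b i \<bullet> (B *v b i) = -1} = q)"

definition metric_on ::
  "nat \<Rightarrow> nat \<Rightarrow> (real^'n::finite) set \<Rightarrow> (real^'n \<Rightarrow> real^'n^'n) \<Rightarrow> bool" where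
  "metric_on p q U g \<longleftrightarrow>
     smooth_map_on U g \<and> (\<forall>y\<in>U. g y \<in> sym_matrices \<and> has_signature (g y) p q)"

definition christoffel ::
  "(real^'n::finite \<Rightarrow> real^'n^'n) \<Rightarrow> 'n \<Rightarrow> 'n \<Rightarrow> 'n \<Rightarrow> real^'n \<Rightarrow> real" where
  "christoffel g k i j y =
     (\<Sum>l\<in>UNIV. matrix_inv (g y) $ k $ l *
        (partial_deriv i (\<lambda>z. g z $ j $ l) y + partial_deriv j (\<lambda>z. g z $ i $ l) y
         - partial_deriv l (\<lambda>z. g z $ i $ j) y)) / 2"

text \<open>The component \<open>R\<^sup>a\<^sub>b\<^sub>c\<^sub>d\<close> of \<open>R(\<partial>\<^sub>c, \<partial>\<^sub>d)\<partial>\<^sub>b = R\<^sup>a\<^sub>b\<^sub>c\<^sub>d \<partial>\<^sub>a\<close>.\<close>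

definition riemann ::
  "(real^'n::finite \<Rightarrow> real^'n^'n) \<Rightarrow> 'n \<Rightarrow> 'n \<Rightarrow> 'n \<Rightarrow> 'n \<Rightarrow> real^'n \<Rightarrow> real" where
  "riemann g a b c d y =
     partial_deriv c (christoffel g a d b) y - partial_deriv d (christoffel g a c b) y
     + (\<Sum>e\<in>UNIV. christoffel g a c e y * christoffel g e d b y
                - christoffel g a d e y * christoffel g e c b y)"

definition ricci ::
  "(real^'n::finite \<Rightarrow> real^'n^'n) \<Rightarrow> 'n \<Rightarrow> 'n \<Rightarrow> real^'n \<Rightarrow> real" where
  "ricci g b d y = (\<Sum>a\<in>UNIV. riemann g a b a d y)"

definition scalar_curvature ::
  "(real^'n::finite \<Rightarrow> real^'n^'n) \<Rightarrow> real^'n \<Rightarrow> real" where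
  "scalar_curvature g y = (\<Sum>i\<in>UNIV. \<Sum>j\<in>UNIV. matrix_inv (g y) $ i $ j * ricci g i j y)"

definition einstein_operator ::
  "real \<Rightarrow> (real^'n::finite \<Rightarrow> real^'n^'n) \<Rightarrow> real^'n \<Rightarrow> real^'n^'n" where
  "einstein_operator \<Lambda> g y =
     (\<chi> i j. ricci g i j y - scalar_curvature g y * (g y $ i $ j) / 2 + \<Lambda> * (g y $ i $ j))"


section \<open>Jets of metrics and the Einstein equation\<close>

text \<open>In a chart, a jet of a metric at a given point is the family of the partial derivatives
  of its components; the list collects the indices of the partial derivatives, and entries
  beyond the order of the jet are \<open>0\<close>. A tensor in \<open>S\<^sup>tT\<^sup>* \<otimes> S\<^sup>2T\<^sup>*\<close> is encoded in the same way by
  its components \<open>f [a\<^sub>1, \<dots>, a\<^sub>t]\<close>, symmetric in the \<open>a\<^sub>i\<close>.\<close>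

type_synonym 'n jet = "'n list \<Rightarrow> real^'n^'n"

definition jet :: "nat \<Rightarrow> (real^'n::finite \<Rightarrow> real^'n^'n) \<Rightarrow> real^'n \<Rightarrow> 'n jet" where
  "jet l g y = (\<lambda>I. if length I \<le> l then partial_derivs I g y else 0)"

definition jet_proj :: "nat \<Rightarrow> 'n::finite jet \<Rightarrow> 'n jet" where
  "jet_proj l \<theta> = (\<lambda>I. if length I \<le> l then \<theta> I else 0)"

text \<open>The fibre over \<open>x\<close> of \<open>\<E>\<^sub>l \<subseteq> J\<^sup>l\<pi>\<close>, for \<open>l \<ge> 2\<close>, in the coordinates of the chart \<open>(U, \<phi>)\<close>. The
  total derivatives of the equation, evaluated on the jet of a section, are the partial
  derivatives of the equation evaluated on that section.\<close>

definition einstein_equation ::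
  "real \<Rightarrow> nat \<Rightarrow> nat \<Rightarrow> ('m, 'n::finite) chart \<Rightarrow> 'm \<Rightarrow> nat \<Rightarrow> 'n jet set" where
  "einstein_equation \<Lambda> p q = (\<lambda>(U, \<phi>) x l.
     {jet l g (\<phi> x) | g. \<exists>V. open V \<and> \<phi> x \<in> V \<and> V \<subseteq> \<phi> ` U \<and> metric_on p q V g \<and>
        (\<forall>K. length K \<le> l - 2 \<longrightarrow> partial_derivs K (einstein_operator \<Lambda> g) (\<phi> x) = 0)})"


section \<open>Symbol spaces\<close>

definition sym_tensors :: "nat \<Rightarrow> 'n::finite jet set" where
  "sym_tensors t = {f. (\<forall>I. f I \<in> sym_matrices) \<and> (\<forall>I. length I \<noteq> t \<longrightarrow> f I = 0) \<and>
                       (\<forall>I J. mset I = mset J \<longrightarrow> f I = f J)}"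

text \<open>Velocities of curves in \<open>S\<close> through \<open>\<theta>\<close>. Only finitely many components of the jets of a
  fixed order are not identically \<open>0\<close>, so componentwise differentiability is differentiability.\<close>

definition tangent_vectors :: "'n::finite jet set \<Rightarrow> 'n jet \<Rightarrow> 'n jet set" where
  "tangent_vectors S \<theta> =
     {v. \<exists>\<gamma> :: real \<Rightarrow> 'n jet. \<gamma> 0 = \<theta> \<and> (\<forall>\<^sub>F s in nhds 0. \<gamma> s \<in> S) \<and>
           (\<forall>I. ((\<lambda>s. \<gamma> s I) has_vector_derivative v I) (at 0))}"

text \<open>The tangent space to the fibre of \<open>\<E>\<^sub>k \<rightarrow> J\<^sup>k\<^sup>-\<^sup>1\<pi>\<close> at \<open>\<theta> \<in> E\<close>, where \<open>E\<close> is the fibre of \<open>\<E>\<^sub>k\<close> over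
  the base point of \<open>\<theta>\<close>.\<close>

definition vertical_symbol :: "nat \<Rightarrow> 'n::finite jet set \<Rightarrow> 'n jet \<Rightarrow> 'n jet set" where
  "vertical_symbol k E \<theta> = tangent_vectors {\<eta>\<in>E. jet_proj (k - 1) \<eta> = jet_proj (k - 1) \<theta>} \<theta>"

text \<open>The spaces \<open>\<gg>\<^sub>t\<close> for given \<open>\<gg>\<^sub>k = G\<close>. Membership in \<open>\<gg>\<^sub>k \<otimes> S\<^sup>t\<^sup>-\<^sup>kT\<^sup>*\<close> means that fixing the last
  \<open>t - k\<close> indices always yields an element of \<open>\<gg>\<^sub>k\<close>.\<close>

definition symbol_space :: "nat \<Rightarrow> 'n::finite jet set \<Rightarrow> nat \<Rightarrow> 'n jet set" where
  "symbol_space k G t =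
     (if t < k then sym_tensors t
      else if t = k then G
      else {f\<in>sym_tensors t. \<forall>J. length J = t - k \<longrightarrow>
              (\<lambda>I. if length I = k then f (I @ J) else 0) \<in> G})"


section \<open>Spencer cohomology\<close>

text \<open>Elements of \<open>S\<^sup>iT\<^sup>* \<otimes> S\<^sup>2T\<^sup>* \<otimes> \<Lambda>\<^sup>jT\<^sup>*\<close>: the first list holds the \<open>j\<close> skew-symmetric indices.\<close>

type_synonym 'n spencer = "'n list \<Rightarrow> 'n jet"

definition forms :: "nat \<Rightarrow> 'n::finite jet set \<Rightarrow> 'n spencer set" where
  "forms j W = {\<omega>. (\<forall>K. \<omega> K \<in> W) \<and> (\<forall>K. length K \<noteq> j \<longrightarrow> \<omega> K = 0) \<and>
     (\<forall>K a b. a < b \<and> b < length K \<longrightarrow> \<omega> (K[a := K ! b, b := K ! a]) = - \<omega> K)}"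

text \<open>Components of \<open>\<delta>(p\<^sup>i \<otimes> v \<otimes> \<omega>) = i p\<^sup>i\<^sup>-\<^sup>1 \<otimes> v \<otimes> (p \<and> \<omega>)\<close>: here \<open>i - 1\<close> is the length of \<open>I\<close>, and
  \<open>(p \<and> \<omega>)(K) = \<Sum>\<^sub>m (-1)\<^sup>m p(K\<^sub>m) \<omega>(K without K\<^sub>m)\<close>.\<close>

definition spencer_delta :: "'n::finite spencer \<Rightarrow> 'n spencer" where
  "spencer_delta \<omega> = (\<lambda>K I. real (Suc (length I)) *\<^sub>R
     (\<Sum>m<length K. (-1) ^ m *\<^sub>R \<omega> (take m K @ drop (Suc m) K) (K ! m # I)))"

definition spencer_cocycles :: "nat \<Rightarrow> 'n::finite jet set \<Rightarrow> nat \<Rightarrow> nat \<Rightarrow> 'n spencer set" where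
  "spencer_cocycles k G i j = {\<omega>\<in>forms j (symbol_space k G i). spencer_delta \<omega> = 0}"

definition spencer_coboundaries :: "nat \<Rightarrow> 'n::finite jet set \<Rightarrow> nat \<Rightarrow> nat \<Rightarrow> 'n spencer set" where
  "spencer_coboundaries k G i j =
     (if j = 0 then {0} else spencer_delta ` forms (j - 1) (symbol_space k G (Suc i)))"

definition spencer_cohomology ::
  "nat \<Rightarrow> 'n::finite jet set \<Rightarrow> nat \<Rightarrow> nat \<Rightarrow> 'n spencer set set" where
  "spencer_cohomology k G i j =
     (\<lambda>\<omega>. \<omega> +o spencer_coboundaries k G i j) ` spencer_cocycles k G i j"

text \<open>The zero coset is the space of coboundaries itself.\<close>

definition spencer_cohomology_zero :: "nat \<Rightarrow> 'n::finite jet set \<Rightarrow> nat \<Rightarrow> nat \<Rightarrow> bool" where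
  "spencer_cohomology_zero k G i j \<longleftrightarrow>
     spencer_cohomology k G i j = {spencer_coboundaries k G i j}"

text \<open>Linear isomorphism with a linear subspace \<open>V\<close>. The vector space operations of the quotient
  are given by representatives.\<close>

definition spencer_cohomology_iso ::
  "nat \<Rightarrow> 'n::finite jet set \<Rightarrow> nat \<Rightarrow> nat \<Rightarrow> 'v::real_vector set \<Rightarrow> bool" where
  "spencer_cohomology_iso k G i j V \<longleftrightarrow>
     (let Z = spencer_cocycles k G i j; cls = (\<lambda>\<omega>. \<omega> +o spencer_coboundaries k G i j) in
      \<exists>F. bij_betw F (spencer_cohomology k G i j) V \<and>
        (\<forall>\<omega>\<in>Z. \<forall>\<eta>\<in>Z. F (cls (\<omega> + \<eta>)) = F (cls \<omega>) + F (cls \<eta>)) \<and>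
        (\<forall>r. \<forall>\<omega>\<in>Z. F (cls (\<lambda>K I. r *\<^sub>R \<omega> K I)) = r *\<^sub>R F (cls \<omega>)))"


section \<open>Involutivity\<close>

definition involutive_symbol :: "nat \<Rightarrow> 'n::finite jet set \<Rightarrow> bool" where
  "involutive_symbol k G \<longleftrightarrow>
     (\<forall>i j. i \<noteq> k - 1 \<and> i + j > 0 \<longrightarrow> spencer_cohomology_zero k G i j)"

text \<open>\<open>\<E> c x l\<close> is the fibre over \<open>x\<close> of the equation (\<open>l = k\<close>) and its prolongations (\<open>l > k\<close>) in
  the coordinates of the chart \<open>c\<close>. Vanishing of \<open>W\<^sub>k\<close> is surjectivity of \<open>\<E>\<^sub>k\<^sub>+\<^sub>1 \<rightarrow> \<E>\<^sub>k\<close>.\<close>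

definition involutive_equation ::
  "('m, 'n::finite) chart set \<Rightarrow> nat \<Rightarrow> (('m, 'n) chart \<Rightarrow> 'm \<Rightarrow> nat \<Rightarrow> 'n jet set) \<Rightarrow> bool" where
  "involutive_equation A k \<E> \<longleftrightarrow>
     (\<forall>c\<in>A. \<forall>x\<in>fst c.
        (\<forall>\<theta>\<in>\<E> c x k. involutive_symbol k (vertical_symbol k (\<E> c x k) \<theta>)) \<and>
        jet_proj k ` \<E> c x (Suc k) = \<E> c x k)"

end

(*
  Write S, T for the vector spaces of symmetric 2-tensors and of covectors. The symbol of the
  equation is the kernel of the Ricci symbol sigma, since Ric - R g / 2 + L g and
  Ric - 2 L / (n - 2) g determine each other. Its prolongations are resolved by the complex of
  constant coefficient operators on formal power series
    S --sigma--> S --B--> T --> 0   (B the linearised Bianchi operator),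
  and a diagram chase with the Poincare lemma yields the Spencer cohomology: the three nonzero
  groups are the degree 0 parts of the three terms.

  Exactness in the middle is a gauge argument. Since
  2 sigma(h)_ij = - Box h_ij + d_i V_j + d_j V_i with V = B h, one solves Box h = - 2 r; then V is
  harmonic if B r = 0, and it is removed by a harmonic tracefree tensor with divergence - V. For
  three distinct indices i, j, c of an orthonormal frame with signs e (here n >= 3 is used) such a
  tensor for V = u dx_c has the components e_i d_i w, e_j d_j w, - e_c d_c w at jc, ic, ij, where
  d_i d_j w = e_i e_j u / 2. Harmonic antiderivatives come from the Cauchy problem for Box.

  Surjectivity of the projection of the first prolongation: by the contracted Bianchi identity the
  first derivatives of the defect at a point where the equation holds lie in the kernel of B, so
  they are removed by a cubic change of the metric.
*)

theory Submission
  imports Defs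
begin

section \<open>Symmetric tensors as formal power series\<close>

text \<open>Why the groups sit in these bidegrees: on polynomial forms the differential is exact
  except at constants, so only constants obstruct. A constant symmetric tensor is lifted by sigma to
  bidegree (2, 0) and differentiated to (1, 1). A constant covector is lifted by B to (1, 0),
  differentiated to (0, 1), lifted by sigma to (2, 1) and differentiated to (1, 2). Formal power
  series are used because there the Cauchy problem is a recursion on coefficients, whatever the
  signature; the homogeneous part of a formal solution is then cut out. The nonlinear equation is
  tied to its symbol by quasilinearity: if two metrics agree at a point up to order k + 1, then up
  to order k their Ricci tensors differ there exactly by sigma applied to the difference of the
  jets. Hence the fibre of the equation over a 1-jet is affine, and adding a polynomial realises
  every symbol direction. The constant 2 L / (n - 2) comes from the trace of the equation, R = 2 n L
  / (n - 2).\<close>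

definition symf :: "('n list \<Rightarrow> 'v) \<Rightarrow> bool" where
  "symf f \<longleftrightarrow> (\<forall>I J. mset I = mset J \<longrightarrow> f I = f J)"

lemma symfI: "(\<And>I J. mset I = mset J \<Longrightarrow> f I = f J) \<Longrightarrow> symf f"
  unfolding symf_def by blast

lemma symfD: "symf f \<Longrightarrow> mset I = mset J \<Longrightarrow> f I = f J"
  unfolding symf_def by blast

lemma symf_swap: "symf f \<Longrightarrow> f (a # b # I) = f (b # a # I)"
  by (erule symfD) simp

text \<open>Reading \<open>f I\<close> as the partial derivative at the origin along the indices in
  \<open>I\<close>, a symmetric family is a formal power series, and prepending \<open>a\<close> is
  differentiation in direction \<open>a\<close>.\<close>

lemma symf_shift: "symf f \<Longrightarrow> symf (\<lambda>I. f (a # I))"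
  by (simp add: symf_def)

lemma symf_comp: "symf f \<Longrightarrow> symf (\<lambda>I. h (f I))"
  unfolding symf_def by metis

lemma symf_binary: "symf f \<Longrightarrow> symf g \<Longrightarrow> symf (\<lambda>I. h (f I) (g I))"
  unfolding symf_def by metis

lemma symf_const: "symf (\<lambda>I. c)"
  by (simp add: symf_def)

lemma symf_sum: "(\<And>a. a \<in> S \<Longrightarrow> symf (f a)) \<Longrightarrow> symf (\<lambda>I. \<Sum>a\<in>S. f a I)"
  by (intro symfI sum.cong refl) (auto dest: symfD)

lemma symf_lambda: "(\<And>a. symf (f a)) \<Longrightarrow> symf (\<lambda>I. \<chi> a. f a I)"
  by (intro symfI) (simp add: vec_eq_iff, meson symfD)

lemmas symf_intros = symf_shift symf_const symf_sum symf_lambda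
  symf_binary[where h="(+)"] symf_binary[where h="(-)"] symf_comp[where h="uminus"]
  symf_comp[where h="\<lambda>x. c * x" for c] symf_comp[where h="\<lambda>x. c *\<^sub>R x" for c]
  symf_comp[where h="\<lambda>x. x $ i" for i] symf_comp[where h="\<lambda>x. x / c" for c]

text \<open>Adjacent exchanges generate all permutations: \<open>move\<close> carries a letter
  across \<open>xs\<close>, and an induction on \<open>I\<close> matches the two lists letter by
  letter behind a growing common prefix.\<close>

lemma symf_adjacent:
  assumes "\<And>xs x y ys. f (xs @ x # y # ys) = f (xs @ y # x # ys)"
  shows "symf f"
proof -
  have move: "f (zs @ xs @ a # ys) = f (zs @ a # xs @ ys)" for zs xs ys and a
  proof (induction xs arbitrary: zs)
    case (Cons b xs)
    have "f (zs @ (b # xs) @ a # ys) = f ((zs @ [b]) @ xs @ a # ys)" by simp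
    also have "\<dots> = f (zs @ b # a # xs @ ys)" using Cons.IH[of "zs @ [b]"] by simp
    finally show ?case using assms[of zs b a "xs @ ys"] by simp
  qed simp
  have "f (zs @ I) = f (zs @ J)" if "mset I = mset J" for zs I J
    using that
  proof (induction I arbitrary: zs J)
    case (Cons a I)
    then have "a \<in> set J" by (metis list.set_intros(1) set_mset_mset)
    then obtain xs ys where J: "J = xs @ a # ys" by (meson split_list)
    have "f (zs @ a # I) = f ((zs @ [a]) @ (xs @ ys))"
      using Cons.IH[of "xs @ ys" "zs @ [a]"] Cons.prems J by simp
    also have "\<dots> = f (zs @ J)" using move[of zs xs a ys] J by simp
    finally show ?case .
  qed simp
  note gen = this
  show ?thesis
  proof (rule symfI)
    fix I J :: "'a list" assume "mset I = mset J"
    then have "f ([] @ I) = f ([] @ J)" by (rule gen)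
    then show "f I = f J" by simp
  qed
qed

text \<open>Formal Cauchy problem for \<open>\<Sum>\<^sub>a e\<^sub>a \<partial>\<^sub>a\<^sup>2\<close> with data \<open>c\<close> on the hyperplane \<open>x\<^sub>k = 0\<close>.\<close>

function cauchy_solution ::
  "'n::finite \<Rightarrow> ('n \<Rightarrow> real) \<Rightarrow> ('n multiset \<Rightarrow> real) \<Rightarrow> ('n multiset \<Rightarrow> real) \<Rightarrow> 'n multiset \<Rightarrow> real"
  where
  "cauchy_solution k e c r M =
     (if count M k < 2 then c M
      else e k * (r (M - {#k, k#})
        - (\<Sum>a\<in>UNIV - {k}. e a * cauchy_solution k e c r (M - {#k, k#} + {#a, a#}))))"
  by pat_completeness auto
termination
  by (relation "Wellfounded.measure (\<lambda>(k, e, c, r, M). count M k)") auto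

declare cauchy_solution.simps[simp del]

text \<open>The equation expresses a coefficient with at least two indices \<open>k\<close> through
  coefficients with two fewer, \<open>e k\<close> being its own inverse; coefficients with at most
  one \<open>k\<close> are free data. Passing to multisets makes the recursion blind to the order of
  the indices.\<close>

lemma cauchy_problem:
  fixes e :: "'n::finite \<Rightarrow> real"
  assumes e: "e k * e k = 1" and r: "symf r" and c: "symf c"
  shows "\<exists>f. symf f \<and> (\<forall>I. (\<Sum>a\<in>UNIV. e a * f (a # a # I)) = r I) \<and>
    (\<forall>I. count (mset I) k < 2 \<longrightarrow> f I = c I)"
proof -
  have ms: "\<exists>G. \<forall>I. F I = G (mset I)" if F: "symf F" for F :: "'n list \<Rightarrow> real"
  proof (intro exI[of _ "\<lambda>M. F (SOME J. mset J = M)"] allI)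
      fix I :: "'n list"
      have "mset (SOME J. mset J = mset I) = mset I" by (rule someI) (rule refl)
      then show "F I = F (SOME J. mset J = mset I)" by (metis F symfD)
  qed
  obtain r' where r': "\<And>I. r I = r' (mset I)" using ms[OF r] by auto
  obtain c' where c': "\<And>I. c I = c' (mset I)" using ms[OF c] by auto
  define f where "f = (\<lambda>I. cauchy_solution k e c' r' (mset I))"
  show ?thesis
  proof (intro exI[of _ f] conjI allI impI)
    show "symf f" by (intro symfI) (simp add: f_def)
    show "f I = c I" if "count (mset I) k < 2" for I
      using that by (simp add: f_def c' cauchy_solution.simps)
    fix I
    have "e k * f (k # k # I) = (e k * e k) * (r I - (\<Sum>a\<in>UNIV - {k}. e a * f (a # a # I)))"
      unfolding f_def r' by (subst cauchy_solution.simps) (simp add: add_mset_commute)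
    then show "(\<Sum>a\<in>UNIV. e a * f (a # a # I)) = r I"
      by (simp add: e sum.remove[of UNIV k])
  qed
qed

text \<open>Two copies of \<open>k\<close> are traded for a pair of other indices, so the
  multiplicity of \<open>k\<close> drops until the data decide.\<close>

lemma cauchy_unique:
  fixes e :: "'n::finite \<Rightarrow> real"
  assumes e: "e k * e k = 1" and f: "symf f" "\<And>I. (\<Sum>a\<in>UNIV. e a * f (a # a # I)) = 0"
    and data: "\<And>I. count (mset I) k < 2 \<Longrightarrow> f I = 0"
  shows "f I = 0"
proof (induction "count (mset I) k" arbitrary: I rule: less_induct)
  case less
  show ?case
  proof (cases "count (mset I) k < 2")
    case False
    define J where "J = remove1 k (remove1 k I)"
    have I: "mset I = mset (k # k # J)" unfolding J_def
      using False by (simp add: multiset_eq_iff)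
    have "f (a # a # J) = 0" if "a \<noteq> k" for a
      using that False I by (intro less) auto
    then have "e k * f (k # k # J) = 0"
      using f(2)[of J] by (simp add: sum.remove[of UNIV k])
    then show ?thesis using e symfD[OF f(1) I] by auto
  qed (rule data)
qed

text \<open>Integration from the hyperplane \<open>x_a = 0\<close>: coefficients without
  \<open>a\<close> are 0. The antiderivative of 0 is then 0, which later keeps a zero source term
  zero.\<close>

lemma antiderivative:
  assumes "symf u"
  shows "\<exists>w. symf w \<and> (\<forall>I. w (a # I) = u I) \<and> ((\<forall>I. u I = 0) \<longrightarrow> (\<forall>I. w I = (0::real)))"
proof (intro exI conjI)
  let ?w = "\<lambda>I. if a \<in> set I then u (remove1 a I) else 0"
  show "symf ?w"
  proof (rule symfI)
    fix I J :: "'a list" assume m: "mset I = mset J"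
    then have "set I = set J" "mset (remove1 a I) = mset (remove1 a J)"
      by (auto dest: mset_eq_setD)
    then show "?w I = ?w J" using symfD[OF assms, of "remove1 a I" "remove1 a J"] by simp
  qed
qed (use assms in auto)

text \<open>For some \<open>k \<noteq> a\<close>, solve the wave equation with an antiderivative
  \<open>d\<close> of \<open>u\<close> as data on \<open>x_k = 0\<close> and an antiderivative
  \<open>r\<close> of \<open>Box u\<close> as source. Then \<open>\<partial>_a w - u\<close> solves
  the homogeneous equation with zero data, so it vanishes by uniqueness; and
  \<open>Box u = 0\<close> forces \<open>r = 0\<close>.\<close>

lemma harmonic_antiderivative:
  fixes e :: "'n::finite \<Rightarrow> real"
  assumes card: "CARD('n) \<ge> 2" and e: "\<And>a. e a * e a = 1" and u: "symf u"
  shows "\<exists>w. symf w \<and> (\<forall>I. w (a # I) = u I) \<and>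
    ((\<forall>I. (\<Sum>c\<in>UNIV. e c * u (c # c # I)) = 0) \<longrightarrow> (\<forall>I. (\<Sum>c\<in>UNIV. e c * w (c # c # I)) = 0))"
proof -
  have "UNIV \<noteq> {a}" using card by (metis card_1_singleton_iff is_singletonI is_singleton_altdef not_less_eq_eq numeral_2_eq_2 order_refl)
  then obtain k where k: "k \<noteq> a" by blast
  obtain d where d: "symf d" "\<forall>I. d (a # I) = u I" using antiderivative[OF u, of a] by blast
  let ?b = "\<lambda>I. \<Sum>c\<in>UNIV. e c * u (c # c # I)"
  have sb: "symf ?b" by (intro symf_intros u)
  obtain r where r: "symf r" "\<forall>I. r (a # I) = ?b I" "(\<forall>I. ?b I = 0) \<longrightarrow> (\<forall>I. r I = 0)"
    using antiderivative[OF sb, of a] by blast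
  obtain w where w: "symf w" "\<forall>I. (\<Sum>c\<in>UNIV. e c * w (c # c # I)) = r I"
    "\<forall>I. count (mset I) k < 2 \<longrightarrow> w I = d I"
    using cauchy_problem[where e=e and k=k, OF e r(1) d(1)] by blast
  have "w (a # I) - u I = 0" for I
  proof (rule cauchy_unique[where e=e and k=k, OF e, where f="\<lambda>I. w (a # I) - u I"])
    show "symf (\<lambda>I. w (a # I) - u I)" by (intro symf_intros w u)
    show "w (a # I) - u I = 0" if "count (mset I) k < 2" for I
      using w(3)[rule_format, of "a # I"] d(2) that k by simp
    show "(\<Sum>c\<in>UNIV. e c * (w (a # c # c # I) - u (c # c # I))) = 0" for I
    proof -
      have "w (a # c # c # I) = w (c # c # a # I)" for c by (rule symfD[OF w(1)]) simp
      then show ?thesis using w(2)[rule_format, of "a # I"] r(2)[rule_format, of I]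
        by (simp add: right_diff_distrib sum_subtractf)
    qed
  qed
  moreover have "(\<forall>I. ?b I = 0) \<longrightarrow> (\<forall>I. (\<Sum>c\<in>UNIV. e c * w (c # c # I)) = 0)"
    using r(3) w(2) by presburger
  ultimately show ?thesis using w(1) by (intro exI[of _ w]) simp
qed

subsection \<open>Linear change of frame\<close>

definition frame_deriv :: "('n::finite \<Rightarrow> 'n \<Rightarrow> real) \<Rightarrow> 'n \<Rightarrow> ('n list \<Rightarrow> real) \<Rightarrow> 'n list \<Rightarrow> real" where
  "frame_deriv b a f = (\<lambda>I. \<Sum>i\<in>UNIV. b a i * f (i # I))"

text \<open>Iterated frame derivatives at the origin: the coefficients of the same power series in
  linear coordinates adapted to the frame \<open>b\<close>.\<close>

primrec change_frame :: "('n::finite \<Rightarrow> 'n \<Rightarrow> real) \<Rightarrow> 'n list \<Rightarrow> ('n list \<Rightarrow> real) \<Rightarrow> real" where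
  "change_frame b [] f = f []"
| "change_frame b (a # I) f = change_frame b I (frame_deriv b a f)"

lemma symf_frame_deriv: "symf f \<Longrightarrow> symf (frame_deriv b a f)"
  unfolding frame_deriv_def by (intro symf_intros)

lemma frame_deriv_commute:
  assumes "symf f"
  shows "frame_deriv b a (frame_deriv c d f) = frame_deriv c d (frame_deriv b a f)"
proof
  fix I
  have "frame_deriv b a (frame_deriv c d f) I = (\<Sum>i\<in>UNIV. \<Sum>j\<in>UNIV. b a i * (c d j * f (j # i # I)))"
    by (simp add: frame_deriv_def sum_distrib_left)
  also have "\<dots> = (\<Sum>j\<in>UNIV. \<Sum>i\<in>UNIV. c d j * (b a i * f (i # j # I)))"
    by (subst sum.swap) (simp add: symf_swap[OF assms] mult.left_commute)
  finally show "frame_deriv b a (frame_deriv c d f) I = frame_deriv c d (frame_deriv b a f) I"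
    by (simp add: frame_deriv_def sum_distrib_left)
qed

lemma frame_deriv_sum:
  "frame_deriv b a (\<lambda>J. \<Sum>s\<in>S. k s * f s J) = (\<lambda>J. \<Sum>s\<in>S. k s * frame_deriv b a (f s) J)"
  unfolding frame_deriv_def sum_distrib_left
  by (rule ext, subst sum.swap) (simp add: mult.left_commute)

lemma change_frame_sum:
  "change_frame b I (\<lambda>J. \<Sum>s\<in>S. k s * f s J) = (\<Sum>s\<in>S. k s * change_frame b I (f s))"
  by (induction I arbitrary: f) (simp_all add: frame_deriv_sum)

lemma symf_change_frame: "symf f \<Longrightarrow> symf (\<lambda>I. change_frame b I f)"
proof (rule symf_adjacent)
  fix xs x y ys assume "symf f"
  then show "change_frame b (xs @ x # y # ys) f = change_frame b (xs @ y # x # ys) f"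
    by (induction xs arbitrary: f) (auto simp: frame_deriv_commute[of _ b y b x] intro: symf_frame_deriv)
qed

text \<open>Differentiating the transformed coefficients along \<open>b' i\<close> recombines the
  frame derivatives into the coordinate derivative along \<open>i\<close>, to which the induction
  hypothesis applies.\<close>

lemma change_frame_inverse:
  assumes inv: "\<And>i j. (\<Sum>a\<in>UNIV. b' i a * b a j) = (if i = j then 1 else 0)" and "symf f"
  shows "change_frame b' I (\<lambda>J. change_frame b J f) = f I"
  using assms(2)
proof (induction I arbitrary: f)
  case (Cons i I)
  have "frame_deriv b' i (\<lambda>J. change_frame b J f) = (\<lambda>J. change_frame b J (\<lambda>L. f (i # L)))"
  proof
    fix J
    have "frame_deriv b' i (\<lambda>J. change_frame b J f) J = (\<Sum>a\<in>UNIV. b' i a * change_frame b J (frame_deriv b a f))"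
      by (simp add: frame_deriv_def)
    also have "\<dots> = change_frame b J (\<lambda>L. \<Sum>a\<in>UNIV. b' i a * frame_deriv b a f L)"
      by (simp add: change_frame_sum)
    also have "(\<lambda>L. \<Sum>a\<in>UNIV. b' i a * frame_deriv b a f L) = (\<lambda>L. f (i # L))"
    proof
      fix L
      have "(\<Sum>a\<in>UNIV. b' i a * frame_deriv b a f L) = (\<Sum>j\<in>UNIV. (\<Sum>a\<in>UNIV. b' i a * b a j) * f (j # L))"
        unfolding frame_deriv_def sum_distrib_left sum_distrib_right
        by (subst sum.swap) (simp add: mult.assoc)
      then show "(\<Sum>a\<in>UNIV. b' i a * frame_deriv b a f L) = f (i # L)"
        by (simp add: inv if_distrib[of "\<lambda>x. x * _"] cong: if_cong)
    qed
    finally show "frame_deriv b' i (\<lambda>J. change_frame b J f) J = change_frame b J (\<lambda>L. f (i # L))" .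
  qed
  then show ?case using Cons.IH[OF symf_shift[OF Cons.prems]] by simp
qed simp

definition frame_box :: "('n::finite \<Rightarrow> 'n \<Rightarrow> real) \<Rightarrow> ('n \<Rightarrow> real) \<Rightarrow> ('n list \<Rightarrow> real) \<Rightarrow> 'n list \<Rightarrow> real" where
  "frame_box b e f = (\<lambda>I. \<Sum>a\<in>UNIV. e a * frame_deriv b a (frame_deriv b a f) I)"

lemma symf_frame_box: "symf f \<Longrightarrow> symf (frame_box b e f)"
  unfolding frame_box_def by (intro symf_intros symf_frame_deriv)

lemma change_frame_box:
  "change_frame b I (frame_box b e f) = (\<Sum>a\<in>UNIV. e a * change_frame b (a # a # I) f)"
  by (simp add: frame_box_def change_frame_sum)

context
  fixes b b' :: "'n::finite \<Rightarrow> 'n \<Rightarrow> real" and e :: "'n \<Rightarrow> real"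
  assumes inv1: "\<And>i j. (\<Sum>a\<in>UNIV. b' i a * b a j) = (if i = j then 1 else 0)"
    and inv2: "\<And>i j. (\<Sum>a\<in>UNIV. b i a * b' a j) = (if i = j then 1 else 0)"
    and e: "\<And>a. e a * e a = 1"
begin

lemma change_frame_eqI:
  assumes "symf f" "symf g" "\<And>I. change_frame b I f = change_frame b I g"
  shows "f = g"
proof
  fix I
  show "f I = g I"
    using change_frame_inverse[OF inv1 assms(1), of I] change_frame_inverse[OF inv1 assms(2), of I] assms(3)
    by simp
qed

text \<open>In the frame the operator is diagonal, so the Cauchy problem applies to the transformed
  coefficients of \<open>r\<close>; \<open>b'\<close> brings the solution back.\<close>

lemma frame_box_surj:
  assumes "symf r" shows "\<exists>f. symf f \<and> frame_box b e f = r"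
proof -
  obtain f0 where f0: "symf f0" "\<forall>I. (\<Sum>a\<in>UNIV. e a * f0 (a # a # I)) = change_frame b I r"
    using cauchy_problem[where e=e, OF e symf_change_frame[OF assms, of b] symf_const] by blast
  define f where "f = (\<lambda>I. change_frame b' I f0)"
  have f: "symf f" "\<And>I. change_frame b I f = f0 I"
    unfolding f_def using symf_change_frame[OF f0(1)] change_frame_inverse[OF inv2 f0(1)] by auto
  have "frame_box b e f = r"
    by (rule change_frame_eqI[OF symf_frame_box[OF f(1)] assms])
      (simp only: change_frame_box f(2) f0(2)[rule_format])
  with f(1) show ?thesis by blast
qed

lemma frame_deriv_surj:
  assumes card: "CARD('n) \<ge> 2" and u: "symf u"
  shows "\<exists>w. symf w \<and> frame_deriv b a w = u \<and> (frame_box b e u = 0 \<longrightarrow> frame_box b e w = 0)"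
proof -
  obtain w0 where w0: "symf w0" "\<forall>I. w0 (a # I) = change_frame b I u"
    "(\<forall>I. (\<Sum>c\<in>UNIV. e c * change_frame b (c # c # I) u) = 0) \<longrightarrow> (\<forall>I. (\<Sum>c\<in>UNIV. e c * w0 (c # c # I)) = 0)"
    using harmonic_antiderivative[where e=e, OF card e symf_change_frame[OF u, of b], of a] by blast
  define w where "w = (\<lambda>I. change_frame b' I w0)"
  have w: "symf w" "\<And>I. change_frame b I w = w0 I"
    unfolding w_def using symf_change_frame[OF w0(1)] change_frame_inverse[OF inv2 w0(1)] by auto
  have zero: "change_frame b I 0 = 0" for I
    using change_frame_sum[of b I "\<lambda>_. 0" _ "{}"] by (simp add: zero_fun_def)
  show ?thesis
  proof (intro exI[of _ w] conjI w(1))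
    show "frame_deriv b a w = u"
      by (rule change_frame_eqI[OF symf_frame_deriv[OF w(1)] u]) (metis w(2) w0(2) change_frame.simps(2))
    show "frame_box b e u = 0 \<longrightarrow> frame_box b e w = 0"
    proof (intro impI, rule change_frame_eqI[OF symf_frame_box[OF w(1)]])
      show "symf (0 :: 'n list \<Rightarrow> real)" by (simp add: symf_def)
      assume "frame_box b e u = 0"
      then have "(\<Sum>c\<in>UNIV. e c * change_frame b (c # c # I) u) = 0" for I
        using change_frame_box[of b I e u] zero by simp
      then show "change_frame b I (frame_box b e w) = change_frame b I 0" for I
        by (simp only: change_frame_box zero w(2) w0(3)[rule_format])
    qed
  qed
qed

end

section \<open>Symbols of the Ricci operator and of the Bianchi operator\<close>

text \<open>The second order part of the linearised Ricci operator, with the inverse metric frozen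
  to \<open>Q\<close>. List entries are derivatives, matrix indices are those of the tensor.\<close>

definition ric_symbol :: "real^'n::finite^'n \<Rightarrow> 'n jet \<Rightarrow> 'n jet" where
  "ric_symbol Q h = (\<lambda>I. \<chi> i j. (\<Sum>k\<in>UNIV. \<Sum>l\<in>UNIV. Q $ k $ l *
     (h (k # i # I) $ l $ j + h (k # j # I) $ l $ i - h (k # l # I) $ i $ j - h (i # j # I) $ k $ l)) / 2)"

text \<open>Divergence minus half the differential of the trace, both taken with
  \<open>Q\<close>.\<close>

definition bianchi_symbol :: "real^'n::finite^'n \<Rightarrow> 'n jet \<Rightarrow> 'n list \<Rightarrow> real^'n" where
  "bianchi_symbol Q r = (\<lambda>I. \<chi> j. \<Sum>k\<in>UNIV. \<Sum>l\<in>UNIV. Q $ k $ l * (r (k # I) $ l $ j - r (j # I) $ k $ l / 2))"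

definition box_symbol :: "real^'n::finite^'n \<Rightarrow> ('n list \<Rightarrow> real) \<Rightarrow> 'n list \<Rightarrow> real" where
  "box_symbol Q f = (\<lambda>I. \<Sum>k\<in>UNIV. \<Sum>l\<in>UNIV. Q $ k $ l * f (k # l # I))"

lemma sym_matrices_iff: "M \<in> sym_matrices \<longleftrightarrow> (\<forall>i j. M $ i $ j = M $ j $ i)"
  by (auto simp: sym_matrices_def transpose_def vec_eq_iff)

lemma symf_ric_symbol: "symf h \<Longrightarrow> symf (ric_symbol Q h)"
  unfolding ric_symbol_def by (intro symf_intros)

lemma symf_bianchi_symbol: "symf r \<Longrightarrow> symf (bianchi_symbol Q r)"
  unfolding bianchi_symbol_def by (intro symf_intros)

lemma ric_symbol_diff: "ric_symbol Q (f - g) = ric_symbol Q f - ric_symbol Q g"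
  by (simp add: fun_eq_iff ric_symbol_def vec_eq_iff flip: sum_subtractf diff_divide_distrib)
    (simp add: algebra_simps)

lemma ric_symbol_scale: "ric_symbol Q (\<lambda>I. c *\<^sub>R f I) = (\<lambda>I. c *\<^sub>R ric_symbol Q f I)"
  by (simp add: fun_eq_iff ric_symbol_def vec_eq_iff sum_distrib_left algebra_simps)

lemma bianchi_symbol_diff: "bianchi_symbol Q (f - g) = bianchi_symbol Q f - bianchi_symbol Q g"
  by (simp add: fun_eq_iff bianchi_symbol_def vec_eq_iff flip: sum_subtractf) (simp add: algebra_simps diff_divide_distrib)

lemma bianchi_symbol_scale: "bianchi_symbol Q (\<lambda>I. c *\<^sub>R f I) = (\<lambda>I. c *\<^sub>R bianchi_symbol Q f I)"
  by (simp add: fun_eq_iff bianchi_symbol_def vec_eq_iff sum_distrib_left algebra_simps)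

lemma bianchi_symbol_sum: "bianchi_symbol Q (\<lambda>I. \<Sum>s\<in>S. f s I) = (\<lambda>I. \<Sum>s\<in>S. bianchi_symbol Q (f s) I)"
proof (induction S rule: infinite_finite_induct)
  case (insert x S)
  have "bianchi_symbol Q (f x - (\<lambda>I. (-1) *\<^sub>R (\<Sum>s\<in>S. f s I))) = (\<lambda>I. \<Sum>s\<in>insert x S. bianchi_symbol Q (f s) I)"
    unfolding bianchi_symbol_diff bianchi_symbol_scale insert.IH using insert.hyps by (simp add: fun_eq_iff)
  moreover have "f x - (\<lambda>I. (-1) *\<^sub>R (\<Sum>s\<in>S. f s I)) = (\<lambda>I. \<Sum>s\<in>insert x S. f s I)"
    using insert.hyps by (simp add: fun_eq_iff)
  ultimately show ?case by simp
qed (simp_all add: bianchi_symbol_def vec_eq_iff fun_eq_iff)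

lemma box_symbol_linear:
  "box_symbol Q (\<lambda>I. f I + g I) = (\<lambda>I. box_symbol Q f I + box_symbol Q g I)"
  "box_symbol Q (\<lambda>I. f I - g I) = (\<lambda>I. box_symbol Q f I - box_symbol Q g I)"
  "box_symbol Q (\<lambda>I. c * f I) = (\<lambda>I. c * box_symbol Q f I)"
  "box_symbol Q (\<lambda>I. f I / c) = (\<lambda>I. box_symbol Q f I / c)"
  by (simp_all add: box_symbol_def fun_eq_iff algebra_simps sum.distrib sum_subtractf sum_distrib_left
      sum_divide_distrib)

lemma box_symbol_sum: "box_symbol Q (\<lambda>I. \<Sum>s\<in>S. f s I) = (\<lambda>I. \<Sum>s\<in>S. box_symbol Q (f s) I)"
proof (induction S rule: infinite_finite_induct)
  case (insert x S)
  then show ?case by (simp add: box_symbol_linear)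
qed (simp_all add: box_symbol_def)

lemma box_symbol_shift:
  assumes "symf f" shows "box_symbol Q (\<lambda>I. f (a # I)) = (\<lambda>I. box_symbol Q f (a # I))"
proof -
  have "f (a # k # l # I) = f (k # l # a # I)" for k l I by (rule symfD[OF assms]) simp
  then show ?thesis by (simp add: box_symbol_def)
qed

lemma box_bianchi_symbol:
  assumes "symf h"
  shows "box_symbol Q (\<lambda>I. bianchi_symbol Q h I $ j) I =
    bianchi_symbol Q (\<lambda>I. \<chi> i j. box_symbol Q (\<lambda>I. h I $ i $ j) I) I $ j"
proof -
  have s: "symf (\<lambda>I. h I $ i $ j)" for i j by (intro symf_intros assms)
  show ?thesis
    by (simp add: bianchi_symbol_def box_symbol_sum box_symbol_linear box_symbol_shift[OF s])
qed

context
  fixes Q :: "real^'n::finite^'n"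
  assumes Q_sym: "Q \<in> sym_matrices"
begin

lemma Q_swap: "Q $ i $ j = Q $ j $ i"
  using Q_sym by (simp add: sym_matrices_iff)

text \<open>In the symmetrised gradient of \<open>bianchi_symbol Q h\<close> the two half traces add
  up to the Hessian of the trace, which is the last summand of \<open>ric_symbol\<close>.\<close>

lemma ric_symbol_gauge:
  assumes h: "symf h"
  shows "ric_symbol Q h I $ i $ j =
    (bianchi_symbol Q h (i # I) $ j + bianchi_symbol Q h (j # I) $ i - box_symbol Q (\<lambda>I. h I $ i $ j) I) / 2"
  unfolding ric_symbol_def bianchi_symbol_def box_symbol_def
  by (simp add: sum.distrib[symmetric] sum_subtractf[symmetric])
    (intro sum.cong refl, simp add: algebra_simps symf_swap[OF h])

text \<open>By the gauge formula two terms must agree. The Bianchi operator sends the symmetrised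
  gradient of \<open>V\<close> to \<open>Box V\<close>, since the two gradients of the divergence of
  \<open>V\<close> cancel; it sends \<open>Box h\<close> to \<open>Box V\<close> as well, since
  constant coefficient operators commute.\<close>

lemma bianchi_ric_symbol:
  assumes h: "symf h"
  shows "bianchi_symbol Q (ric_symbol Q h) = 0"
proof (rule ext, simp add: vec_eq_iff, intro allI)
  fix I j
  define V where "V = bianchi_symbol Q h"
  have V: "symf V" unfolding V_def by (rule symf_bianchi_symbol[OF h])
  have r: "ric_symbol Q h I $ i $ j = (V (i # I) $ j + V (j # I) $ i - box_symbol Q (\<lambda>I. h I $ i $ j) I) / 2" for I i j
    unfolding V_def by (rule ric_symbol_gauge[OF h])
  let ?S = "\<lambda>f. \<Sum>k\<in>UNIV. \<Sum>l\<in>UNIV. Q $ k $ l * f k l"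
  have S_add: "?S (\<lambda>k l. f k l + g k l) = ?S f + ?S g" for f g :: "'n \<Rightarrow> 'n \<Rightarrow> real"
    by (simp add: algebra_simps sum.distrib)
  have S_diff: "?S (\<lambda>k l. f k l - g k l) = ?S f - ?S g" for f g :: "'n \<Rightarrow> 'n \<Rightarrow> real"
    by (simp add: algebra_simps sum_subtractf)
  have S_div: "?S (\<lambda>k l. f k l / 2) = ?S f / 2" for f :: "'n \<Rightarrow> 'n \<Rightarrow> real"
    by (simp add: sum_divide_distrib)
  have 1: "?S (\<lambda>k l. V (l # k # I) $ j) = box_symbol Q (\<lambda>I. V I $ j) I"
    by (simp add: box_symbol_def symf_swap[OF V])
  have 2: "?S (\<lambda>k l. V (l # j # I) $ k) = ?S (\<lambda>k l. V (k # j # I) $ l)"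
    by (subst sum.swap) (simp add: Q_swap)
  have 3: "?S (\<lambda>k l. V (j # k # I) $ l) = ?S (\<lambda>k l. V (k # j # I) $ l)"
    by (simp add: symf_swap[OF V, of j])
  have "box_symbol Q (\<lambda>I. V I $ j) I =
      ?S (\<lambda>k l. box_symbol Q (\<lambda>I. h I $ l $ j) (k # I) - box_symbol Q (\<lambda>I. h I $ k $ l) (j # I) / 2)"
    unfolding V_def box_bianchi_symbol[OF h] by (simp add: bianchi_symbol_def)
  then have 4: "?S (\<lambda>k l. box_symbol Q (\<lambda>I. h I $ l $ j) (k # I)) =
      box_symbol Q (\<lambda>I. V I $ j) I + ?S (\<lambda>k l. box_symbol Q (\<lambda>I. h I $ k $ l) (j # I)) / 2"
    by (simp only: S_diff S_div)
  have "bianchi_symbol Q (ric_symbol Q h) I $ j =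
    ?S (\<lambda>k l. (V (l # k # I) $ j + V (j # k # I) $ l - box_symbol Q (\<lambda>I. h I $ l $ j) (k # I)) / 2
       - (V (k # j # I) $ l + V (l # j # I) $ k - box_symbol Q (\<lambda>I. h I $ k $ l) (j # I)) / 2 / 2)"
    by (simp add: bianchi_symbol_def r)
  also have "\<dots> = 0" unfolding S_add S_diff S_div 1 2 3 4 by simp
  finally show "bianchi_symbol Q (ric_symbol Q h) I $ j = 0" .
qed

end

lemma ric_symbol_sym:
  assumes "symf h" "\<And>I. h I \<in> sym_matrices"
  shows "ric_symbol Q h I \<in> sym_matrices"
proof -
  have "h J $ i $ j = h J $ j $ i" for J i j using assms(2) by (simp add: sym_matrices_iff)
  moreover have "h (i # j # I) $ k $ l = h (j # i # I) $ k $ l" for i j k l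
    by (simp add: symf_swap[OF assms(1)])
  ultimately show ?thesis
    unfolding sym_matrices_iff ric_symbol_def by (simp add: add.commute)
qed

subsection \<open>Exactness\<close>

text \<open>\<open>Q\<close> is an inverse metric, \<open>b\<close> an orthonormal frame with signs
  \<open>e\<close>, and \<open>\<beta>\<close> the dual coframe.\<close>

locale orthonormal_frame =
  fixes Q :: "real^'n::finite^'n" and b \<beta> :: "'n \<Rightarrow> real^'n" and e :: "'n \<Rightarrow> real"
  assumes card: "CARD('n) \<ge> 3"
    and e: "e a * e a = 1"
    and Q: "Q $ i $ j = (\<Sum>a\<in>UNIV. e a * (b a $ i * b a $ j))"
    and inv1: "(\<Sum>a\<in>UNIV. \<beta> a $ i * b a $ j) = (if i = j then 1 else 0)"
    and inv2: "(\<Sum>i\<in>UNIV. b a $ i * \<beta> c $ i) = (if a = c then 1 else 0)"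
begin

lemma Q_sym: "Q \<in> sym_matrices"
  by (simp add: sym_matrices_iff Q mult.commute)

definition D :: "'n \<Rightarrow> ('n list \<Rightarrow> real) \<Rightarrow> 'n list \<Rightarrow> real" where
  "D = frame_deriv (\<lambda>a i. b a $ i)"

lemma symf_D: "symf f \<Longrightarrow> symf (D a f)"
  unfolding D_def by (rule symf_frame_deriv)

lemma box_symbol_frame:
  assumes "symf f" shows "box_symbol Q f = frame_box (\<lambda>a i. b a $ i) e f"
proof
  fix I
  have "box_symbol Q f I = (\<Sum>k\<in>UNIV. \<Sum>l\<in>UNIV. \<Sum>a\<in>UNIV. e a * (b a $ k * (b a $ l * f (l # k # I))))"
    by (simp add: box_symbol_def Q sum_distrib_left sum_distrib_right symf_swap[OF assms] mult.assoc)
  also have "\<dots> = (\<Sum>k\<in>UNIV. \<Sum>a\<in>UNIV. \<Sum>l\<in>UNIV. e a * (b a $ k * (b a $ l * f (l # k # I))))"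
    by (intro sum.cong refl sum.swap)
  also have "\<dots> = (\<Sum>a\<in>UNIV. \<Sum>k\<in>UNIV. \<Sum>l\<in>UNIV. e a * (b a $ k * (b a $ l * f (l # k # I))))"
    by (rule sum.swap)
  finally show "box_symbol Q f I = frame_box (\<lambda>a i. b a $ i) e f I"
    by (simp add: frame_box_def frame_deriv_def sum_distrib_left)
qed

lemma box_symbol_surj:
  assumes "symf r" shows "\<exists>f. symf f \<and> box_symbol Q f = r"
  using frame_box_surj[where b="\<lambda>a i. b a $ i" and b'="\<lambda>i a. \<beta> a $ i" and e=e, OF inv1 inv2 e assms]
  by (auto simp: box_symbol_frame)

lemma D_surj:
  assumes "symf u" shows "\<exists>w. symf w \<and> D a w = u \<and> (box_symbol Q u = 0 \<longrightarrow> box_symbol Q w = 0)"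
  using frame_deriv_surj[where b="\<lambda>a i. b a $ i" and b'="\<lambda>i a. \<beta> a $ i" and e=e and a=a, OF inv1 inv2 e _ assms] card
  by (auto simp: box_symbol_frame[OF assms] box_symbol_frame D_def)

lemma box_D:
  assumes "symf w" "box_symbol Q w = 0" shows "box_symbol Q (D a w) = 0"
proof -
  have "box_symbol Q (D a w) = D a (box_symbol Q w)"
    unfolding D_def frame_deriv_def box_symbol_sum box_symbol_linear box_symbol_shift[OF assms(1)] ..
  then show ?thesis using assms(2) by (simp add: D_def frame_deriv_def fun_eq_iff)
qed

lemma Q_coframe: "(\<Sum>l\<in>UNIV. Q $ k $ l * \<beta> a $ l) = e a * b a $ k"
proof -
  have "(\<Sum>l\<in>UNIV. Q $ k $ l * \<beta> a $ l) = (\<Sum>l\<in>UNIV. \<Sum>c\<in>UNIV. e c * b c $ k * (b c $ l * \<beta> a $ l))"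
    by (simp add: Q sum_distrib_right mult.assoc)
  also have "\<dots> = (\<Sum>c\<in>UNIV. e c * b c $ k * (\<Sum>l\<in>UNIV. b c $ l * \<beta> a $ l))"
    by (subst sum.swap) (simp add: sum_distrib_left)
  also have "\<dots> = e a * b a $ k"
    by (simp add: inv2 if_distrib[of "\<lambda>x. _ * x"] cong: if_cong)
  finally show ?thesis .
qed

lemma Q_coframe_coframe: "(\<Sum>k\<in>UNIV. \<Sum>l\<in>UNIV. Q $ k $ l * (\<beta> c $ k * \<beta> a $ l)) = (if a = c then e a else 0)"
proof -
  have "(\<Sum>k\<in>UNIV. \<Sum>l\<in>UNIV. Q $ k $ l * (\<beta> c $ k * \<beta> a $ l)) =
      (\<Sum>k\<in>UNIV. \<beta> c $ k * (\<Sum>l\<in>UNIV. Q $ k $ l * \<beta> a $ l))"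
    by (simp add: sum_distrib_left mult.left_commute)
  also have "\<dots> = e a * (\<Sum>k\<in>UNIV. b a $ k * \<beta> c $ k)"
    by (simp add: Q_coframe) (simp add: sum_distrib_left mult_ac)
  finally show ?thesis by (simp add: inv2)
qed

text \<open>The symmetric product of two coframe covectors with scalar coefficient \<open>v\<close>.
  For \<open>p \<noteq> q\<close> it is tracefree, so the Bianchi symbol reduces to the
  divergence.\<close>

definition sprod :: "'n \<Rightarrow> 'n \<Rightarrow> ('n list \<Rightarrow> real) \<Rightarrow> 'n jet" where
  "sprod p q v = (\<lambda>I. \<chi> l m. (\<beta> p $ l * \<beta> q $ m + \<beta> q $ l * \<beta> p $ m) * v I)"

lemma bianchi_sprod:
  assumes "p \<noteq> q"
  shows "bianchi_symbol Q (sprod p q v) I $ m = e p * D p v I * \<beta> q $ m + e q * D q v I * \<beta> p $ m"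
proof -
  have div: "(\<Sum>k\<in>UNIV. \<Sum>l\<in>UNIV. Q $ k $ l * (\<beta> a $ l * v (k # I))) = e a * D a v I" for a
  proof -
    have "(\<Sum>k\<in>UNIV. \<Sum>l\<in>UNIV. Q $ k $ l * (\<beta> a $ l * v (k # I))) =
        (\<Sum>k\<in>UNIV. (\<Sum>l\<in>UNIV. Q $ k $ l * \<beta> a $ l) * v (k # I))"
      by (simp add: sum_distrib_right mult.assoc)
    then show ?thesis by (simp add: Q_coframe D_def frame_deriv_def sum_distrib_left mult.assoc)
  qed
  have "bianchi_symbol Q (sprod p q v) I $ m =
      (\<Sum>k\<in>UNIV. \<Sum>l\<in>UNIV. Q $ k $ l * (\<beta> p $ l * v (k # I))) * \<beta> q $ m
    + (\<Sum>k\<in>UNIV. \<Sum>l\<in>UNIV. Q $ k $ l * (\<beta> q $ l * v (k # I))) * \<beta> p $ m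
    - ((\<Sum>k\<in>UNIV. \<Sum>l\<in>UNIV. Q $ k $ l * (\<beta> p $ k * \<beta> q $ l))
     + (\<Sum>k\<in>UNIV. \<Sum>l\<in>UNIV. Q $ k $ l * (\<beta> q $ k * \<beta> p $ l))) * v (m # I) / 2"
    unfolding bianchi_symbol_def sprod_def
    by (simp add: sum_distrib_right sum_divide_distrib flip: sum.distrib sum_subtractf)
      (intro sum.cong refl, simp add: field_simps)
  then show ?thesis using assms by (simp add: div Q_coframe_coframe)
qed

lemma divergence_surj1:
  assumes u: "symf u"
  shows "\<exists>k. symf k \<and> (\<forall>I. k I \<in> sym_matrices) \<and> (\<forall>I. bianchi_symbol Q k I = u I *\<^sub>R \<beta> c) \<and>
    (box_symbol Q u = 0 \<longrightarrow> (\<forall>i j. box_symbol Q (\<lambda>I. k I $ i $ j) = 0))"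
proof -
  have "\<not> UNIV \<subseteq> {c}" using card card_mono[of "{c}" UNIV] by auto
  then obtain i where i: "i \<noteq> c" by blast
  have "\<not> UNIV \<subseteq> {c, i}" using card card_mono[of "{c, i}" UNIV] i by auto
  then obtain j where j: "j \<noteq> c" "j \<noteq> i" by blast
  have u': "symf (\<lambda>I. e i * e j / 2 * u I)" by (intro symf_intros u)
  obtain w1 where w1: "symf w1" "D i w1 = (\<lambda>I. e i * e j / 2 * u I)"
      "box_symbol Q (\<lambda>I. e i * e j / 2 * u I) = 0 \<longrightarrow> box_symbol Q w1 = 0"
    using D_surj[OF u', of i] by blast
  obtain w where w: "symf w" "D j w = w1" "box_symbol Q w1 = 0 \<longrightarrow> box_symbol Q w = 0"
    using D_surj[OF w1(1), of j] by blast
  \<comment> \<open>In the divergence the coefficients of \<open>\<beta> i\<close> and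
    \<open>\<beta> j\<close> cancel because derivatives commute, and that of
    \<open>\<beta> c\<close> is \<open>2 * e i * e j * D i (D j w)\<close>, which the normalisation
    of \<open>w\<close> makes equal to \<open>u\<close>. Sums are written as differences of
    negatives to fit \<open>bianchi_symbol_diff\<close> and
    \<open>bianchi_symbol_scale\<close>.\<close>
  define k where "k = sprod j c (\<lambda>I. e i * D i w I) - ((\<lambda>I. (-1) *\<^sub>R sprod i c (\<lambda>I. e j * D j w I) I)
    - (\<lambda>I. (-1) *\<^sub>R sprod i j (\<lambda>I. e c * D c w I) I))"
  have Dc: "D a (\<lambda>I. s * f I) = (\<lambda>I. s * D a f I)" for a s f
    by (simp add: D_def frame_deriv_def sum_distrib_left mult.left_commute)
  have comm: "D a (D d w) = D d (D a w)" for a d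
    unfolding D_def by (rule frame_deriv_commute[OF w(1)])
  have DD: "D i (D j w) I = e i * e j / 2 * u I" for I using w(2) w1(2) by simp
  have e': "e a * (e a * x) = x" for a x using e[of a] by (simp flip: mult.assoc)
  have "bianchi_symbol Q k I $ m = u I * \<beta> c $ m" for I m
    unfolding k_def bianchi_symbol_diff bianchi_symbol_scale using i j
    by (simp add: bianchi_sprod Dc comm[of j i] comm[of j c] comm[of i c] DD mult_ac e')
  then have "\<forall>I. bianchi_symbol Q k I = u I *\<^sub>R \<beta> c" by (simp add: vec_eq_iff)
  moreover have "symf k"
    unfolding k_def sprod_def fun_diff_def by (intro symf_intros symf_D w)
  moreover have "\<forall>I. k I \<in> sym_matrices"
    by (simp add: sym_matrices_iff k_def sprod_def add.commute mult.commute)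
  moreover have "box_symbol Q (\<lambda>I. k I $ l $ m) = 0" if "box_symbol Q u = 0" for l m
  proof -
    have "box_symbol Q w = 0" using w(3) w1(3) that by (simp add: box_symbol_linear fun_eq_iff)
    from box_D[OF w(1) this] show ?thesis
      by (simp add: k_def sprod_def box_symbol_linear fun_eq_iff)
  qed
  ultimately show ?thesis by blast
qed

lemma divergence_surj:
  assumes V: "symf V"
  shows "\<exists>k. symf k \<and> (\<forall>I. k I \<in> sym_matrices) \<and> bianchi_symbol Q k = V \<and>
    ((\<forall>j. box_symbol Q (\<lambda>I. V I $ j) = 0) \<longrightarrow> (\<forall>i j. box_symbol Q (\<lambda>I. k I $ i $ j) = 0))"
proof -
  define u where "u = (\<lambda>c I. \<Sum>j\<in>UNIV. b c $ j * V I $ j)"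
  have u: "symf (u c)" for c unfolding u_def by (intro symf_intros V)
  let ?P = "\<lambda>c k. symf k \<and> (\<forall>I. k I \<in> sym_matrices) \<and>
      (\<forall>I. bianchi_symbol Q k I = u c I *\<^sub>R \<beta> c) \<and>
      (box_symbol Q (u c) = 0 \<longrightarrow> (\<forall>i j. box_symbol Q (\<lambda>I. k I $ i $ j) = 0))"
  have "\<forall>c. \<exists>k. ?P c k" by (intro allI divergence_surj1 u)
  from choice[OF this] obtain k where k: "\<forall>c. ?P c (k c)" ..
  let ?k = "\<lambda>I. \<Sum>c\<in>UNIV. k c I"
  have "bianchi_symbol Q ?k I $ i = V I $ i" for I i
  proof -
    have "bianchi_symbol Q ?k I $ i = (\<Sum>c\<in>UNIV. \<Sum>j\<in>UNIV. \<beta> c $ i * b c $ j * V I $ j)"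
      by (simp add: bianchi_symbol_sum k u_def sum_distrib_left mult_ac)
    also have "\<dots> = (\<Sum>j\<in>UNIV. (\<Sum>c\<in>UNIV. \<beta> c $ i * b c $ j) * V I $ j)"
      by (subst sum.swap) (simp add: sum_distrib_right)
    also have "\<dots> = V I $ i" by (simp add: inv1 if_distrib[of "\<lambda>x. x * _"] cong: if_cong)
    finally show ?thesis .
  qed
  then have "bianchi_symbol Q ?k = V" by (simp add: fun_eq_iff vec_eq_iff)
  moreover have "symf ?k" using k by (intro symf_intros) blast
  moreover have "\<forall>I. ?k I \<in> sym_matrices" using k by (simp add: sym_matrices_iff)
  moreover have "box_symbol Q (\<lambda>I. ?k I $ i $ j) = 0" if "\<forall>j. box_symbol Q (\<lambda>I. V I $ j) = 0" for i j
  proof -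
    have "box_symbol Q (u c) = 0" for c
      using that by (simp add: u_def box_symbol_sum box_symbol_linear fun_eq_iff)
    then show ?thesis using k by (simp add: box_symbol_sum fun_eq_iff)
  qed
  ultimately show ?thesis by blast
qed

lemma ric_symbol_exact:
  assumes r: "symf r" "\<And>I. r I \<in> sym_matrices" "bianchi_symbol Q r = 0"
  shows "\<exists>h. symf h \<and> (\<forall>I. h I \<in> sym_matrices) \<and> ric_symbol Q h = r"
proof -
  have r_swap: "r I $ i $ j = r I $ j $ i" for I i j using r(2) by (simp add: sym_matrices_iff)
  obtain S where S: "\<And>f. symf f \<Longrightarrow> symf (S f) \<and> box_symbol Q (S f) = f"
    using box_symbol_surj by metis
  have r': "symf (\<lambda>I. - 2 * r I $ i $ j)" for i j by (intro symf_intros r)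
  \<comment> \<open>One fixed solution operator \<open>S\<close> makes \<open>h\<close> symmetric:
    the entries \<open>i j\<close> and \<open>j i\<close> solve the wave equation with the same
    right-hand side.\<close>
  define h where "h = (\<lambda>I. \<chi> i j. S (\<lambda>I. - 2 * r I $ i $ j) I)"
  have eq: "(\<lambda>I. - 2 * r I $ i $ j) = (\<lambda>I. - 2 * r I $ j $ i)" for i j
    by (rule ext, subst r_swap, rule refl)
  have h: "symf h" "\<And>I. h I \<in> sym_matrices" "\<And>i j. box_symbol Q (\<lambda>I. h I $ i $ j) = (\<lambda>I. - 2 * r I $ i $ j)"
  proof -
    show "symf h" unfolding h_def using S[OF r'] by (intro symf_intros) blast
    show "h I \<in> sym_matrices" for I
      unfolding sym_matrices_iff
    proof (intro allI)
      fix i j show "h I $ i $ j = h I $ j $ i" by (simp add: h_def, subst eq[simplified], rule refl)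
    qed
    show "box_symbol Q (\<lambda>I. h I $ i $ j) = (\<lambda>I. - 2 * r I $ i $ j)" for i j
      using S[OF r', of i j] by (simp add: h_def)
  qed
  define V where "V = (\<lambda>I. (-1) *\<^sub>R bianchi_symbol Q h I)"
  have V: "symf V" unfolding V_def by (intro symf_intros symf_bianchi_symbol h)
  have "(\<lambda>I. \<chi> i j. - 2 * r I $ i $ j) = (\<lambda>I. (- 2) *\<^sub>R r I)" by (simp add: fun_eq_iff vec_eq_iff)
  then have "box_symbol Q (\<lambda>I. bianchi_symbol Q h I $ j) I = bianchi_symbol Q (\<lambda>I. (- 2) *\<^sub>R r I) I $ j" for I j
    unfolding box_bianchi_symbol[OF h(1)] h(3) by simp
  then have "box_symbol Q (\<lambda>I. bianchi_symbol Q h I $ j) I = 0" for I j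
    unfolding bianchi_symbol_scale r(3) by simp
  then have "box_symbol Q (\<lambda>I. V I $ j) I = 0" for I j
    using box_symbol_linear(3)[of Q "-1" "\<lambda>I. bianchi_symbol Q h I $ j"] by (simp add: V_def fun_eq_iff)
  then obtain k where k: "symf k" "\<forall>I. k I \<in> sym_matrices" "bianchi_symbol Q k = V"
      "\<forall>i j. box_symbol Q (\<lambda>I. k I $ i $ j) = 0"
    using divergence_surj[OF V] by (auto simp: fun_eq_iff)
  define h' where "h' = h - (\<lambda>I. (-1) *\<^sub>R k I)"
  have h': "symf h'" unfolding h'_def fun_diff_def by (intro symf_intros h k)
  have "bianchi_symbol Q h' = 0"
    unfolding h'_def bianchi_symbol_diff bianchi_symbol_scale k(3) V_def by (simp add: fun_eq_iff)
  moreover have "box_symbol Q (\<lambda>I. h' I $ i $ j) = (\<lambda>I. - 2 * r I $ i $ j)" for i j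
  proof -
    have "box_symbol Q (\<lambda>I. h I $ i $ j + k I $ i $ j) = (\<lambda>I. - 2 * r I $ i $ j)"
      unfolding box_symbol_linear h(3) using k(4) by simp
    then show ?thesis by (simp add: h'_def)
  qed
  ultimately have "ric_symbol Q h' I $ i $ j = r I $ i $ j" for I i j
    by (simp add: ric_symbol_gauge[OF Q_sym h'])
  then have "ric_symbol Q h' = r" by (simp add: fun_eq_iff vec_eq_iff)
  moreover have "\<forall>I. h' I \<in> sym_matrices"
    using h(2) k(2) by (simp add: h'_def sym_matrices_iff)
  ultimately show ?thesis using h' by blast
qed

end

section \<open>The Poincare lemma for polynomial forms\<close>

text \<open>The operator \<open>\<delta>\<close> without the factor \<open>length I + 1\<close>, by recursion on the skew-symmetric indices.\<close>

primrec form_deriv :: "('n list \<Rightarrow> 'n list \<Rightarrow> 'v::real_vector) \<Rightarrow> 'n list \<Rightarrow> 'n list \<Rightarrow> 'v" where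
  "form_deriv \<omega> [] = (\<lambda>I. 0)"
| "form_deriv \<omega> (x # K) = (\<lambda>I. \<omega> K (x # I) - form_deriv (\<lambda>L. \<omega> (x # L)) K I)"

text \<open>Contraction with the Euler vector field: each symmetric index in turn is moved to the
  front of the skew ones.\<close>

primrec form_homotopy :: "('n list \<Rightarrow> 'n list \<Rightarrow> 'v::real_vector) \<Rightarrow> 'n list \<Rightarrow> 'n list \<Rightarrow> 'v" where
  "form_homotopy \<omega> K [] = 0"
| "form_homotopy \<omega> K (x # I) = \<omega> (x # K) I + form_homotopy (\<lambda>L J. \<omega> L (x # J)) K I"

text \<open>Only neighbours are exchanged, the form suited to induction on lists;
  \<open>altf_iff_list_update\<close> relates it to the exchange of arbitrary positions in
  \<open>forms\<close>.\<close>

definition altf :: "('n list \<Rightarrow> 'w::ab_group_add) \<Rightarrow> bool" where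
  "altf F \<longleftrightarrow> (\<forall>xs x y ys. F (xs @ x # y # ys) = - F (xs @ y # x # ys))"

lemma altfD: "altf F \<Longrightarrow> F (xs @ x # y # ys) = - F (xs @ y # x # ys)"
  unfolding altf_def by blast

lemma altf_Cons: "altf F \<Longrightarrow> altf (\<lambda>K. F (x # K))"
  unfolding altf_def by (metis append_Cons)

lemma altf_shift:
  fixes F :: "'n list \<Rightarrow> 'n list \<Rightarrow> 'v::ab_group_add"
  assumes "altf F" shows "altf (\<lambda>K I. F K (y # I))"
  unfolding altf_def
proof (intro allI ext)
  fix xs x z ys I
  show "F (xs @ x # z # ys) (y # I) = (- (\<lambda>I. F (xs @ z # x # ys) (y # I))) I"
    using altfD[OF assms, of xs x z ys] by simp
qed

text \<open>Moving \<open>v\<close> across \<open>z\<close>, exchanging, and moving \<open>u\<close>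
  back across \<open>z\<close> costs one sign more than an even number.\<close>

lemma altf_transposition:
  assumes "altf F" shows "F (xs @ v # zs @ u # ys) = - F (xs @ u # zs @ v # ys)"
proof (induction zs arbitrary: xs)
  case Nil
  show ?case using altfD[OF assms, of xs v u ys] by simp
next
  case (Cons z zs)
  have "F (xs @ v # (z # zs) @ u # ys) = - F (xs @ z # v # zs @ u # ys)"
    using altfD[OF assms, of xs v z] by simp
  also have "\<dots> = F (xs @ z # u # zs @ v # ys)" using Cons.IH[of "xs @ [z]"] by simp
  also have "\<dots> = - F (xs @ u # z # zs @ v # ys)" using altfD[OF assms, of xs z u] by simp
  finally show ?case by simp
qed

lemma altf_iff_list_update:
  "altf F \<longleftrightarrow> (\<forall>K a b. a < b \<and> b < length K \<longrightarrow> F (K[a := K ! b, b := K ! a]) = - F K)"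
proof (intro iffI allI impI)
  fix K :: "'a list" and a b assume "altf F" and ab: "a < b \<and> b < length K"
  define xs zs ys where "xs = take a K" and "zs = drop (Suc a) (take b K)" and "ys = drop (Suc b) K"
  have K: "K = xs @ K ! a # zs @ K ! b # ys"
  proof -
    have "take b K = xs @ K ! a # zs"
      using ab id_take_nth_drop[of a "take b K"] by (simp add: xs_def zs_def min_def)
    then show ?thesis using ab id_take_nth_drop[of b K] by (simp add: ys_def)
  qed
  have len: "length xs = a" "length zs = b - Suc a" using ab by (auto simp: xs_def zs_def)
  have "K[a := K ! b, b := K ! a] = xs @ K ! b # zs @ K ! a # ys"
    using ab len by (subst K, subst K) (simp add: list_update_append Suc_diff_Suc[symmetric])
  then show "F (K[a := K ! b, b := K ! a]) = - F K"
    using altf_transposition[OF \<open>altf F\<close>, of xs "K ! b" zs "K ! a" ys] K by simp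
next
  assume *: "\<forall>K a b. a < b \<and> b < length K \<longrightarrow> F (K[a := K ! b, b := K ! a]) = - F K"
  show "altf F" unfolding altf_def
  proof (intro allI)
    fix xs x y ys
    show "F (xs @ x # y # ys) = - F (xs @ y # x # ys)"
      using *[rule_format, of "length xs" "Suc (length xs)" "xs @ y # x # ys"]
      by (simp add: list_update_append nth_append)
  qed
qed

lemma form_deriv_diff:
  "form_deriv (\<lambda>K I. \<omega> K I - \<eta> K I) = (\<lambda>K I. form_deriv \<omega> K I - form_deriv \<eta> K I)"
proof (intro ext)
  fix K I show "form_deriv (\<lambda>K I. \<omega> K I - \<eta> K I) K I = form_deriv \<omega> K I - form_deriv \<eta> K I"
    by (induction K arbitrary: \<omega> \<eta>) simp_all
qed

lemma form_deriv_add: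
  "form_deriv (\<lambda>K I. \<omega> K I + \<eta> K I) = (\<lambda>K I. form_deriv \<omega> K I + form_deriv \<eta> K I)"
proof (intro ext)
  fix K I show "form_deriv (\<lambda>K I. \<omega> K I + \<eta> K I) K I = form_deriv \<omega> K I + form_deriv \<eta> K I"
    by (induction K arbitrary: \<omega> \<eta>) simp_all
qed

lemma form_deriv_scale:
  "form_deriv (\<lambda>K I. c *\<^sub>R \<omega> K I) = (\<lambda>K I. c *\<^sub>R form_deriv \<omega> K I)"
proof (intro ext)
  fix K I show "form_deriv (\<lambda>K I. c *\<^sub>R \<omega> K I) K I = c *\<^sub>R form_deriv \<omega> K I"
    by (induction K arbitrary: \<omega>) (simp_all add: scaleR_diff_right)
qed

lemma form_deriv_uminus: "form_deriv (\<lambda>K I. - \<omega> K I) = (\<lambda>K I. - form_deriv \<omega> K I)"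
  using form_deriv_scale[of "-1" \<omega>] by simp

lemma form_homotopy_add:
  "form_homotopy (\<lambda>K I. \<omega> K I + \<eta> K I) = (\<lambda>K I. form_homotopy \<omega> K I + form_homotopy \<eta> K I)"
proof (intro ext)
  fix K I show "form_homotopy (\<lambda>K I. \<omega> K I + \<eta> K I) K I = form_homotopy \<omega> K I + form_homotopy \<eta> K I"
    by (induction I arbitrary: \<omega> \<eta>) simp_all
qed

lemma form_homotopy_scale:
  "form_homotopy (\<lambda>K I. c *\<^sub>R \<omega> K I) = (\<lambda>K I. c *\<^sub>R form_homotopy \<omega> K I)"
proof (intro ext)
  fix K I show "form_homotopy (\<lambda>K I. c *\<^sub>R \<omega> K I) K I = c *\<^sub>R form_homotopy \<omega> K I"
    by (induction I arbitrary: \<omega>) (simp_all add: scaleR_add_right)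
qed

lemma form_homotopy_diff:
  "form_homotopy (\<lambda>K I. \<omega> K I - \<eta> K I) = (\<lambda>K I. form_homotopy \<omega> K I - form_homotopy \<eta> K I)"
  using form_homotopy_add[of \<omega> "\<lambda>K I. (-1) *\<^sub>R \<eta> K I"] by (simp add: form_homotopy_scale[of "-1", simplified])

lemma form_deriv_shift:
  assumes "\<And>K. symf (\<omega> K)" shows "form_deriv \<omega> K (x # I) = form_deriv (\<lambda>L J. \<omega> L (x # J)) K I"
  using assms
proof (induction K arbitrary: \<omega>)
  case (Cons y K)
  then show ?case using symf_swap[of "\<omega> K" x y I] Cons.IH[of "\<lambda>L. \<omega> (y # L)"] Cons.prems by simp
qed simp

lemma form_deriv_Cons:
  "form_deriv \<omega> (x # K) = (\<lambda>I. \<omega> K (x # I) - form_deriv (\<lambda>L. \<omega> (x # L)) K I)"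
  by simp

lemma altf_form_deriv:
  assumes "altf \<omega>" shows "altf (form_deriv \<omega>)"
  unfolding altf_def
proof (intro allI)
  fix xs x y ys
  show "form_deriv \<omega> (xs @ x # y # ys) = - form_deriv \<omega> (xs @ y # x # ys)"
    using assms
  proof (induction xs arbitrary: \<omega>)
    case Nil
    have "(\<lambda>L. \<omega> (x # y # L)) = (\<lambda>L J. - \<omega> (y # x # L) J)"
      using altfD[OF Nil, of "[]" x y] by (simp add: fun_eq_iff)
    then have "form_deriv (\<lambda>L. \<omega> (x # y # L)) ys = (\<lambda>I. - form_deriv (\<lambda>L. \<omega> (y # x # L)) ys I)"
      using form_deriv_uminus[of "\<lambda>L. \<omega> (y # x # L)"] by simp
    then show ?case by (simp add: fun_eq_iff)
  next
    case (Cons z xs)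
    show ?case using Cons.IH[OF altf_Cons[OF Cons.prems, of z]] altfD[OF Cons.prems, of xs x y ys]
      by (simp add: fun_eq_iff)
  qed
qed

lemma symf_form_deriv: "(\<And>K. symf (\<omega> K)) \<Longrightarrow> symf (form_deriv \<omega> K)"
proof (induction K arbitrary: \<omega>)
  case (Cons x K)
  have "symf (form_deriv (\<lambda>L. \<omega> (x # L)) K)" by (rule Cons.IH) (rule Cons.prems)
  then show ?case unfolding form_deriv_Cons by (intro symf_intros Cons.prems)
qed (simp add: symf_const)

lemma form_deriv_in:
  assumes "subspace W" "\<And>K I. \<omega> K I \<in> W" shows "form_deriv \<omega> K I \<in> W"
  using assms(2) by (induction K arbitrary: \<omega>) (auto intro: subspace_diff[OF assms(1)] subspace_0[OF assms(1)])

lemma form_deriv_length: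
  assumes "\<And>K I. length K \<noteq> j \<or> length I \<noteq> Suc i \<Longrightarrow> \<omega> K I = 0"
  shows "length K \<noteq> Suc j \<or> length I \<noteq> i \<Longrightarrow> form_deriv \<omega> K I = 0"
  using assms
proof (induction K arbitrary: \<omega> j)
  case (Cons x K)
  show ?case
  proof (cases j)
    case 0
    have eq: "(\<lambda>L. \<omega> (x # L)) = (\<lambda>L J. 0)"
      using Cons.prems(2) 0 by (intro ext) simp
    have "form_deriv (\<lambda>L. \<omega> (x # L)) K I = 0"
      unfolding eq using fun_cong[OF fun_cong[OF form_deriv_scale[of 0 "\<lambda>L. \<omega> (x # L)"]], of K I] by simp
    then show ?thesis using Cons.prems 0 by simp
  next
    case (Suc j')
    have "form_deriv (\<lambda>L. \<omega> (x # L)) K I = 0"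
      using Cons.prems Suc by (intro Cons.IH[of j']) auto
    then show ?thesis using Cons.prems by simp
  qed
qed simp

text \<open>The recursion is Cartan's formula \<open>i_x d = \<partial>_x - d i_x\<close> for a
  coordinate field. Hence \<open>i_x d d = \<partial>_x d - d \<partial>_x + d d i_x\<close>, where
  \<open>\<partial>_x\<close> commutes with \<open>d\<close> and the last term is the induction
  hypothesis.\<close>

lemma form_deriv_deriv:
  assumes "\<And>K. symf (\<omega> K)" shows "form_deriv (form_deriv \<omega>) K I = 0"
  using assms
proof (induction K arbitrary: \<omega>)
  case (Cons x K)
  have "form_deriv (form_deriv \<omega>) (x # K) I = form_deriv (\<lambda>L J. \<omega> L (x # J)) K I
      - form_deriv (\<lambda>L J. \<omega> L (x # J) - form_deriv (\<lambda>L. \<omega> (x # L)) L J) K I"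
    by (simp add: form_deriv_shift[OF Cons.prems])
  then show ?case unfolding form_deriv_diff using Cons.IH[of "\<lambda>L. \<omega> (x # L)"] Cons.prems by simp
qed simp

text \<open>Contractions with two vector fields, here a coordinate field and the Euler field,
  anticommute.\<close>

lemma form_homotopy_Cons:
  assumes "altf \<omega>" shows "form_homotopy \<omega> (x # K) I = - form_homotopy (\<lambda>L. \<omega> (x # L)) K I"
  using assms
proof (induction I arbitrary: \<omega>)
  case (Cons y I)
  have "altf (\<lambda>L J. \<omega> L (y # J))" by (rule altf_shift[OF Cons.prems])
  from Cons.IH[OF this] show ?case
    using altfD[OF Cons.prems, of "[]" y x K] by (simp add: fun_eq_iff)
qed simp

lemma altf_form_homotopy:
  assumes "altf \<omega>" shows "altf (form_homotopy \<omega>)"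
proof -
  have anti: "form_homotopy \<omega> (xs @ x # y # ys) I = - form_homotopy \<omega> (xs @ y # x # ys) I" for xs x y ys I
    using assms
  proof (induction I arbitrary: \<omega>)
    case (Cons z I)
    have "altf (\<lambda>L J. \<omega> L (z # J))" by (rule altf_shift[OF Cons.prems])
    from Cons.IH[OF this] show ?case
      using altfD[OF Cons.prems, of "z # xs" x y ys] by (simp add: fun_eq_iff)
  qed simp
  show ?thesis unfolding altf_def by (intro allI ext) (subst anti, simp)
qed

lemma symf_form_homotopy:
  assumes "\<And>K. symf (\<omega> K)" shows "symf (form_homotopy \<omega> K)"
proof (rule symf_adjacent)
  fix xs x y ys
  show "form_homotopy \<omega> K (xs @ x # y # ys) = form_homotopy \<omega> K (xs @ y # x # ys)"
    using assms
  proof (induction xs arbitrary: \<omega>)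
    case Nil
    have "(\<lambda>L J. \<omega> L (x # y # J)) = (\<lambda>L J. \<omega> L (y # x # J))"
      using symf_swap[OF Nil] by (intro ext) blast
    then show ?case by (simp add: add.left_commute)
  next
    case (Cons z xs)
    have "\<omega> (z # K) (xs @ x # y # ys) = \<omega> (z # K) (xs @ y # x # ys)"
      by (rule symfD[OF Cons.prems]) simp
    then show ?case using Cons.IH[of "\<lambda>L J. \<omega> L (z # J)"] symf_shift[OF Cons.prems] by simp
  qed
qed

lemma form_homotopy_in:
  assumes "subspace W" "\<And>K I. \<omega> K I \<in> W" shows "form_homotopy \<omega> K I \<in> W"
  using assms(2) by (induction I arbitrary: \<omega>) (auto intro: subspace_add[OF assms(1)] subspace_0[OF assms(1)])

lemma form_homotopy_length:
  assumes "\<And>K I. length K \<noteq> Suc j \<or> length I \<noteq> i \<Longrightarrow> \<omega> K I = 0"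
  shows "length K \<noteq> j \<or> length I \<noteq> Suc i \<Longrightarrow> form_homotopy \<omega> K I = 0"
  using assms
proof (induction I arbitrary: \<omega> i)
  case (Cons x I)
  show ?case
  proof (cases i)
    case 0
    have "(\<lambda>L J. \<omega> L (x # J)) = (\<lambda>L J. 0 *\<^sub>R 0)"
      using Cons.prems(2) 0 by (intro ext) simp
    then show ?thesis using Cons.prems 0 by (simp add: form_homotopy_scale[of 0, simplified])
  next
    case (Suc i')
    have "form_homotopy (\<lambda>L J. \<omega> L (x # J)) K I = 0"
      using Cons.prems Suc by (intro Cons.IH[of i']) auto
    then show ?thesis using Cons.prems by simp
  qed
qed simp

text \<open>Cartan's formula for the Lie derivative along the Euler field, which acts on homogeneous
  forms as multiplication by the total degree. The shift by a symmetric index commutes with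
  \<open>form_deriv\<close> and produces the inductive step in \<open>I\<close>; the case of an
  empty \<open>I\<close> is an induction on \<open>K\<close>.\<close>

lemma form_homotopy_formula:
  assumes "altf \<omega>" "\<And>K. symf (\<omega> K)"
  shows "form_deriv (form_homotopy \<omega>) K I + form_homotopy (form_deriv \<omega>) K I =
    real (length K + length I) *\<^sub>R \<omega> K I"
  using assms
proof (induction I arbitrary: \<omega>)
  case Nil
  then show ?case
  proof (induction K arbitrary: \<omega>)
    case (Cons x K)
    have "(\<lambda>L J. form_homotopy \<omega> (x # L) J) = (\<lambda>L J. - form_homotopy (\<lambda>L. \<omega> (x # L)) L J)"
      by (intro ext form_homotopy_Cons Cons.prems)
    then show ?case using Cons.IH[OF altf_Cons[OF Cons.prems(1)]] Cons.prems(2)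
      by (simp add: form_deriv_uminus scaleR_left_distrib)
  qed simp
next
  case (Cons x I)
  let ?d = "\<lambda>L J. \<omega> L (x # J)" and ?i = "\<lambda>L. \<omega> (x # L)"
  have "altf ?d" by (rule altf_shift[OF Cons.prems(1)])
  moreover have "symf (?d K)" for K by (intro symf_shift Cons.prems)
  ultimately have IH: "form_deriv (form_homotopy ?d) K I + form_homotopy (form_deriv ?d) K I =
    real (length K + length I) *\<^sub>R \<omega> K (x # I)" by (rule Cons.IH)
  have "form_deriv (form_homotopy \<omega>) K (x # I) = form_deriv (\<lambda>L J. ?i L J + form_homotopy ?d L J) K I"
    by (subst form_deriv_shift) (auto intro: symf_form_homotopy Cons.prems)
  then have 1: "form_deriv (form_homotopy \<omega>) K (x # I) = form_deriv ?i K I + form_deriv (form_homotopy ?d) K I"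
    unfolding form_deriv_add .
  have "(\<lambda>L J. form_deriv \<omega> L (x # J)) = form_deriv ?d"
    by (intro ext form_deriv_shift Cons.prems)
  then have 2: "form_homotopy (form_deriv \<omega>) K (x # I) =
      \<omega> K (x # I) - form_deriv ?i K I + form_homotopy (form_deriv ?d) K I"
    by simp
  show ?case unfolding 1 2 using IH by (simp add: algebra_simps)
qed

text \<open>Forms of degree \<open>j\<close> whose coefficients are homogeneous polynomials of
  degree \<open>i\<close> with values in \<open>W\<close>.\<close>

definition sym_forms :: "'v::real_vector set \<Rightarrow> nat \<Rightarrow> nat \<Rightarrow> ('n list \<Rightarrow> 'n list \<Rightarrow> 'v) set" where
  "sym_forms W i j = {\<omega>. altf \<omega> \<and> (\<forall>K. symf (\<omega> K)) \<and> (\<forall>K I. \<omega> K I \<in> W) \<and>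
     (\<forall>K I. length K \<noteq> j \<or> length I \<noteq> i \<longrightarrow> \<omega> K I = 0)}"

lemma sym_formsD:
  assumes "\<omega> \<in> sym_forms W i j"
  shows "altf \<omega>" "symf (\<omega> K)" "\<omega> K I \<in> W" "length K \<noteq> j \<or> length I \<noteq> i \<Longrightarrow> \<omega> K I = 0"
  using assms by (auto simp: sym_forms_def)

lemma form_deriv_sym_forms:
  assumes "subspace W" "\<omega> \<in> sym_forms W (Suc i) j" shows "form_deriv \<omega> \<in> sym_forms W i (Suc j)"
proof -
  have "form_deriv \<omega> K I = 0" if "length K \<noteq> Suc j \<or> length I \<noteq> i" for K I
    by (rule form_deriv_length[where \<omega>=\<omega>, OF _ that]) (rule sym_formsD(4)[OF assms(2)])
  then show ?thesis
    by (auto simp: sym_forms_def intro!: altf_form_deriv symf_form_deriv form_deriv_in assms(1) sym_formsD(1-3)[OF assms(2)])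
qed

lemma form_deriv_eq_0:
  assumes "\<And>L x J. \<omega> L (x # J) = 0" shows "form_deriv \<omega> K J = 0"
  using assms by (induction K arbitrary: \<omega>) auto

lemma form_deriv_degree_0:
  assumes "\<omega> \<in> sym_forms W 0 j" shows "form_deriv \<omega> = 0"
  using sym_formsD(4)[OF assms] by (intro ext) (simp add: form_deriv_eq_0)

lemma form_homotopy_sym_forms:
  assumes "subspace W" "\<omega> \<in> sym_forms W i (Suc j)" shows "form_homotopy \<omega> \<in> sym_forms W (Suc i) j"
proof -
  have "form_homotopy \<omega> K I = 0" if "length K \<noteq> j \<or> length I \<noteq> Suc i" for K I
    by (rule form_homotopy_length[where \<omega>=\<omega>, OF _ that]) (rule sym_formsD(4)[OF assms(2)])
  then show ?thesis
    by (auto simp: sym_forms_def intro!: altf_form_homotopy symf_form_homotopy form_homotopy_in assms(1) sym_formsD(1-3)[OF assms(2)])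
qed

lemma form_homotopy_sym_forms_formula:
  assumes "\<omega> \<in> sym_forms W i j"
  shows "form_deriv (form_homotopy \<omega>) K I + form_homotopy (form_deriv \<omega>) K I = real (i + j) *\<^sub>R \<omega> K I"
  using form_homotopy_formula[OF sym_formsD(1,2)[OF assms], of K I] sym_formsD(4)[OF assms, of K I]
  by (cases "length K = j \<and> length I = i") (auto simp: add.commute)

lemma sym_forms_scale:
  assumes "subspace W" "\<omega> \<in> sym_forms W i j" shows "(\<lambda>K I. c *\<^sub>R \<omega> K I) \<in> sym_forms W i j"
proof -
  have "altf (\<lambda>K I. c *\<^sub>R \<omega> K I)"
    unfolding altf_def
  proof (intro allI ext)
    fix xs x y ys I
    show "c *\<^sub>R \<omega> (xs @ x # y # ys) I = (- (\<lambda>I. c *\<^sub>R \<omega> (xs @ y # x # ys) I)) I"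
      using altfD[OF sym_formsD(1)[OF assms(2)], of xs x y ys] by simp
  qed
  then show ?thesis using sym_formsD(3,4)[OF assms(2)]
    by (auto simp: sym_forms_def intro: symf_intros sym_formsD(2)[OF assms(2)] subspace_scale[OF assms(1)])
qed

lemma sym_forms_diff:
  assumes "subspace W" "\<omega> \<in> sym_forms W i j" "\<eta> \<in> sym_forms W i j"
  shows "(\<lambda>K I. \<omega> K I - \<eta> K I) \<in> sym_forms W i j"
proof -
  have "altf (\<lambda>K I. \<omega> K I - \<eta> K I)"
    unfolding altf_def
  proof (intro allI ext)
    fix xs x y ys I
    show "\<omega> (xs @ x # y # ys) I - \<eta> (xs @ x # y # ys) I =
        (- (\<lambda>I. \<omega> (xs @ y # x # ys) I - \<eta> (xs @ y # x # ys) I)) I"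
      using altfD[OF sym_formsD(1)[OF assms(2)], of xs x y ys]
        altfD[OF sym_formsD(1)[OF assms(3)], of xs x y ys] by simp
  qed
  then show ?thesis using sym_formsD(3,4)[OF assms(2)] sym_formsD(3,4)[OF assms(3)]
    by (auto simp: sym_forms_def intro: symf_intros sym_formsD(2)[OF assms(2)] sym_formsD(2)[OF assms(3)]
        subspace_diff[OF assms(1)])
qed

lemma form_homotopy_zero: "form_homotopy 0 = 0"
  using form_homotopy_scale[of 0 0] by (simp add: zero_fun_def)

lemma form_deriv_zero: "form_deriv 0 = 0"
  using form_deriv_scale[of 0 0] by (simp add: zero_fun_def)

text \<open>The homotopy formula makes a positive multiple of \<open>\<omega>\<close> vanish. In
  degree 0 it would say nothing, as constants are closed; this is the source of all the cohomology
  below.\<close>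

lemma poincare_0:
  assumes "\<omega> \<in> sym_forms W (Suc i) 0" "form_deriv \<omega> = 0" shows "\<omega> = 0"
proof (intro ext)
  fix K I
  show "\<omega> K I = 0 K I"
  proof (cases K)
    case Nil
    then show ?thesis using form_homotopy_sym_forms_formula[OF assms(1), of K I] assms(2)
      by (simp add: form_homotopy_zero)
  qed (simp add: sym_formsD(4)[OF assms(1)])
qed

text \<open>The homotopy is divided by the total degree, which is positive because the form degree
  is.\<close>

lemma poincare:
  assumes W: "subspace W" and \<omega>: "\<omega> \<in> sym_forms W i (Suc j)" "form_deriv \<omega> = 0"
  shows "\<exists>\<eta> \<in> sym_forms W (Suc i) j. form_deriv \<eta> = \<omega>"
proof
  show "(\<lambda>K I. (1 / real (i + Suc j)) *\<^sub>R form_homotopy \<omega> K I) \<in> sym_forms W (Suc i) j"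
    by (intro sym_forms_scale form_homotopy_sym_forms W \<omega>)
  show "form_deriv (\<lambda>K I. (1 / real (i + Suc j)) *\<^sub>R form_homotopy \<omega> K I) = \<omega>"
    using form_homotopy_sym_forms_formula[OF \<omega>(1)] unfolding form_deriv_scale \<omega>(2) form_homotopy_zero
    by (intro ext) simp
qed

section \<open>Comparison of polynomial forms with the Spencer complex\<close>

lemma spencer_delta_eq: "spencer_delta \<omega> K I = real (Suc (length I)) *\<^sub>R form_deriv \<omega> K I"
proof -
  have "(\<Sum>m<length K. (-1) ^ m *\<^sub>R \<omega> (take m K @ drop (Suc m) K) (K ! m # I)) = form_deriv \<omega> K I"
  proof (induction K arbitrary: \<omega>)
    case (Cons x K)
    from Cons.IH[of "\<lambda>L. \<omega> (x # L)"] show ?case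
      by (simp add: sum.lessThan_Suc_shift sum_negf del: sum.lessThan_Suc)
  qed simp
  then show ?thesis by (simp add: spencer_delta_def)
qed

lemma spencer_delta_0_iff: "spencer_delta \<omega> = 0 \<longleftrightarrow> form_deriv \<omega> = 0"
  by (simp add: fun_eq_iff spencer_delta_eq)

text \<open>On homogeneous forms the degree factor of the Spencer operator is constant and can be
  moved inside, so it does not affect images.\<close>

lemma spencer_delta_sym_forms:
  assumes "subspace W" "\<omega> \<in> sym_forms W (Suc i) j"
  shows "spencer_delta \<omega> = form_deriv (\<lambda>K I. real (Suc i) *\<^sub>R \<omega> K I)"
  using sym_formsD(4)[OF form_deriv_sym_forms[OF assms]]
  by (intro ext) (auto simp: spencer_delta_eq form_deriv_scale)

lemma sym_tensors_iff:
  "f \<in> sym_tensors t \<longleftrightarrow> symf f \<and> (\<forall>I. f I \<in> sym_matrices) \<and> (\<forall>I. length I \<noteq> t \<longrightarrow> f I = 0)"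
  unfolding sym_tensors_def symf_def by blast

lemma forms_iff:
  "\<omega> \<in> forms j W \<longleftrightarrow> altf \<omega> \<and> (\<forall>K. \<omega> K \<in> W) \<and> (\<forall>K. length K \<noteq> j \<longrightarrow> \<omega> K = 0)"
  unfolding forms_def altf_iff_list_update by blast

lemma forms_sym_tensors: "forms j (sym_tensors i) = sym_forms sym_matrices i j"
proof (intro set_eqI iffI)
  fix \<omega> :: "'a spencer"
  assume \<omega>: "\<omega> \<in> forms j (sym_tensors i)"
  then have "\<omega> K I = 0" if "length K \<noteq> j \<or> length I \<noteq> i" for K I
    using that unfolding forms_iff sym_tensors_iff by (metis zero_fun_apply)
  then show "\<omega> \<in> sym_forms sym_matrices i j"
    using \<omega> unfolding forms_iff sym_tensors_iff sym_forms_def by blast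
next
  fix \<omega> :: "'a spencer"
  assume \<omega>: "\<omega> \<in> sym_forms sym_matrices i j"
  then have "\<omega> K = 0" if "length K \<noteq> j" for K
    using that sym_formsD(4)[OF \<omega>] by (intro ext) simp
  then show "\<omega> \<in> forms j (sym_tensors i)"
    using \<omega> unfolding forms_iff sym_tensors_iff sym_forms_def by blast
qed

section \<open>Spencer cohomology of the Ricci symbol\<close>

definition graded_tensors :: "'v::real_vector set \<Rightarrow> nat \<Rightarrow> ('n list \<Rightarrow> 'v) set" where
  "graded_tensors W t = {f. symf f \<and> (\<forall>I. f I \<in> W) \<and> (\<forall>I. length I \<noteq> t \<longrightarrow> f I = 0)}"

text \<open>Abstracts the constant coefficient operators: linear, and commuting with partial
  derivatives of power series. This is what makes such an operator commute with
  \<open>form_deriv\<close>.\<close>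

definition shift_linear :: "(('n list \<Rightarrow> 'v::real_vector) \<Rightarrow> 'n list \<Rightarrow> 'w::real_vector) \<Rightarrow> bool" where
  "shift_linear L \<longleftrightarrow> (\<forall>f g. L (f - g) = L f - L g) \<and> (\<forall>c f. L (\<lambda>I. c *\<^sub>R f I) = (\<lambda>I. c *\<^sub>R L f I)) \<and>
     (\<forall>f a. symf f \<longrightarrow> L (\<lambda>I. f (a # I)) = (\<lambda>I. L f (a # I)))"

definition truncate :: "nat \<Rightarrow> ('n list \<Rightarrow> 'v::zero) \<Rightarrow> 'n list \<Rightarrow> 'v" where
  "truncate t f = (\<lambda>I. if length I = t then f I else 0)"

lemma graded_tensorsD:
  assumes "f \<in> graded_tensors W t"
  shows "symf f" "f I \<in> W" "length I \<noteq> t \<Longrightarrow> f I = 0"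
  using assms by (auto simp: graded_tensors_def)

lemma graded_tensorsI:
  assumes "symf f" "\<And>I. f I \<in> W" "\<And>I. length I \<noteq> t \<Longrightarrow> f I = 0"
  shows "f \<in> graded_tensors W t"
  using assms by (auto simp: graded_tensors_def)

lemma graded_tensors_diff:
  assumes W: "subspace W" and f: "f \<in> graded_tensors W t" and g: "g \<in> graded_tensors W t"
  shows "f - g \<in> graded_tensors W t"
proof (rule graded_tensorsI)
  show "symf (f - g)" unfolding fun_diff_def
    by (intro symf_intros graded_tensorsD(1)[OF f] graded_tensorsD(1)[OF g])
qed (use graded_tensorsD[OF f] graded_tensorsD[OF g] subspace_diff[OF W] in auto)

lemma graded_tensors_scale:
  assumes W: "subspace W" and f: "f \<in> graded_tensors W t"
  shows "(\<lambda>I. c *\<^sub>R f I) \<in> graded_tensors W t"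
  by (rule graded_tensorsI) (use graded_tensorsD[OF f] subspace_scale[OF W] in \<open>auto intro: symf_intros\<close>)

lemma truncate_graded:
  assumes W: "subspace W" and f: "symf f" "\<And>I. f I \<in> W"
  shows "truncate t f \<in> graded_tensors W t"
proof (rule graded_tensorsI)
  show "symf (truncate t f)"
  proof (rule symfI)
    fix I J :: "'b list" assume m: "mset I = mset J"
    then have "length I = length J" by (metis size_mset)
    then show "truncate t f I = truncate t f J" using symfD[OF f(1) m] by (simp add: truncate_def)
  qed
qed (use f(2) subspace_0[OF W] in \<open>auto simp: truncate_def\<close>)

lemma shift_linearD:
  assumes "shift_linear L"
  shows "L (f - g) = L f - L g" "L (\<lambda>I. c *\<^sub>R f I) = (\<lambda>I. c *\<^sub>R L f I)"
    "symf f \<Longrightarrow> L (\<lambda>I. f (a # I)) = (\<lambda>I. L f (a # I))"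
  using assms unfolding shift_linear_def by blast+

lemma shift_linear_zero: "shift_linear L \<Longrightarrow> L 0 = 0"
  using shift_linearD(1)[of L 0 0] by simp

lemma shift_linear_uminus: "shift_linear L \<Longrightarrow> L (- f) = - L f"
  using shift_linearD(1)[of L 0 f] by (simp add: shift_linear_zero fun_eq_iff)

lemma form_deriv_apply:
  assumes L: "shift_linear L" and \<omega>: "\<And>K. symf (\<omega> K)"
  shows "form_deriv (\<lambda>K. L (\<omega> K)) = (\<lambda>K. L (form_deriv \<omega> K))"
proof
  fix K show "form_deriv (\<lambda>K. L (\<omega> K)) K = L (form_deriv \<omega> K)"
    using \<omega>
  proof (induction K arbitrary: \<omega>)
    case Nil
    have "L (\<lambda>I. 0) = 0" using shift_linear_zero[OF L] by (simp add: zero_fun_def)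
    then show ?case by (simp add: fun_eq_iff)
  next
    case (Cons x K)
    have IH: "form_deriv (\<lambda>M. L (\<omega> (x # M))) K = L (form_deriv (\<lambda>M. \<omega> (x # M)) K)"
      by (rule Cons.IH) (rule Cons.prems)
    have "L (form_deriv \<omega> (x # K)) = L ((\<lambda>I. \<omega> K (x # I)) - form_deriv (\<lambda>M. \<omega> (x # M)) K)"
      by (simp add: fun_diff_def)
    also have "\<dots> = (\<lambda>I. L (\<omega> K) (x # I)) - L (form_deriv (\<lambda>M. \<omega> (x # M)) K)"
      by (simp add: shift_linearD[OF L] Cons.prems)
    finally show ?case by (simp add: IH fun_eq_iff)
  qed
qed

lemma form_deriv_apply_sym:
  assumes "shift_linear L" "\<omega> \<in> sym_forms W i j"
  shows "form_deriv (\<lambda>K. L (\<omega> K)) = (\<lambda>K. L (form_deriv \<omega> K))"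
  by (intro form_deriv_apply assms(1) sym_formsD(2)[OF assms(2)])

lemma sym_forms_graded:
  assumes "\<omega> \<in> sym_forms W i j" shows "\<omega> K \<in> graded_tensors W i" "length K \<noteq> j \<Longrightarrow> \<omega> K = 0"
  using sym_formsD[OF assms] by (auto intro!: graded_tensorsI)

lemma sym_formsI:
  assumes "altf \<omega>" "\<And>K. \<omega> K \<in> graded_tensors W i" "\<And>K. length K \<noteq> j \<Longrightarrow> \<omega> K = 0"
  shows "\<omega> \<in> sym_forms W i j"
  unfolding sym_forms_def using assms(1,3) graded_tensorsD[OF assms(2)] by auto

lemma sym_forms_apply:
  assumes L: "shift_linear L" and im: "\<And>f. f \<in> graded_tensors W i \<Longrightarrow> L f \<in> graded_tensors W' i'"
    and \<omega>: "\<omega> \<in> sym_forms W i j"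
  shows "(\<lambda>K. L (\<omega> K)) \<in> sym_forms W' i' j"
proof (rule sym_formsI)
  show "altf (\<lambda>K. L (\<omega> K))"
    unfolding altf_def
  proof (intro allI)
    fix xs x y ys
    show "L (\<omega> (xs @ x # y # ys)) = - L (\<omega> (xs @ y # x # ys))"
      unfolding altfD[OF sym_formsD(1)[OF \<omega>], of xs x y ys] by (rule shift_linear_uminus[OF L])
  qed
qed (use sym_forms_graded[OF \<omega>] im shift_linear_zero[OF L] in auto)

text \<open>The antisymmetrised choice \<open>(t x - t (- x)) / 2\<close> of a preimage is an odd function of \<open>x\<close>,
  which is all that is needed to lift alternating families.\<close>

lemma sym_forms_lift:
  assumes L: "shift_linear L" and W': "subspace W'" and \<nu>: "\<nu> \<in> sym_forms W i j"
    and ex: "\<And>K. \<exists>y\<in>graded_tensors W' i'. L y = \<nu> K"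
  shows "\<exists>\<rho>\<in>sym_forms W' i' j. (\<lambda>K. L (\<rho> K)) = \<nu>"
proof -
  define D where "D = {x. \<exists>y\<in>graded_tensors W' i'. L y = x}"
  define t where "t x = (SOME y. y \<in> graded_tensors W' i' \<and> L y = x)" for x
  have t: "t x \<in> graded_tensors W' i'" "L (t x) = x" if "x \<in> D" for x
    using someI_ex[of "\<lambda>y. y \<in> graded_tensors W' i' \<and> L y = x"] that unfolding D_def t_def by blast+
  have neg: "- x \<in> D" if x: "x \<in> D" for x
  proof -
    obtain y where y: "y \<in> graded_tensors W' i'" "L y = x" using x unfolding D_def by blast
    then have "- y \<in> graded_tensors W' i'" "L (- y) = - x"
      using graded_tensors_scale[OF W' y(1), of "-1"] shift_linear_uminus[OF L, of y]
      by (auto simp: fun_Compl_def)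
    then show ?thesis unfolding D_def by blast
  qed
  define s where "s x = (\<lambda>I. (1 / 2) *\<^sub>R (t x - t (- x)) I)" for x
  have s: "s x \<in> graded_tensors W' i'" "L (s x) = x" if x: "x \<in> D" for x
  proof -
    show "s x \<in> graded_tensors W' i'"
      unfolding s_def by (intro graded_tensors_scale graded_tensors_diff W' t x neg)
    have "L (s x) = (\<lambda>I. (1 / 2) *\<^sub>R (x - (- x)) I)"
      unfolding s_def shift_linearD(2)[OF L] shift_linearD(1)[OF L] t(2)[OF x] t(2)[OF neg[OF x]] ..
    then show "L (s x) = x" by (simp add: fun_eq_iff flip: scaleR_2)
  qed
  have s_odd: "s (- x) = - s x" for x by (simp add: s_def fun_eq_iff algebra_simps)
  have D: "\<nu> K \<in> D" for K using ex unfolding D_def by blast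
  have s0: "s 0 = 0" by (simp add: s_def fun_eq_iff)
  have "(\<lambda>K. s (\<nu> K)) \<in> sym_forms W' i' j"
  proof (rule sym_formsI)
    show "altf (\<lambda>K. s (\<nu> K))"
      unfolding altf_def
    proof (intro allI)
      fix xs x y ys
      show "s (\<nu> (xs @ x # y # ys)) = - s (\<nu> (xs @ y # x # ys))"
        unfolding altfD[OF sym_formsD(1)[OF \<nu>], of xs x y ys] by (rule s_odd)
    qed
  qed (use s(1)[OF D] sym_forms_graded(2)[OF \<nu>] s0 in auto)
  moreover have "(\<lambda>K. L (s (\<nu> K))) = \<nu>" using s(2)[OF D] by simp
  ultimately show ?thesis by (intro bexI[of _ "\<lambda>K. s (\<nu> K)"])
qed

lemma subspace_sym_matrices: "subspace sym_matrices"
  by (simp add: subspace_def sym_matrices_iff)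

lemma shift_linear_ric: "shift_linear (ric_symbol Q)"
proof -
  have "ric_symbol Q (\<lambda>I. f (a # I)) = (\<lambda>I. ric_symbol Q f (a # I))" if "symf f" for f and a
  proof -
    have "f (a # k # l # I) = f (k # l # a # I)" for k l I by (rule symfD[OF that]) simp
    then show ?thesis by (simp add: ric_symbol_def)
  qed
  then show ?thesis by (simp add: shift_linear_def ric_symbol_diff ric_symbol_scale)
qed

lemma shift_linear_bianchi: "shift_linear (bianchi_symbol Q)"
proof -
  have "bianchi_symbol Q (\<lambda>I. f (a # I)) = (\<lambda>I. bianchi_symbol Q f (a # I))" if "symf f" for f and a
  proof -
    have "f (a # k # I) = f (k # a # I)" for k I by (rule symfD[OF that]) simp
    then show ?thesis by (simp add: bianchi_symbol_def)
  qed
  then show ?thesis by (simp add: shift_linear_def bianchi_symbol_diff bianchi_symbol_scale)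
qed

lemma ric_symbol_graded:
  assumes f: "f \<in> graded_tensors sym_matrices (Suc (Suc t))"
  shows "ric_symbol Q f \<in> graded_tensors sym_matrices t"
proof (rule graded_tensorsI)
  show "ric_symbol Q f I = 0" if "length I \<noteq> t" for I
    using graded_tensorsD(3)[OF f] that by (simp add: ric_symbol_def vec_eq_iff)
qed (use graded_tensorsD[OF f] in \<open>auto intro: symf_ric_symbol ric_symbol_sym\<close>)

lemma ric_symbol_low:
  assumes f: "f \<in> graded_tensors sym_matrices t" and "t < 2"
  shows "ric_symbol Q f = 0"
  using graded_tensorsD(3)[OF f] assms(2) by (intro ext) (simp add: ric_symbol_def vec_eq_iff)

lemma bianchi_symbol_graded:
  assumes f: "f \<in> graded_tensors sym_matrices (Suc t)"
  shows "bianchi_symbol Q f \<in> graded_tensors UNIV t"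
proof (rule graded_tensorsI)
  show "bianchi_symbol Q f I = 0" if "length I \<noteq> t" for I
    using graded_tensorsD(3)[OF f] that by (simp add: bianchi_symbol_def vec_eq_iff)
qed (use graded_tensorsD[OF f] in \<open>auto intro: symf_bianchi_symbol\<close>)

lemma bianchi_symbol_low:
  assumes f: "f \<in> graded_tensors sym_matrices 0"
  shows "bianchi_symbol Q f = 0"
  using graded_tensorsD(3)[OF f] by (intro ext) (simp add: bianchi_symbol_def vec_eq_iff)

section \<open>Exactness degree by degree and the diagram chase\<close>

context orthonormal_frame
begin

text \<open>The symbol lowers the degree by exactly two, so the homogeneous part of degree
  \<open>t + 2\<close> of a formal solution already solves the equation.\<close>

lemma ric_symbol_graded_exact:
  assumes r: "r \<in> graded_tensors sym_matrices t" "bianchi_symbol Q r = 0"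
  shows "\<exists>h\<in>graded_tensors sym_matrices (Suc (Suc t)). ric_symbol Q h = r"
proof -
  obtain h where h: "symf h" "\<forall>I. h I \<in> sym_matrices" "ric_symbol Q h = r"
    using ric_symbol_exact[OF graded_tensorsD(1,2)[OF r(1)] r(2)] by blast
  have "ric_symbol Q (truncate (Suc (Suc t)) h) I = r I" for I
  proof (cases "length I = t")
    case True
    then have "ric_symbol Q (truncate (Suc (Suc t)) h) I = ric_symbol Q h I"
      by (simp add: ric_symbol_def truncate_def)
    then show ?thesis using h(3) by simp
  next
    case False
    then show ?thesis using graded_tensorsD(3)[OF r(1)]
      by (simp add: ric_symbol_def truncate_def vec_eq_iff)
  qed
  then show ?thesis using truncate_graded[OF subspace_sym_matrices h(1)] h(2)
    by (intro bexI[of _ "truncate (Suc (Suc t)) h"]) auto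
qed

lemma bianchi_symbol_graded_surj:
  assumes V: "V \<in> graded_tensors UNIV t"
  shows "\<exists>r\<in>graded_tensors sym_matrices (Suc t). bianchi_symbol Q r = V"
proof -
  obtain h where h: "symf h" "\<forall>I. h I \<in> sym_matrices" "bianchi_symbol Q h = V"
    using divergence_surj[OF graded_tensorsD(1)[OF V]] by blast
  have "bianchi_symbol Q (truncate (Suc t) h) I = V I" for I
  proof (cases "length I = t")
    case True
    then have "bianchi_symbol Q (truncate (Suc t) h) I = bianchi_symbol Q h I"
      by (simp add: bianchi_symbol_def truncate_def)
    then show ?thesis using h(3) by simp
  next
    case False
    then show ?thesis using graded_tensorsD(3)[OF V]
      by (simp add: bianchi_symbol_def truncate_def vec_eq_iff)
  qed
  then show ?thesis using truncate_graded[OF subspace_sym_matrices h(1)] h(2)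
    by (intro bexI[of _ "truncate (Suc t) h"]) auto
qed

lemma bianchi_ric_symbol': "symf h \<Longrightarrow> bianchi_symbol Q (ric_symbol Q h) = 0"
  by (rule bianchi_ric_symbol[OF Q_sym])

text \<open>The terms of the Spencer complex, as \<open>forms_ric_kernel\<close> shows; in degrees
  below 2 the kernel condition holds automatically.\<close>

definition ric_forms :: "nat \<Rightarrow> nat \<Rightarrow> 'n spencer set" where
  "ric_forms i j = {\<omega> \<in> sym_forms sym_matrices i j. \<forall>K. ric_symbol Q (\<omega> K) = 0}"

lemma ric_forms_low: "i < 2 \<Longrightarrow> ric_forms i j = sym_forms sym_matrices i j"
  unfolding ric_forms_def using ric_symbol_low sym_forms_graded(1) by blast

text \<open>Inverting the Ricci symbol on a primitive \<open>\<mu>\<close> requires its Bianchi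
  symbol \<open>\<kappa>\<close> to vanish. Now \<open>\<kappa>\<close> is closed, because the
  Bianchi symbol kills \<open>ric_symbol Q (\<eta> K)\<close>. If it is a function of positive
  degree it is 0; if it has positive form degree it is \<open>d \<nu>\<close>, and lifting
  \<open>\<nu>\<close> to \<open>\<rho>\<close> allows \<open>\<mu>\<close> to be replaced by
  \<open>\<mu> - d \<rho>\<close>. In bidegree (0, 0) it is a constant covector that may survive:
  this is the class in \<open>H^{1,2}\<close>.\<close>

lemma correct_gauge:
  assumes \<psi>: "\<mu> \<in> sym_forms sym_matrices (Suc i) j" "form_deriv \<mu> = (\<lambda>K. ric_symbol Q (\<eta> K))"
    and \<eta>: "\<eta> \<in> sym_forms sym_matrices (Suc (Suc i)) (Suc j)"
    and exc: "(i, j) \<noteq> (0, 0)"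
  shows "\<exists>\<mu>' \<in> sym_forms sym_matrices (Suc i) j. form_deriv \<mu>' = (\<lambda>K. ric_symbol Q (\<eta> K)) \<and>
    (\<forall>K. bianchi_symbol Q (\<mu>' K) = 0)"
proof -
  define \<kappa> where "\<kappa> = (\<lambda>K. bianchi_symbol Q (\<mu> K))"
  have \<kappa>: "\<kappa> \<in> sym_forms UNIV i j"
    unfolding \<kappa>_def by (rule sym_forms_apply[OF shift_linear_bianchi bianchi_symbol_graded \<psi>(1)])
  have "form_deriv \<kappa> = 0"
    unfolding \<kappa>_def form_deriv_apply_sym[OF shift_linear_bianchi \<psi>(1)] \<psi>(2)
    by (simp add: bianchi_ric_symbol'[OF sym_formsD(2)[OF \<eta>]] fun_eq_iff)
  show ?thesis
  proof (cases j)
    case 0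
    then obtain i' where "i = Suc i'" using exc by (cases i) auto
    then have "\<kappa> = 0" using poincare_0 \<kappa> \<open>form_deriv \<kappa> = 0\<close> 0 by blast
    then have "\<forall>K. bianchi_symbol Q (\<mu> K) = 0" unfolding \<kappa>_def by (simp add: fun_eq_iff)
    then show ?thesis using \<psi> by blast
  next
    case (Suc j')
    obtain \<nu> where \<nu>: "\<nu> \<in> sym_forms UNIV (Suc i) j'" "form_deriv \<nu> = \<kappa>"
      using poincare[OF subspace_UNIV \<kappa>[unfolded Suc] \<open>form_deriv \<kappa> = 0\<close>] by blast
    obtain \<rho> where \<rho>: "\<rho> \<in> sym_forms sym_matrices (Suc (Suc i)) j'" "(\<lambda>K. bianchi_symbol Q (\<rho> K)) = \<nu>"
      using sym_forms_lift[OF shift_linear_bianchi subspace_sym_matrices \<nu>(1)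
          bianchi_symbol_graded_surj[OF sym_forms_graded(1)[OF \<nu>(1)]]] by blast
    have d\<rho>: "form_deriv \<rho> \<in> sym_forms sym_matrices (Suc i) j"
      unfolding Suc by (rule form_deriv_sym_forms[OF subspace_sym_matrices \<rho>(1)])
    let ?\<mu> = "\<lambda>K I. \<mu> K I - form_deriv \<rho> K I"
    have 1: "?\<mu> \<in> sym_forms sym_matrices (Suc i) j"
      by (rule sym_forms_diff[OF subspace_sym_matrices \<psi>(1) d\<rho>])
    have 2: "form_deriv ?\<mu> = (\<lambda>K. ric_symbol Q (\<eta> K))"
      unfolding form_deriv_diff \<psi>(2) using form_deriv_deriv[OF sym_formsD(2)[OF \<rho>(1)]] by simp
    have "bianchi_symbol Q (form_deriv \<rho> K) = \<kappa> K" for K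
      using fun_cong[OF form_deriv_apply_sym[OF shift_linear_bianchi[of Q] \<rho>(1)], where x=K]
      unfolding \<rho>(2) \<nu>(2) by simp
    then have 3: "bianchi_symbol Q (?\<mu> K) = 0" for K
      using bianchi_symbol_diff[of Q "\<mu> K" "form_deriv \<rho> K"] unfolding fun_diff_def[of "\<mu> K"]
      by (simp add: \<kappa>_def fun_eq_iff)
    show ?thesis using 1 2 3 by blast
  qed
qed

text \<open>A primitive \<open>\<eta>\<close> of \<open>\<omega>\<close> need not lie in the kernel,
  but its symbol \<open>\<psi>\<close> is closed. If \<open>\<psi> = d \<mu>'\<close> with
  \<open>\<mu>'\<close> the Ricci symbol of \<open>\<tau>\<close>, then
  \<open>\<eta> - d \<tau>\<close> is a primitive in the kernel. The chase stops only at constants: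
  \<open>\<psi>\<close> itself for (1, 1), and the covector of \<open>correct_gauge\<close> for (1,
  2).\<close>

lemma ric_forms_exact:
  assumes \<omega>: "\<omega> \<in> ric_forms i (Suc j)" "form_deriv \<omega> = 0" and exc: "(i, Suc j) \<notin> {(1, 1), (1, 2)}"
  shows "\<exists>\<eta>\<in>ric_forms (Suc i) j. form_deriv \<eta> = \<omega>"
proof -
  have \<omega>': "\<omega> \<in> sym_forms sym_matrices i (Suc j)" "\<And>K. ric_symbol Q (\<omega> K) = 0"
    using \<omega>(1) by (auto simp: ric_forms_def)
  obtain \<eta> where \<eta>: "\<eta> \<in> sym_forms sym_matrices (Suc i) j" "form_deriv \<eta> = \<omega>"
    using poincare[OF subspace_sym_matrices \<omega>'(1) \<omega>(2)] by blast
  show ?thesis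
  proof (cases i)
    case 0
    \<comment> \<open>The primitive has degree 1, below the order of the equation, so it is in the
      kernel.\<close>
    then show ?thesis using \<eta> ric_forms_low[of "Suc i" j] by auto
  next
    case (Suc i')
    define \<psi> where "\<psi> = (\<lambda>K. ric_symbol Q (\<eta> K))"
    have \<psi>: "\<psi> \<in> sym_forms sym_matrices i' j"
      unfolding \<psi>_def using \<eta>(1) Suc by (intro sym_forms_apply[OF shift_linear_ric ric_symbol_graded]) auto
    have d\<psi>: "form_deriv \<psi> = 0"
      unfolding \<psi>_def form_deriv_apply_sym[OF shift_linear_ric \<eta>(1)] \<eta>(2)
      by (simp add: \<omega>'(2) fun_eq_iff)
    show ?thesis
    proof (cases j)
      case 0
      then obtain i'' where "i' = Suc i''" using exc Suc by (cases i') auto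
      then have "\<psi> = 0" using poincare_0 \<psi> d\<psi> 0 by blast
      then have "\<eta> \<in> ric_forms (Suc i) j" using \<eta>(1) by (simp add: ric_forms_def \<psi>_def fun_eq_iff)
      then show ?thesis using \<eta>(2) by blast
    next
      case (Suc j')
      obtain \<mu> where \<mu>: "\<mu> \<in> sym_forms sym_matrices (Suc i') j'" "form_deriv \<mu> = \<psi>"
        using poincare[OF subspace_sym_matrices \<psi>[unfolded Suc] d\<psi>] by blast
      have "(i', j') \<noteq> (0, 0)" using exc \<open>i = Suc i'\<close> Suc by auto
      then obtain \<mu>' where \<mu>': "\<mu>' \<in> sym_forms sym_matrices (Suc i') j'" "form_deriv \<mu>' = \<psi>"
          "\<And>K. bianchi_symbol Q (\<mu>' K) = 0"
        using correct_gauge[of \<mu> i' j' \<eta>] \<mu> \<eta>(1) \<open>i = Suc i'\<close> Suc unfolding \<psi>_def by blast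
      obtain \<tau> where \<tau>: "\<tau> \<in> sym_forms sym_matrices (Suc (Suc (Suc i'))) j'" "(\<lambda>K. ric_symbol Q (\<tau> K)) = \<mu>'"
        using sym_forms_lift[OF shift_linear_ric subspace_sym_matrices \<mu>'(1)
            ric_symbol_graded_exact[OF sym_forms_graded(1)[OF \<mu>'(1)] \<mu>'(3)]] by blast
      have d\<tau>: "form_deriv \<tau> \<in> sym_forms sym_matrices (Suc i) j"
        unfolding Suc \<open>i = Suc i'\<close> by (rule form_deriv_sym_forms[OF subspace_sym_matrices \<tau>(1)])
      let ?\<eta> = "\<lambda>K I. \<eta> K I - form_deriv \<tau> K I"
      have "?\<eta> \<in> sym_forms sym_matrices (Suc i) j"
        by (rule sym_forms_diff[OF subspace_sym_matrices \<eta>(1) d\<tau>])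
      moreover have "ric_symbol Q (form_deriv \<tau> K) = \<psi> K" for K
        using fun_cong[OF form_deriv_apply_sym[OF shift_linear_ric[of Q] \<tau>(1)], where x=K]
        unfolding \<tau>(2) \<mu>'(2) by simp
      then have "ric_symbol Q (?\<eta> K) = 0" for K
        using ric_symbol_diff[of Q "\<eta> K" "form_deriv \<tau> K"] unfolding fun_diff_def[of "\<eta> K"]
        by (simp add: \<psi>_def fun_eq_iff)
      moreover have "form_deriv ?\<eta> = \<omega>"
        unfolding form_deriv_diff \<eta>(2) using form_deriv_deriv[OF sym_formsD(2)[OF \<tau>(1)]] by simp
      ultimately show ?thesis unfolding ric_forms_def by blast
    qed
  qed
qed

text \<open>Snake maps: up to nonzero factors \<open>form_homotopy\<close> inverts \<open>\<delta>\<close> on cocycles, so these are the connecting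
  homomorphisms \<open>\<sigma> \<delta>\<^sup>-\<^sup>1\<close> and \<open>B \<delta>\<^sup>-\<^sup>1 \<sigma> \<delta>\<^sup>-\<^sup>1\<close> of the diagram chase.\<close>

definition phi11 :: "'n spencer \<Rightarrow> real^'n^'n" where
  "phi11 \<omega> = ric_symbol Q (form_homotopy \<omega> []) []"

definition phi12 :: "'n spencer \<Rightarrow> real^'n" where
  "phi12 \<omega> = bianchi_symbol Q (form_homotopy (\<lambda>K. ric_symbol Q (form_homotopy \<omega> K)) []) []"

definition ric_cocycles :: "nat \<Rightarrow> nat \<Rightarrow> 'n spencer set" where
  "ric_cocycles i j = {\<omega>\<in>ric_forms i j. form_deriv \<omega> = 0}"

lemma phi11_add: "phi11 (\<omega> + \<eta>) = phi11 \<omega> + phi11 \<eta>"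
proof -
  have "form_homotopy (\<omega> + \<eta>) [] = form_homotopy \<omega> [] - (\<lambda>I. (-1) *\<^sub>R form_homotopy \<eta> [] I)"
    using form_homotopy_add[of \<omega> \<eta>] by (simp add: fun_eq_iff plus_fun_def)
  then show ?thesis unfolding phi11_def
    by (simp only: ric_symbol_diff ric_symbol_scale minus_apply) simp
qed

lemma phi11_scale: "phi11 (\<lambda>K I. c *\<^sub>R \<omega> K I) = c *\<^sub>R phi11 \<omega>"
  unfolding phi11_def form_homotopy_scale ric_symbol_scale ..

lemma phi12_scale: "phi12 (\<lambda>K I. c *\<^sub>R \<omega> K I) = c *\<^sub>R phi12 \<omega>"
  unfolding phi12_def form_homotopy_scale ric_symbol_scale bianchi_symbol_scale ..

lemma phi12_diff: "phi12 (\<lambda>K I. \<omega> K I - \<eta> K I) = phi12 \<omega> - phi12 \<eta>"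
proof -
  have r: "ric_symbol Q (\<lambda>I. f I - g I) = (\<lambda>I. ric_symbol Q f I - ric_symbol Q g I)" for f g
    using ric_symbol_diff[of Q f g] by (simp add: fun_diff_def)
  have b: "bianchi_symbol Q (\<lambda>I. f I - g I) = (\<lambda>I. bianchi_symbol Q f I - bianchi_symbol Q g I)" for f g
    using bianchi_symbol_diff[of Q f g] by (simp add: fun_diff_def)
  show ?thesis unfolding phi12_def form_homotopy_diff r b ..
qed

lemma phi12_add: "phi12 (\<omega> + \<eta>) = phi12 \<omega> + phi12 \<eta>"
  using phi12_diff[of \<omega> "\<lambda>K I. (-1) *\<^sub>R \<eta> K I"] unfolding phi12_scale by (simp add: plus_fun_def)

lemma phi11_coboundary:
  assumes "\<eta> \<in> ric_forms 2 0" shows "phi11 (form_deriv \<eta>) = 0"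
proof -
  have \<eta>: "\<eta> \<in> sym_forms sym_matrices 2 0" "ric_symbol Q (\<eta> []) = 0" using assms by (auto simp: ric_forms_def)
  have "form_homotopy (form_deriv \<eta>) [] = (\<lambda>I. 2 *\<^sub>R \<eta> [] I)"
    using form_homotopy_sym_forms_formula[OF \<eta>(1), of "[]"] by (intro ext) simp
  then show ?thesis unfolding phi11_def by (simp only: ric_symbol_scale \<eta>(2)) simp
qed

lemma phi11_in: "\<omega> \<in> ric_cocycles 1 1 \<Longrightarrow> phi11 \<omega> \<in> sym_matrices"
  unfolding phi11_def ric_cocycles_def ric_forms_def
  using form_homotopy_sym_forms[OF subspace_sym_matrices, of \<omega> 1 0]
  by (auto intro!: ric_symbol_sym dest: sym_formsD)

lemma phi11_kernel:
  assumes \<omega>: "\<omega> \<in> ric_cocycles 1 1" and 0: "phi11 \<omega> = 0"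
  shows "\<exists>\<eta>\<in>ric_forms 2 0. form_deriv \<eta> = \<omega>"
proof -
  have \<omega>': "\<omega> \<in> sym_forms sym_matrices 1 (Suc 0)" "form_deriv \<omega> = 0"
    using \<omega> by (auto simp: ric_cocycles_def ric_forms_def)
  \<comment> \<open>The factor 1/2 is the inverse of the total degree 1 + 1 of
    \<open>\<omega>\<close>.\<close>
  define \<eta> where "\<eta> = (\<lambda>K I. (1 / 2) *\<^sub>R form_homotopy \<omega> K I)"
  have h: "form_homotopy \<omega> \<in> sym_forms sym_matrices 2 0"
    using form_homotopy_sym_forms[OF subspace_sym_matrices \<omega>'(1)] by (simp add: numeral_2_eq_2)
  have \<eta>: "\<eta> \<in> sym_forms sym_matrices 2 0" unfolding \<eta>_def by (rule sym_forms_scale[OF subspace_sym_matrices h])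
  \<comment> \<open>By degree the only coefficient that can be nonzero is the one at two empty
    lists, and that is \<open>phi11 \<omega>\<close>.\<close>
  have "ric_symbol Q (form_homotopy \<omega> K) I = 0" for K I
  proof (cases "K = [] \<and> I = []")
    case True then show ?thesis using 0 by (simp add: phi11_def)
  next
    case False
    then show ?thesis
    proof (cases K)
      case Nil
      then have "length I \<noteq> 0" using False by simp
      then show ?thesis using graded_tensorsD(3)[OF ric_symbol_graded[of "form_homotopy \<omega> K" 0], of I]
        sym_forms_graded(1)[OF h, of K] by (simp add: numeral_2_eq_2)
    next
      case (Cons x L)
      then show ?thesis using sym_forms_graded(2)[OF h, of K] shift_linear_zero[OF shift_linear_ric[of Q]] by simp
    qed
  qed
  then have "ric_symbol Q (\<eta> K) = 0" for K unfolding \<eta>_def ric_symbol_scale by (simp add: fun_eq_iff)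
  moreover have "form_deriv \<eta> = \<omega>"
    using form_homotopy_sym_forms_formula[OF \<omega>'(1)] unfolding \<eta>_def form_deriv_scale \<omega>'(2) form_homotopy_zero
    by (intro ext) simp
  ultimately show ?thesis using \<eta> by (auto simp: ric_forms_def)
qed

definition scalar_form :: "('n list \<Rightarrow> 'v::real_vector) \<Rightarrow> 'n list \<Rightarrow> 'n list \<Rightarrow> 'v" where
  "scalar_form f = (\<lambda>K. if K = [] then f else 0)"

lemma scalar_form:
  assumes "f \<in> graded_tensors W i" and W: "subspace W" shows "scalar_form f \<in> sym_forms W i 0"
proof (rule sym_formsI)
  show "altf (scalar_form f)" by (simp add: altf_def scalar_form_def)
  have "f - f \<in> graded_tensors W i" by (intro graded_tensors_diff W assms(1))
  then show "scalar_form f K \<in> graded_tensors W i" for K using assms by (simp add: scalar_form_def)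
qed (simp add: scalar_form_def)

lemma constant_graded:
  assumes "subspace W" "M \<in> W" shows "(\<lambda>I. if I = [] then M else 0) \<in> graded_tensors W 0"
  using truncate_graded[OF assms(1) symf_const[of M] assms(2), of 0] by (simp add: truncate_def)

lemma ric_cocycles_form_deriv:
  assumes "\<eta> \<in> sym_forms sym_matrices 2 j" shows "form_deriv \<eta> \<in> ric_cocycles 1 (Suc j)"
  using form_deriv_sym_forms[OF subspace_sym_matrices, of \<eta> 1 j] assms
    form_deriv_deriv[OF sym_formsD(2)[OF assms]]
  by (simp add: ric_cocycles_def ric_forms_low numeral_2_eq_2 fun_eq_iff)

lemma phi11_surj:
  assumes M: "M \<in> sym_matrices" shows "\<exists>\<omega>\<in>ric_cocycles 1 1. phi11 \<omega> = M"
proof -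
  \<comment> \<open>The factor 1/2 offsets the 2 with which \<open>form_homotopy\<close> after
    \<open>form_deriv\<close> acts in bidegree (2, 0). Being of degree 0, the tensor is annihilated
    by the Bianchi symbol and hence lies in the image of the Ricci symbol.\<close>
  let ?r = "\<lambda>I. if I = [] then (1 / 2) *\<^sub>R M else 0"
  have r: "?r \<in> graded_tensors sym_matrices 0"
    by (intro constant_graded subspace_sym_matrices subspace_scale M)
  obtain h where h: "h \<in> graded_tensors sym_matrices (Suc (Suc 0))" "ric_symbol Q h = ?r"
    using ric_symbol_graded_exact[OF r bianchi_symbol_low[OF r]] by blast
  have s: "scalar_form h \<in> sym_forms sym_matrices 2 0"
    unfolding numeral_2_eq_2 by (rule scalar_form[OF h(1) subspace_sym_matrices])
  have "form_homotopy (form_deriv (scalar_form h)) [] = (\<lambda>I. 2 *\<^sub>R h I)"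
    using form_homotopy_sym_forms_formula[OF s, of "[]"] by (intro ext) (simp add: scalar_form_def)
  then have "phi11 (form_deriv (scalar_form h)) = M"
    unfolding phi11_def by (simp only: ric_symbol_scale h(2)) simp
  then show ?thesis using ric_cocycles_form_deriv[OF s] by auto
qed

text \<open>Writing h for the homotopy and d for \<open>form_deriv\<close>,
  \<open>h d \<eta> = 3 \<eta> - d h \<eta>\<close>. The correction contributes
  \<open>h d \<zeta> = \<zeta>\<close>, where \<open>\<zeta>\<close> is the Ricci symbol of
  \<open>h \<eta>\<close>, and this is killed by the Bianchi symbol.\<close>

lemma phi12_form_deriv:
  assumes \<eta>: "\<eta> \<in> sym_forms sym_matrices 2 1"
  shows "phi12 (form_deriv \<eta>) = 3 *\<^sub>R bianchi_symbol Q (form_homotopy (\<lambda>K. ric_symbol Q (\<eta> K)) []) []"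
proof -
  have h\<eta>: "form_homotopy \<eta> \<in> sym_forms sym_matrices 3 0"
    using form_homotopy_sym_forms[OF subspace_sym_matrices, of \<eta> 2 0] \<eta> by (simp add: numeral_3_eq_3 numeral_2_eq_2)
  define \<zeta> where "\<zeta> = (\<lambda>K. ric_symbol Q (form_homotopy \<eta> K))"
  have \<zeta>: "\<zeta> \<in> sym_forms sym_matrices 1 0"
  proof -
    have "form_homotopy \<eta> \<in> sym_forms sym_matrices (Suc (Suc 1)) 0" using h\<eta> by (simp add: numeral_3_eq_3)
    from sym_forms_apply[OF shift_linear_ric ric_symbol_graded this] show ?thesis
      unfolding \<zeta>_def .
  qed
  have "form_homotopy (form_deriv \<eta>) = (\<lambda>K I. 3 *\<^sub>R \<eta> K I - form_deriv (form_homotopy \<eta>) K I)"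
    using form_homotopy_sym_forms_formula[OF \<eta>] by (intro ext) (simp add: eq_diff_eq add.commute)
  then have "ric_symbol Q (form_homotopy (form_deriv \<eta>) K) =
      (\<lambda>I. 3 *\<^sub>R ric_symbol Q (\<eta> K) I - form_deriv \<zeta> K I)" for K
    unfolding \<zeta>_def form_deriv_apply_sym[OF shift_linear_ric h\<eta>]
    using ric_symbol_diff[of Q "\<lambda>I. 3 *\<^sub>R \<eta> K I" "form_deriv (form_homotopy \<eta>) K"]
    by (simp add: fun_diff_def ric_symbol_scale)
  then have "form_homotopy (\<lambda>K. ric_symbol Q (form_homotopy (form_deriv \<eta>) K)) [] =
      (\<lambda>I. 3 *\<^sub>R form_homotopy (\<lambda>K. ric_symbol Q (\<eta> K)) [] I - form_homotopy (form_deriv \<zeta>) [] I)"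
    by (simp add: form_homotopy_diff form_homotopy_scale)
  also have "form_homotopy (form_deriv \<zeta>) [] = \<zeta> []"
    using form_homotopy_sym_forms_formula[OF \<zeta>, of "[]"] by (intro ext) simp
  finally have "phi12 (form_deriv \<eta>) = bianchi_symbol Q
      ((\<lambda>I. 3 *\<^sub>R form_homotopy (\<lambda>K. ric_symbol Q (\<eta> K)) [] I) - \<zeta> []) []"
    by (simp add: phi12_def fun_diff_def)
  also have "bianchi_symbol Q (\<zeta> []) = 0"
    unfolding \<zeta>_def by (rule bianchi_ric_symbol'[OF sym_formsD(2)[OF h\<eta>]])
  ultimately show ?thesis by (simp add: bianchi_symbol_diff bianchi_symbol_scale)
qed

lemma phi12_coboundary:
  assumes "\<eta> \<in> ric_forms 2 1" shows "phi12 (form_deriv \<eta>) = 0"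
proof -
  have \<eta>: "\<eta> \<in> sym_forms sym_matrices 2 1" "(\<lambda>K. ric_symbol Q (\<eta> K)) = 0"
    using assms by (auto simp: ric_forms_def fun_eq_iff)
  show ?thesis unfolding phi12_form_deriv[OF \<eta>(1)] \<eta>(2) form_homotopy_zero
    using shift_linear_zero[OF shift_linear_bianchi[of Q]] by (simp add: fun_eq_iff)
qed

text \<open>The chase of \<open>ric_forms_exact\<close> in the exceptional bidegree, with
  \<open>phi12 \<omega> = 0\<close> in place of the correction of the gauge.\<close>

lemma phi12_kernel:
  assumes \<omega>: "\<omega> \<in> ric_cocycles 1 2" and 0: "phi12 \<omega> = 0"
  shows "\<exists>\<eta>\<in>ric_forms 2 1. form_deriv \<eta> = \<omega>"
proof -
  have \<omega>': "\<omega> \<in> sym_forms sym_matrices 1 (Suc 1)" "form_deriv \<omega> = 0"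
    using \<omega> by (auto simp: ric_cocycles_def ric_forms_def numeral_2_eq_2)
  define h where "h = form_homotopy \<omega>"
  have h: "h \<in> sym_forms sym_matrices (Suc (Suc 0)) 1" unfolding h_def
    using form_homotopy_sym_forms[OF subspace_sym_matrices \<omega>'(1)] by simp
  have dh: "form_deriv h = (\<lambda>K I. 3 *\<^sub>R \<omega> K I)"
    using form_homotopy_sym_forms_formula[OF \<omega>'(1)] unfolding h_def \<omega>'(2) form_homotopy_zero
    by (intro ext) simp
  define \<psi> where "\<psi> = (\<lambda>K. ric_symbol Q (h K))"
  have \<psi>: "\<psi> \<in> sym_forms sym_matrices 0 (Suc 0)"
    unfolding \<psi>_def using sym_forms_apply[OF shift_linear_ric ric_symbol_graded h] by simp
  define \<mu> where "\<mu> = form_homotopy \<psi>"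
  have \<mu>: "\<mu> \<in> sym_forms sym_matrices (Suc 0) 0" unfolding \<mu>_def
    by (rule form_homotopy_sym_forms[OF subspace_sym_matrices \<psi>])
  \<comment> \<open>The form \<open>\<psi>\<close> is closed since its coefficients are constant,
    and no factor appears since its total degree is 1.\<close>
  have d\<mu>: "form_deriv \<mu> = \<psi>"
    using form_homotopy_sym_forms_formula[OF \<psi>] unfolding \<mu>_def form_deriv_degree_0[OF \<psi>] form_homotopy_zero
    by (intro ext) simp
  \<comment> \<open>For degree reasons only the coefficient at two empty lists remains, and it is
    \<open>phi12 \<omega>\<close>.\<close>
  have B\<mu>: "bianchi_symbol Q (\<mu> K) = 0" for K
  proof
    fix I
    show "bianchi_symbol Q (\<mu> K) I = 0 I"
    proof (cases "K = [] \<and> I = []")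
      case True then show ?thesis using 0 by (simp add: phi12_def \<mu>_def \<psi>_def h_def)
    next
      case False
      then show ?thesis
        using sym_formsD(4)[OF sym_forms_apply[OF shift_linear_bianchi bianchi_symbol_graded \<mu>], where K=K and I=I]
        by (cases K; cases I) auto
    qed
  qed
  obtain \<tau> where \<tau>: "\<tau> \<in> sym_forms sym_matrices (Suc (Suc (Suc 0))) 0" "(\<lambda>K. ric_symbol Q (\<tau> K)) = \<mu>"
    using sym_forms_lift[OF shift_linear_ric subspace_sym_matrices \<mu>
        ric_symbol_graded_exact[OF sym_forms_graded(1)[OF \<mu>] B\<mu>]] by blast
  have d\<tau>: "form_deriv \<tau> \<in> sym_forms sym_matrices (Suc (Suc 0)) 1"
    using form_deriv_sym_forms[OF subspace_sym_matrices \<tau>(1)] by simp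
  define \<eta> where "\<eta> = (\<lambda>K I. h K I - form_deriv \<tau> K I)"
  have \<eta>: "\<eta> \<in> sym_forms sym_matrices 2 1"
    unfolding \<eta>_def numeral_2_eq_2 by (rule sym_forms_diff[OF subspace_sym_matrices h d\<tau>])
  have "ric_symbol Q (form_deriv \<tau> K) = \<psi> K" for K
    using fun_cong[OF form_deriv_apply_sym[OF shift_linear_ric[of Q] \<tau>(1)], where x=K]
    unfolding \<tau>(2) d\<mu> by simp
  then have "ric_symbol Q (\<eta> K) = 0" for K
    using ric_symbol_diff[of Q "h K" "form_deriv \<tau> K"] unfolding fun_diff_def[of "h K"] \<eta>_def
    by (simp add: \<psi>_def fun_eq_iff)
  \<comment> \<open>The homotopy \<open>h\<close> was not normalised: \<open>d h\<close> is 3 times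
    \<open>\<omega>\<close>, whence the division by 3.\<close>
  then have "ric_symbol Q (\<lambda>I. (1 / 3) *\<^sub>R \<eta> K I) = 0" for K
    unfolding ric_symbol_scale by (simp add: fun_eq_iff)
  then have "(\<lambda>K I. (1 / 3) *\<^sub>R \<eta> K I) \<in> ric_forms 2 1"
    using sym_forms_scale[OF subspace_sym_matrices \<eta>] by (simp add: ric_forms_def)
  moreover have "form_deriv (\<lambda>K I. (1 / 3) *\<^sub>R \<eta> K I) = \<omega>"
    unfolding form_deriv_scale \<eta>_def form_deriv_diff dh
    using form_deriv_deriv[OF sym_formsD(2)[OF \<tau>(1)]] by simp
  ultimately show ?thesis by blast
qed

lemma phi12_surj: "\<exists>\<omega>\<in>ric_cocycles 1 2. phi12 \<omega> = v"
proof -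
  \<comment> \<open>The chase is run backwards, the factor 1/3 offsetting the 3 in
    \<open>phi12_form_deriv\<close>. The second lift, through the Ricci symbol, is unobstructed
    because the form to be lifted has constant coefficients.\<close>
  let ?v = "\<lambda>I. if I = [] then (1 / 3) *\<^sub>R v else 0"
  have v: "?v \<in> graded_tensors UNIV 0" by (rule constant_graded) auto
  obtain r where r: "r \<in> graded_tensors sym_matrices (Suc 0)" "bianchi_symbol Q r = ?v"
    using bianchi_symbol_graded_surj[OF v] by blast
  have \<mu>: "scalar_form r \<in> sym_forms sym_matrices (Suc 0) 0"
    by (rule scalar_form[OF r(1) subspace_sym_matrices])
  have \<psi>: "form_deriv (scalar_form r) \<in> sym_forms sym_matrices 0 (Suc 0)"
    by (rule form_deriv_sym_forms[OF subspace_sym_matrices \<mu>])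
  obtain \<eta> where \<eta>: "\<eta> \<in> sym_forms sym_matrices (Suc (Suc 0)) (Suc 0)"
      "(\<lambda>K. ric_symbol Q (\<eta> K)) = form_deriv (scalar_form r)"
    using sym_forms_lift[OF shift_linear_ric subspace_sym_matrices \<psi>
        ric_symbol_graded_exact[OF sym_forms_graded(1)[OF \<psi>] bianchi_symbol_low[OF sym_forms_graded(1)[OF \<psi>]]]]
    by blast
  have "form_homotopy (form_deriv (scalar_form r)) [] = r"
    using form_homotopy_sym_forms_formula[OF \<mu>, of "[]"] by (intro ext) (simp add: scalar_form_def)
  then have "phi12 (form_deriv \<eta>) = v"
    using phi12_form_deriv[of \<eta>] \<eta> r(2) by (simp add: numeral_2_eq_2)
  moreover have "form_deriv \<eta> \<in> ric_cocycles 1 2"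
    using ric_cocycles_form_deriv[of \<eta> 1] \<eta>(1) by (simp add: numeral_2_eq_2)
  ultimately show ?thesis by blast
qed

end

section \<open>Cosets of coboundaries and criteria for the cohomology groups\<close>

lemma elt_set_plus_eq_iff:
  fixes C :: "'a::ab_group_add set"
  assumes 0: "0 \<in> C" and diff: "\<And>a b. a \<in> C \<Longrightarrow> b \<in> C \<Longrightarrow> a - b \<in> C"
  shows "x +o C = y +o C \<longleftrightarrow> x - y \<in> C"
proof
  assume "x +o C = y +o C"
  moreover have "x \<in> x +o C" using 0 by (force simp: elt_set_plus_def)
  ultimately obtain b where "b \<in> C" "x = y + b" by (auto simp: elt_set_plus_def)
  then show "x - y \<in> C" by simp
next
  have add: "a + b \<in> C" if "a \<in> C" "b \<in> C" for a b
    using diff[OF that(1) diff[OF 0 that(2)]] by simp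
  have "u +o C \<subseteq> v +o C" if "u - v \<in> C" for u v
  proof
    fix c assume "c \<in> u +o C"
    then obtain b where "b \<in> C" "c = v + ((u - v) + b)" by (auto simp: elt_set_plus_def)
    then show "c \<in> v +o C" unfolding elt_set_plus_def using add[OF that] by blast
  qed
  moreover assume "x - y \<in> C"
  moreover from this have "y - x \<in> C" using diff[OF 0, of "x - y"] by simp
  ultimately show "x +o C = y +o C" by blast
qed

text \<open>The first isomorphism theorem: a linear map on cocycles whose kernel consists of the
  coboundaries descends to the cosets.\<close>

lemma spencer_cohomology_isoI:
  fixes \<Phi> :: "'n::finite spencer \<Rightarrow> 'v::real_vector"
  assumes C0: "0 \<in> spencer_coboundaries k G i j"
    and C: "\<And>a b. a \<in> spencer_coboundaries k G i j \<Longrightarrow> b \<in> spencer_coboundaries k G i j \<Longrightarrow>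
      a - b \<in> spencer_coboundaries k G i j"
    and Zadd: "\<And>a b. a \<in> spencer_cocycles k G i j \<Longrightarrow> b \<in> spencer_cocycles k G i j \<Longrightarrow> a + b \<in> spencer_cocycles k G i j"
    and Zscale: "\<And>a r. a \<in> spencer_cocycles k G i j \<Longrightarrow> (\<lambda>K I. r *\<^sub>R a K I) \<in> spencer_cocycles k G i j"
    and add: "\<And>a b. \<Phi> (a + b) = \<Phi> a + \<Phi> b"
    and scale: "\<And>a r. \<Phi> (\<lambda>K I. r *\<^sub>R a K I) = r *\<^sub>R \<Phi> a"
    and V: "\<Phi> ` spencer_cocycles k G i j = V"
    and kernel: "\<And>a. a \<in> spencer_cocycles k G i j \<Longrightarrow> \<Phi> a = 0 \<longleftrightarrow> a \<in> spencer_coboundaries k G i j"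
  shows "spencer_cohomology_iso k G i j V"
proof -
  let ?Z = "spencer_cocycles k G i j" and ?C = "spencer_coboundaries k G i j"
  define cls where "cls = (\<lambda>\<omega>. \<omega> +o ?C)"
  have cls: "cls a = cls b \<longleftrightarrow> a - b \<in> ?C" for a b
    unfolding cls_def by (rule elt_set_plus_eq_iff[OF C0 C])
  have minus: "a - b = a + (\<lambda>K I. (-1) *\<^sub>R b K I)" for a b :: "'n spencer"
    by (simp add: fun_eq_iff)
  have eq: "cls a = cls b \<longleftrightarrow> \<Phi> a = \<Phi> b" if "a \<in> ?Z" "b \<in> ?Z" for a b
  proof -
    have "a - b \<in> ?Z" unfolding minus by (intro Zadd Zscale that)
    moreover have "\<Phi> (a - b) = \<Phi> a - \<Phi> b" unfolding minus add scale by simp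
    ultimately show ?thesis using kernel[of "a - b"] cls by simp
  qed
  define F where "F c = \<Phi> (SOME \<omega>. \<omega> \<in> ?Z \<and> cls \<omega> = c)" for c
  have F: "F (cls \<omega>) = \<Phi> \<omega>" if "\<omega> \<in> ?Z" for \<omega>
    using someI[of "\<lambda>\<eta>. \<eta> \<in> ?Z \<and> cls \<eta> = cls \<omega>" \<omega>] that eq unfolding F_def by blast
  have "bij_betw F (cls ` ?Z) V"
    unfolding bij_betw_def
  proof
    show "inj_on F (cls ` ?Z)" by (auto simp: inj_on_def F eq)
    show "F ` cls ` ?Z = V" unfolding V[symmetric] by (auto simp: F image_iff)
  qed
  then show ?thesis
    unfolding spencer_cohomology_iso_def spencer_cohomology_def Let_def
    using F Zadd Zscale add scale unfolding cls_def by (intro exI[of _ F]) simp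
qed

lemma spencer_cohomology_zeroI:
  fixes G :: "'n::finite jet set"
  assumes C0: "0 \<in> spencer_coboundaries k G i j"
    and C: "\<And>a b. a \<in> spencer_coboundaries k G i j \<Longrightarrow> b \<in> spencer_coboundaries k G i j \<Longrightarrow>
      a - b \<in> spencer_coboundaries k G i j"
    and Z0: "0 \<in> spencer_cocycles k G i j" and Z: "spencer_cocycles k G i j \<subseteq> spencer_coboundaries k G i j"
  shows "spencer_cohomology_zero k G i j"
proof -
  let ?C = "spencer_coboundaries k G i j"
  have "\<omega> +o ?C = 0 +o ?C" if "\<omega> \<in> ?C" for \<omega>
    using that by (subst elt_set_plus_eq_iff[OF C0 C]) auto
  then have "(\<lambda>\<omega>. \<omega> +o ?C) ` spencer_cocycles k G i j = {0 +o ?C}"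
    using Z Z0 by (auto simp: image_iff)
  moreover have "0 +o ?C = ?C" by (simp add: elt_set_plus_def)
  ultimately show ?thesis unfolding spencer_cohomology_zero_def spencer_cohomology_def by simp
qed

section \<open>Cohomology and involutivity of the kernel of the Ricci symbol\<close>

context orthonormal_frame
begin

definition ric_kernel :: "'n jet set" where
  "ric_kernel = {v \<in> sym_tensors 2. ric_symbol Q v = 0}"

lemma graded_sym_tensors: "graded_tensors sym_matrices t = sym_tensors t"
  by (rule set_eqI) (simp add: graded_tensors_def sym_tensors_iff)

text \<open>Prolonging the kernel gives the kernel in every degree: once the last indices
  \<open>J\<close> are fixed, the slice has Ricci symbol concentrated at the empty list, with value
  \<open>ric_symbol Q f J\<close>.\<close>

lemma symbol_space_ric_kernel:
  "symbol_space 2 ric_kernel t = {f \<in> sym_tensors t. ric_symbol Q f = 0}"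
proof -
  consider "t < 2" | "t = 2" | "t > 2" by linarith
  then show ?thesis
  proof cases
    case 1
    then show ?thesis using ric_symbol_low[of _ t Q]
      by (auto simp: symbol_space_def graded_sym_tensors)
  next
    case 2
    then show ?thesis by (simp add: symbol_space_def ric_kernel_def)
  next
    case 3
    have "(\<forall>J. length J = t - 2 \<longrightarrow> (\<lambda>I. if length I = 2 then f (I @ J) else 0) \<in> ric_kernel) \<longleftrightarrow>
        ric_symbol Q f = 0" if f: "f \<in> sym_tensors t" for f
    proof -
      have r: "ric_symbol Q (\<lambda>I. if length I = 2 then f (I @ J) else 0) I =
          (if I = [] then ric_symbol Q f J else 0)" for I J
        by (simp add: ric_symbol_def vec_eq_iff)
      have "(\<lambda>I. if length I = 2 then f (I @ J) else 0) \<in> sym_tensors 2" for J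
      proof -
        have f': "symf f" "\<And>I. f I \<in> sym_matrices" using f by (auto simp: sym_tensors_iff)
        have "symf (\<lambda>I. f (I @ J))" by (intro symfI symfD[OF f'(1)]) simp
        from truncate_graded[OF subspace_sym_matrices this f'(2), of 2] show ?thesis
          by (simp add: truncate_def graded_sym_tensors)
      qed
      then have "(\<forall>J. length J = t - 2 \<longrightarrow> (\<lambda>I. if length I = 2 then f (I @ J) else 0) \<in> ric_kernel) \<longleftrightarrow>
          (\<forall>J. length J = t - 2 \<longrightarrow> ric_symbol Q f J = 0)"
        by (auto simp: ric_kernel_def fun_eq_iff r)
      moreover have "ric_symbol Q f J = 0" if "length J \<noteq> t - 2" for J
      proof -
        have "f \<in> graded_tensors sym_matrices (Suc (Suc (t - 2)))"
          using f 3 by (simp add: graded_sym_tensors numeral_2_eq_2 Suc_diff_Suc)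
        from graded_tensorsD(3)[OF ric_symbol_graded[OF this] that] show ?thesis .
      qed
      ultimately show ?thesis by (auto simp: fun_eq_iff)
    qed
    then show ?thesis using 3 by (auto simp: symbol_space_def)
  qed
qed

lemma forms_ric_kernel: "forms j (symbol_space 2 ric_kernel i) = ric_forms i j"
  unfolding symbol_space_ric_kernel ric_forms_def forms_sym_tensors[symmetric]
  by (auto simp: forms_iff)

lemma cocycles_ric_kernel: "spencer_cocycles 2 ric_kernel i j = ric_cocycles i j"
  unfolding spencer_cocycles_def forms_ric_kernel ric_cocycles_def spencer_delta_0_iff ..

lemma ric_forms_scale: "\<omega> \<in> ric_forms i j \<Longrightarrow> (\<lambda>K I. c *\<^sub>R \<omega> K I) \<in> ric_forms i j"
  using sym_forms_scale[OF subspace_sym_matrices, of \<omega> i j c]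
  by (auto simp: ric_forms_def ric_symbol_scale fun_eq_iff)

lemma ric_forms_diff:
  assumes "\<omega> \<in> ric_forms i j" "\<eta> \<in> ric_forms i j" shows "(\<lambda>K I. \<omega> K I - \<eta> K I) \<in> ric_forms i j"
proof -
  have "ric_symbol Q (\<lambda>I. \<omega> K I - \<eta> K I) = 0" for K
    using ric_symbol_diff[of Q "\<omega> K" "\<eta> K"] assms by (simp add: ric_forms_def fun_diff_def zero_fun_def)
  then show ?thesis using sym_forms_diff[OF subspace_sym_matrices, of \<omega> i j \<eta>] assms
    by (simp add: ric_forms_def)
qed

lemma coboundaries_ric_kernel:
  "spencer_coboundaries 2 ric_kernel i (Suc j) = form_deriv ` ric_forms (Suc i) j"
proof -
  have d: "spencer_delta \<omega> = form_deriv (\<lambda>K I. real (Suc i) *\<^sub>R \<omega> K I)" if "\<omega> \<in> ric_forms (Suc i) j" for \<omega>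
    using spencer_delta_sym_forms[OF subspace_sym_matrices, of \<omega> i j] that by (simp add: ric_forms_def)
  have "form_deriv \<omega> \<in> spencer_delta ` ric_forms (Suc i) j" if "\<omega> \<in> ric_forms (Suc i) j" for \<omega>
  proof -
    have s: "(\<lambda>K I. (1 / real (Suc i)) *\<^sub>R \<omega> K I) \<in> ric_forms (Suc i) j" by (rule ric_forms_scale[OF that])
    have "spencer_delta (\<lambda>K I. (1 / real (Suc i)) *\<^sub>R \<omega> K I) = form_deriv \<omega>"
      unfolding d[OF s] by simp
    then show ?thesis using s by (metis imageI)
  qed
  moreover have "spencer_delta \<omega> \<in> form_deriv ` ric_forms (Suc i) j" if "\<omega> \<in> ric_forms (Suc i) j" for \<omega>
    unfolding d[OF that] by (intro imageI ric_forms_scale that)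
  ultimately show ?thesis unfolding spencer_coboundaries_def forms_ric_kernel by auto
qed

lemma ric_forms_0: "0 \<in> ric_forms i j"
proof -
  have "(0 :: 'n spencer) \<in> sym_forms sym_matrices i j"
    using subspace_0[OF subspace_sym_matrices] by (auto simp: sym_forms_def altf_def symf_def)
  then show ?thesis using shift_linear_zero[OF shift_linear_ric[of Q]] by (simp add: ric_forms_def)
qed

lemma ric_cocycles_0: "0 \<in> ric_cocycles i j"
  by (simp add: ric_cocycles_def ric_forms_0 form_deriv_zero)

lemma ric_cocycles_scale: "\<omega> \<in> ric_cocycles i j \<Longrightarrow> (\<lambda>K I. c *\<^sub>R \<omega> K I) \<in> ric_cocycles i j"
  by (auto simp: ric_cocycles_def ric_forms_scale form_deriv_scale fun_eq_iff)

lemma ric_cocycles_add: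
  assumes "\<omega> \<in> ric_cocycles i j" "\<eta> \<in> ric_cocycles i j" shows "\<omega> + \<eta> \<in> ric_cocycles i j"
proof -
  have "(\<lambda>K I. \<omega> K I - (-1) *\<^sub>R \<eta> K I) \<in> ric_forms i j"
    using assms unfolding ric_cocycles_def by (intro ric_forms_diff ric_forms_scale) auto
  moreover have "(\<lambda>K I. \<omega> K I - (-1) *\<^sub>R \<eta> K I) = \<omega> + \<eta>" by (simp add: fun_eq_iff)
  moreover have "form_deriv (\<omega> + \<eta>) = form_deriv \<omega> + form_deriv \<eta>"
    using form_deriv_add[of \<omega> \<eta>] by (simp add: plus_fun_def)
  ultimately show ?thesis using assms by (simp add: ric_cocycles_def)
qed

lemma coboundaries_subgroup:
  "0 \<in> spencer_coboundaries 2 ric_kernel i j"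
  "u \<in> spencer_coboundaries 2 ric_kernel i j \<Longrightarrow> v \<in> spencer_coboundaries 2 ric_kernel i j \<Longrightarrow>
    u - v \<in> spencer_coboundaries 2 ric_kernel i j"
proof -
  show "0 \<in> spencer_coboundaries 2 ric_kernel i j"
  proof (cases j)
    case (Suc j')
    then show ?thesis unfolding Suc coboundaries_ric_kernel
      by (intro image_eqI[where x=0]) (simp_all add: ric_forms_0 form_deriv_zero)
  qed (simp add: spencer_coboundaries_def)
  assume ab: "u \<in> spencer_coboundaries 2 ric_kernel i j" "v \<in> spencer_coboundaries 2 ric_kernel i j"
  show "u - v \<in> spencer_coboundaries 2 ric_kernel i j"
  proof (cases j)
    case 0
    then show ?thesis using ab by (simp add: spencer_coboundaries_def)
  next
    case (Suc j')
    obtain \<omega> \<eta> where *: "\<omega> \<in> ric_forms (Suc i) j'" "\<eta> \<in> ric_forms (Suc i) j'" "u = form_deriv \<omega>" "v = form_deriv \<eta>"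
      using ab unfolding Suc coboundaries_ric_kernel by blast
    then have "u - v = form_deriv (\<lambda>K I. \<omega> K I - \<eta> K I)"
      unfolding form_deriv_diff by (simp add: fun_eq_iff)
    then show ?thesis unfolding Suc coboundaries_ric_kernel using ric_forms_diff[OF *(1,2)] by blast
  qed
qed

lemma ric_kernel_cohomology_00: "spencer_cohomology_iso 2 ric_kernel 0 0 (sym_matrices :: (real^'n^'n) set)"
proof (rule spencer_cohomology_isoI[where \<Phi>="\<lambda>\<omega>. \<omega> [] []", OF coboundaries_subgroup], unfold cocycles_ric_kernel)
  have Z: "ric_cocycles 0 0 = sym_forms sym_matrices 0 0"
    using form_deriv_degree_0 by (auto simp: ric_cocycles_def ric_forms_low)
  show "(\<lambda>\<omega>. \<omega> [] []) ` ric_cocycles 0 0 = (sym_matrices :: (real^'n^'n) set)"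
  proof (intro equalityI subsetI)
    fix M :: "real^'n^'n" assume M: "M \<in> sym_matrices"
    have "scalar_form (\<lambda>I. if I = [] then M else 0) \<in> ric_cocycles 0 0"
      unfolding Z by (intro scalar_form constant_graded subspace_sym_matrices M)
    then show "M \<in> (\<lambda>\<omega>. \<omega> [] []) ` ric_cocycles 0 0"
      by (rule rev_image_eqI) (simp add: scalar_form_def)
  qed (use Z sym_formsD(3) in blast)
  show "a [] [] = 0 \<longleftrightarrow> a \<in> spencer_coboundaries 2 ric_kernel 0 0" if "a \<in> ric_cocycles 0 0" for a
  proof -
    have "a K I = 0" if "K \<noteq> [] \<or> I \<noteq> []" for K I
      using sym_formsD(4)[of a sym_matrices 0 0 K I] that \<open>a \<in> _\<close> Z by auto
    then have "a = 0 \<longleftrightarrow> a [] [] = 0" unfolding fun_eq_iff by (metis zero_fun_apply)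
    then show ?thesis by (simp add: spencer_coboundaries_def)
  qed
qed (auto intro: ric_cocycles_add ric_cocycles_scale)

lemma ric_kernel_cohomology_11: "spencer_cohomology_iso 2 ric_kernel 1 1 (sym_matrices :: (real^'n^'n) set)"
proof (rule spencer_cohomology_isoI[where \<Phi>=phi11, OF coboundaries_subgroup], unfold cocycles_ric_kernel)
  show "phi11 ` ric_cocycles 1 1 = (sym_matrices :: (real^'n^'n) set)"
    using phi11_in phi11_surj by blast
  have C: "spencer_coboundaries 2 ric_kernel 1 1 = form_deriv ` ric_forms 2 0"
    using coboundaries_ric_kernel[of 1 0] by (simp add: numeral_2_eq_2)
  show "phi11 a = 0 \<longleftrightarrow> a \<in> spencer_coboundaries 2 ric_kernel 1 1" if "a \<in> ric_cocycles 1 1" for a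
    unfolding C using phi11_kernel[OF that] phi11_coboundary by blast
qed (auto intro: ric_cocycles_add ric_cocycles_scale phi11_add phi11_scale)

lemma ric_kernel_cohomology_12: "spencer_cohomology_iso 2 ric_kernel 1 2 (UNIV :: (real^'n) set)"
proof (rule spencer_cohomology_isoI[where \<Phi>=phi12, OF coboundaries_subgroup], unfold cocycles_ric_kernel)
  show "phi12 ` ric_cocycles 1 2 = (UNIV :: (real^'n) set)"
    using phi12_surj by (metis UNIV_eq_I imageI)
  have C: "spencer_coboundaries 2 ric_kernel 1 2 = form_deriv ` ric_forms 2 1"
    using coboundaries_ric_kernel[of 1 1] by (simp add: numeral_2_eq_2)
  show "phi12 a = 0 \<longleftrightarrow> a \<in> spencer_coboundaries 2 ric_kernel 1 2" if "a \<in> ric_cocycles 1 2" for a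
    unfolding C using phi12_kernel[OF that] phi12_coboundary by blast
qed (auto intro: ric_cocycles_add ric_cocycles_scale phi12_add phi12_scale)

lemma ric_kernel_cohomology_zero:
  assumes "(i, j) \<notin> {(0, 0), (1, 1), (1, 2)}"
  shows "spencer_cohomology_zero 2 ric_kernel i j"
proof (rule spencer_cohomology_zeroI[OF coboundaries_subgroup], unfold cocycles_ric_kernel)
  show "0 \<in> ric_cocycles i j" by (rule ric_cocycles_0)
  show "ric_cocycles i j \<subseteq> spencer_coboundaries 2 ric_kernel i j"
  proof
    fix \<omega> assume "\<omega> \<in> ric_cocycles i j"
    then have \<omega>: "\<omega> \<in> ric_forms i j" "form_deriv \<omega> = 0" by (auto simp: ric_cocycles_def)
    show "\<omega> \<in> spencer_coboundaries 2 ric_kernel i j"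
    proof (cases j)
      case 0
      then obtain i' where "i = Suc i'" using assms by (cases i) auto
      then have "\<omega> = 0" using \<omega> 0 poincare_0[of \<omega> sym_matrices i'] by (simp add: ric_forms_def)
      then show ?thesis using 0 by (simp add: spencer_coboundaries_def)
    next
      case (Suc j')
      then show ?thesis using ric_forms_exact[of \<omega> i j'] \<omega> assms coboundaries_ric_kernel[of i j'] by auto
    qed
  qed
qed

lemma involutive_ric_kernel: "involutive_symbol 2 ric_kernel"
  unfolding involutive_symbol_def by (intro allI impI ric_kernel_cohomology_zero) auto

end

section \<open>Calculus of smooth functions\<close>

lemma partial_deriv_eqI: "(f has_derivative D) (at y) \<Longrightarrow> partial_deriv i f y = D (axis i 1)"
  unfolding partial_deriv_def using frechet_derivative_at by metis

lemma partial_deriv_cong: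
  assumes "open V" "y \<in> V" "\<And>z. z \<in> V \<Longrightarrow> f z = g z" "f differentiable (at y)"
  shows "partial_deriv i f y = partial_deriv i g y"
  unfolding partial_deriv_def using frechet_derivative_transform_within_open[OF assms(4,1,2,3)] by simp

lemma differentiable_cong_open:
  assumes "open V" "y \<in> V" "\<And>z. z \<in> V \<Longrightarrow> f z = g z" "f differentiable (at y)"
  shows "g differentiable (at y)"
proof -
  obtain D where "(f has_derivative D) (at y)" using assms(4) unfolding differentiable_def by blast
  from has_derivative_transform_within_open[OF this assms(1,2,3)] show ?thesis
    unfolding differentiable_def by blast
qed

lemma partial_deriv_bounded_linear:
  assumes "bounded_linear L" "f differentiable (at y)"
  shows "(\<lambda>z. L (f z)) differentiable (at y)" "partial_deriv i (\<lambda>z. L (f z)) y = L (partial_deriv i f y)"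
proof -
  have "(f has_derivative frechet_derivative f (at y)) (at y)"
    using assms(2) frechet_derivative_works by blast
  from bounded_linear.has_derivative[OF assms(1) this]
  show "(\<lambda>z. L (f z)) differentiable (at y)" "partial_deriv i (\<lambda>z. L (f z)) y = L (partial_deriv i f y)"
    by (auto simp: differentiable_def partial_deriv_def[of i f] intro!: partial_deriv_eqI[THEN trans])
qed

lemma partial_deriv_bilinear:
  assumes "bounded_bilinear B" "f differentiable (at y)" "g differentiable (at y)"
  shows "(\<lambda>z. B (f z) (g z)) differentiable (at y)"
    "partial_deriv i (\<lambda>z. B (f z) (g z)) y = B (f y) (partial_deriv i g y) + B (partial_deriv i f y) (g y)"
proof -
  have "(f has_derivative frechet_derivative f (at y)) (at y)" "(g has_derivative frechet_derivative g (at y)) (at y)"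
    using assms(2,3) frechet_derivative_works by blast+
  from bounded_bilinear.FDERIV[OF assms(1) this]
  show "(\<lambda>z. B (f z) (g z)) differentiable (at y)"
    "partial_deriv i (\<lambda>z. B (f z) (g z)) y = B (f y) (partial_deriv i g y) + B (partial_deriv i f y) (g y)"
    by (auto simp: differentiable_def partial_deriv_def[of i f] partial_deriv_def[of i g] intro!: partial_deriv_eqI[THEN trans])
qed

lemma partial_deriv_add:
  assumes "f differentiable (at y)" "g differentiable (at y)"
  shows "partial_deriv i (\<lambda>z. f z + g z) y = partial_deriv i f y + partial_deriv i g y"
  using partial_deriv_eqI[OF has_derivative_add[OF assms[unfolded frechet_derivative_works]]]
  by (simp add: partial_deriv_def)

lemma partial_deriv_const: "partial_deriv i (\<lambda>z. c) = (\<lambda>z. 0)"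
  by (simp add: partial_deriv_def fun_eq_iff)

lemma partial_derivs_append: "partial_derivs (I @ J) f = partial_derivs I (partial_derivs J f)"
  by (induction I) simp_all

lemma smooth_map_on_iff:
  "smooth_map_on V f \<longleftrightarrow> (\<forall>y\<in>V. f differentiable (at y)) \<and> (\<forall>i. smooth_map_on V (partial_deriv i f))"
  (is "?L \<longleftrightarrow> ?R")
proof
  assume ?L
  then have *: "partial_derivs I f differentiable (at y)" if "y \<in> V" for I y
    using that by (auto simp: smooth_map_on_def)
  show ?R
    unfolding smooth_map_on_def
  proof (intro conjI ballI allI)
    show "f differentiable (at y)" if "y \<in> V" for y using *[OF that, of "[]"] by simp
    show "partial_derivs I (partial_deriv i f) differentiable (at y)" if "y \<in> V" for y I i
      using *[OF that, of "I @ [i]"] by (simp add: partial_derivs_append)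
  qed
next
  assume R: ?R
  have "partial_derivs I f differentiable (at y)" if "y \<in> V" for I y
  proof (cases I rule: rev_cases)
    case (snoc J i)
    then show ?thesis using R that by (simp add: partial_derivs_append smooth_map_on_def)
  qed (use R that in simp)
  then show ?L by (simp add: smooth_map_on_def)
qed

lemma smooth_differentiable: "smooth_map_on V f \<Longrightarrow> y \<in> V \<Longrightarrow> f differentiable (at y)"
  using smooth_map_on_iff by blast

lemma smooth_partial_deriv: "smooth_map_on V f \<Longrightarrow> smooth_map_on V (partial_deriv i f)"
  using smooth_map_on_iff by blast

lemma smooth_partial_derivs: "smooth_map_on V f \<Longrightarrow> smooth_map_on V (partial_derivs I f)"
  by (induction I) (auto intro: smooth_partial_deriv)

lemma smooth_subset: "smooth_map_on V f \<Longrightarrow> W \<subseteq> V \<Longrightarrow> smooth_map_on W f"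
  by (auto simp: smooth_map_on_def)

text \<open>Differentiability to finite order, peeling off the innermost derivative, so that the
  Leibniz rule and its relatives provide the inductive steps of the closure properties.\<close>

primrec smooth_upto :: "(real^'n::finite) set \<Rightarrow> nat \<Rightarrow> (real^'n \<Rightarrow> 'b::real_normed_vector) \<Rightarrow> bool" where
  "smooth_upto V 0 f \<longleftrightarrow> (\<forall>y\<in>V. f differentiable (at y))"
| "smooth_upto V (Suc k) f \<longleftrightarrow> (\<forall>y\<in>V. f differentiable (at y)) \<and> (\<forall>i. smooth_upto V k (partial_deriv i f))"

lemma smooth_upto_Suc: "smooth_upto V (Suc k) f \<Longrightarrow> smooth_upto V k f"
  by (induction k arbitrary: f) auto

lemma smooth_iff_upto: "smooth_map_on V f \<longleftrightarrow> (\<forall>k. smooth_upto V k f)"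
proof
  have "smooth_map_on V f \<Longrightarrow> smooth_upto V k f" for k
  proof (induction k arbitrary: f)
    case 0 then show ?case using smooth_map_on_iff[of V f] by simp
  next
    case (Suc k) then show ?case using smooth_map_on_iff[of V f] by simp
  qed
  then show "smooth_map_on V f \<Longrightarrow> \<forall>k. smooth_upto V k f" by blast
next
  assume *: "\<forall>k. smooth_upto V k f"
  have "smooth_upto V (length I) f \<Longrightarrow> y \<in> V \<Longrightarrow> partial_derivs I f differentiable (at y)" for I y
  proof (induction I arbitrary: f rule: rev_induct)
    case (snoc i I)
    then show ?case by (simp add: partial_derivs_append)
  qed simp
  then show "smooth_map_on V f" using * by (simp add: smooth_map_on_def)
qed

context
  fixes V :: "(real^'n::finite) set"
  assumes V: "open V"
begin

lemma smooth_upto_cong: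
  "smooth_upto V k f \<Longrightarrow> (\<And>z. z \<in> V \<Longrightarrow> f z = g z) \<Longrightarrow> smooth_upto V k g"
proof (induction k arbitrary: f g)
  case 0
  then show ?case using differentiable_cong_open[OF V] by (metis smooth_upto.simps(1))
next
  case (Suc k)
  have d: "\<forall>y\<in>V. f differentiable (at y)" using Suc.prems(1) by simp
  have "smooth_upto V k (partial_deriv i g)" for i
  proof (rule Suc.IH)
    show "smooth_upto V k (partial_deriv i f)" using Suc.prems(1) by simp
    show "partial_deriv i f z = partial_deriv i g z" if "z \<in> V" for z
      by (rule partial_deriv_cong[OF V that Suc.prems(2)]) (use d that in auto)
  qed
  moreover have "g differentiable (at y)" if "y \<in> V" for y
    by (rule differentiable_cong_open[OF V that Suc.prems(2)]) (use d that in auto)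
  ultimately show ?case by simp
qed

lemma smooth_cong: "smooth_map_on V f \<Longrightarrow> (\<And>z. z \<in> V \<Longrightarrow> f z = g z) \<Longrightarrow> smooth_map_on V g"
  unfolding smooth_iff_upto using smooth_upto_cong by blast

lemma smooth_upto_add: "smooth_upto V k f \<Longrightarrow> smooth_upto V k g \<Longrightarrow> smooth_upto V k (\<lambda>z. f z + g z)"
proof (induction k arbitrary: f g)
  case (Suc k)
  have "smooth_upto V k (partial_deriv i (\<lambda>z. f z + g z))" for i
  proof (rule smooth_upto_cong)
    show "smooth_upto V k (\<lambda>z. partial_deriv i f z + partial_deriv i g z)" using Suc by simp
    show "partial_deriv i f z + partial_deriv i g z = partial_deriv i (\<lambda>z. f z + g z) z" if "z \<in> V" for z
      using Suc.prems that by (simp add: partial_deriv_add)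
  qed
  then show ?case using Suc.prems by (auto intro: differentiable_add)
qed (auto intro: differentiable_add)

lemma smooth_add: "smooth_map_on V f \<Longrightarrow> smooth_map_on V g \<Longrightarrow> smooth_map_on V (\<lambda>z. f z + g z)"
  unfolding smooth_iff_upto using smooth_upto_add by blast

lemma smooth_const: "smooth_map_on V (\<lambda>z. c)"
proof -
  have "smooth_upto V k (\<lambda>z. c)" for k
  proof (induction k arbitrary: c)
    case (Suc k)
    show ?case using Suc.IH[of 0] by (simp add: partial_deriv_const)
  qed simp
  then show ?thesis by (simp add: smooth_iff_upto)
qed

lemma smooth_bounded_linear:
  assumes L: "bounded_linear L" and f: "smooth_map_on V f"
  shows "smooth_map_on V (\<lambda>z. L (f z))"
proof -
  have "smooth_upto V k f \<Longrightarrow> smooth_upto V k (\<lambda>z. L (f z))" for k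
  proof (induction k arbitrary: f)
    case 0
    then show ?case by (simp add: partial_deriv_bounded_linear(1)[OF L])
  next
    case (Suc k)
    have "smooth_upto V k (partial_deriv i (\<lambda>z. L (f z)))" for i
    proof (rule smooth_upto_cong)
      show "smooth_upto V k (\<lambda>z. L (partial_deriv i f z))" using Suc by simp
      show "L (partial_deriv i f z) = partial_deriv i (\<lambda>z. L (f z)) z" if "z \<in> V" for z
        using Suc.prems that by (simp add: partial_deriv_bounded_linear(2)[OF L])
    qed
    then show ?case using Suc.prems by (simp add: partial_deriv_bounded_linear(1)[OF L])
  qed
  then show ?thesis using f by (simp add: smooth_iff_upto)
qed

lemma smooth_upto_bilinear:
  assumes B: "bounded_bilinear B"
  shows "smooth_upto V k f \<Longrightarrow> smooth_upto V k g \<Longrightarrow> smooth_upto V k (\<lambda>z. B (f z) (g z))"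
proof (induction k arbitrary: f g)
  case 0
  then show ?case by (simp add: partial_deriv_bilinear(1)[OF B])
next
  case (Suc k)
  have "smooth_upto V k (partial_deriv i (\<lambda>z. B (f z) (g z)))" for i
  proof (rule smooth_upto_cong)
    show "smooth_upto V k (\<lambda>z. B (f z) (partial_deriv i g z) + B (partial_deriv i f z) (g z))"
      using Suc smooth_upto_Suc[of V k f] smooth_upto_Suc[of V k g] by (intro smooth_upto_add) auto
    show "B (f z) (partial_deriv i g z) + B (partial_deriv i f z) (g z) = partial_deriv i (\<lambda>z. B (f z) (g z)) z"
      if "z \<in> V" for z
      using Suc.prems that by (simp add: partial_deriv_bilinear(2)[OF B])
  qed
  then show ?case using Suc.prems by (simp add: partial_deriv_bilinear(1)[OF B])
qed

lemma smooth_bilinear: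
  assumes "bounded_bilinear B" "smooth_map_on V f" "smooth_map_on V g"
  shows "smooth_map_on V (\<lambda>z. B (f z) (g z))"
  using smooth_upto_bilinear[OF assms(1)] assms(2,3) by (simp add: smooth_iff_upto)

lemmas smooth_mult = smooth_bilinear[OF bounded_bilinear_mult]

lemma smooth_cmult: "smooth_map_on V f \<Longrightarrow> smooth_map_on V (\<lambda>z. c * f z :: real)"
  by (rule smooth_mult[OF smooth_const])

lemma smooth_diff:
  assumes "smooth_map_on V f" "smooth_map_on V g" shows "smooth_map_on V (\<lambda>z. f z - g z)"
  using smooth_add[OF assms(1) smooth_bounded_linear[OF bounded_linear_minus[OF bounded_linear_ident] assms(2)]]
  by simp

lemma smooth_sum: "(\<And>s. s \<in> S \<Longrightarrow> smooth_map_on V (f s)) \<Longrightarrow> smooth_map_on V (\<lambda>z. \<Sum>s\<in>S. f s z)"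
  by (induction S rule: infinite_finite_induct) (auto intro: smooth_add smooth_const)

lemma smooth_prod:
  fixes f :: "'a \<Rightarrow> real^'n \<Rightarrow> real"
  shows "(\<And>s. s \<in> S \<Longrightarrow> smooth_map_on V (f s)) \<Longrightarrow> smooth_map_on V (\<lambda>z. \<Prod>s\<in>S. f s z)"
  by (induction S rule: infinite_finite_induct) (auto intro: smooth_mult smooth_const)

lemma smooth_inverse:
  fixes f :: "real^'n \<Rightarrow> real"
  assumes f: "smooth_map_on V f" and nz: "\<And>y. y \<in> V \<Longrightarrow> f y \<noteq> 0"
  shows "smooth_map_on V (\<lambda>z. inverse (f z))"
proof -
  have d: "((\<lambda>z. inverse (f z)) has_derivative
      (\<lambda>h. - (inverse (f y) * frechet_derivative f (at y) h * inverse (f y)))) (at y)" if "y \<in> V" for y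
    by (rule Deriv.has_derivative_inverse[OF nz[OF that] smooth_differentiable[OF f that, unfolded frechet_derivative_works]])
  have "smooth_upto V k (\<lambda>z. inverse (f z))" for k
  proof (induction k)
    case 0
    then show ?case using d by (auto simp: differentiable_def)
  next
    case (Suc k)
    have "smooth_upto V k (partial_deriv i (\<lambda>z. inverse (f z)))" for i
    proof (rule smooth_upto_cong)
      have f': "smooth_upto V k (\<lambda>z. (-1) * partial_deriv i f z)"
        using smooth_cmult[OF smooth_partial_deriv[OF f, of i], of "-1"] unfolding smooth_iff_upto by blast
      show "smooth_upto V k (\<lambda>z. inverse (f z) * ((-1) * partial_deriv i f z) * inverse (f z))"
        by (rule smooth_upto_bilinear[OF bounded_bilinear_mult smooth_upto_bilinear[OF bounded_bilinear_mult Suc.IH f'] Suc.IH])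
      show "inverse (f z) * ((-1) * partial_deriv i f z) * inverse (f z) = partial_deriv i (\<lambda>z. inverse (f z)) z"
        if "z \<in> V" for z
        using partial_deriv_eqI[OF d[OF that], of i] by (simp add: partial_deriv_def[of i f])
    qed
    then show ?case using d by (auto simp: differentiable_def)
  qed
  then show ?thesis by (simp add: smooth_iff_upto)
qed

lemma partial_derivs_cong:
  assumes f: "smooth_map_on V f" and eq: "\<And>z. z \<in> V \<Longrightarrow> f z = g z" and y: "y \<in> V"
  shows "partial_derivs I f y = partial_derivs I g y"
  using y
proof (induction I arbitrary: y)
  case (Cons i I)
  show ?case unfolding partial_derivs.simps
    using smooth_differentiable[OF smooth_partial_derivs[OF f] Cons.prems, of I] Cons.IH
    by (intro partial_deriv_cong[OF V Cons.prems]) auto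
qed (simp add: eq)

lemma partial_derivs_add:
  assumes f: "smooth_map_on V f" and g: "smooth_map_on V g" and y: "y \<in> V"
  shows "partial_derivs I (\<lambda>z. f z + g z) y = partial_derivs I f y + partial_derivs I g y"
  using y
proof (induction I arbitrary: y)
  case (Cons i I)
  have s: "smooth_map_on V (partial_derivs I f)" "smooth_map_on V (partial_derivs I g)"
    by (intro smooth_partial_derivs f g)+
  have "partial_derivs (i # I) (\<lambda>z. f z + g z) y = partial_deriv i (\<lambda>z. partial_derivs I f z + partial_derivs I g z) y"
    unfolding partial_derivs.simps
    by (rule partial_deriv_cong[OF V Cons.prems Cons.IH])
      (auto intro: smooth_differentiable[OF smooth_partial_derivs[OF smooth_add[OF f g]] Cons.prems])
  then show ?case using partial_deriv_add[OF s[THEN smooth_differentiable[OF _ Cons.prems]]] by simp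
qed simp

lemma partial_derivs_bounded_linear:
  assumes L: "bounded_linear L" and f: "smooth_map_on V f" and y: "y \<in> V"
  shows "partial_derivs I (\<lambda>z. L (f z)) y = L (partial_derivs I f y)"
  using y
proof (induction I arbitrary: y)
  case (Cons i I)
  have s: "smooth_map_on V (partial_derivs I f)" by (intro smooth_partial_derivs f)
  have "partial_derivs (i # I) (\<lambda>z. L (f z)) y = partial_deriv i (\<lambda>z. L (partial_derivs I f z)) y"
    unfolding partial_derivs.simps
    by (rule partial_deriv_cong[OF V Cons.prems Cons.IH])
      (auto intro: smooth_differentiable[OF smooth_partial_derivs[OF smooth_bounded_linear[OF L f]] Cons.prems])
  then show ?case using partial_deriv_bounded_linear(2)[OF L smooth_differentiable[OF s Cons.prems]] by simp
qed simp

end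

subsection \<open>Symmetry of mixed partial derivatives\<close>

lemma partial_deriv_line:
  assumes "f differentiable (at (w + s *\<^sub>R axis i 1))"
  shows "((\<lambda>s. f (w + s *\<^sub>R axis i 1)) has_real_derivative partial_deriv i f (w + s *\<^sub>R axis i 1)) (at s)"
proof -
  let ?D = "frechet_derivative f (at (w + s *\<^sub>R axis i 1))"
  have D: "(f has_derivative ?D) (at (w + s *\<^sub>R axis i 1))"
    using assms frechet_derivative_works by blast
  have "((\<lambda>s. w + s *\<^sub>R axis i 1) has_derivative (\<lambda>h. h *\<^sub>R axis i 1)) (at s)"
    by (auto intro!: derivative_eq_intros)
  from has_derivative_compose[OF this D]
  have "((\<lambda>s. f (w + s *\<^sub>R axis i 1)) has_derivative (\<lambda>h. ?D (h *\<^sub>R axis i 1))) (at s)" .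
  moreover have "?D (h *\<^sub>R axis i 1) = h * ?D (axis i 1)" for h
    using linear_cmul[OF has_derivative_linear[OF D]] by simp
  ultimately show ?thesis by (simp add: has_field_derivative_def partial_deriv_def mult_commute_abs)
qed

text \<open>The mean value theorem is used twice, first along \<open>i\<close> for the increment in
  direction \<open>j\<close>, then along \<open>j\<close>. The left-hand side is symmetric in
  \<open>i\<close> and \<open>j\<close>, so comparing both orders and letting the square shrink
  yields Schwarz's theorem.\<close>

lemma second_difference:
  fixes f :: "real^'n::finite \<Rightarrow> real"
  assumes f: "smooth_map_on V f" and h: "h > 0"
    and V: "\<And>s t. \<lbrakk>0 \<le> s; s \<le> h; 0 \<le> t; t \<le> h\<rbrakk> \<Longrightarrow> x + s *\<^sub>R axis i 1 + t *\<^sub>R axis j 1 \<in> V"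
  shows "\<exists>s t. 0 \<le> s \<and> s \<le> h \<and> 0 \<le> t \<and> t \<le> h \<and>
    f (x + h *\<^sub>R axis i 1 + h *\<^sub>R axis j 1) - f (x + h *\<^sub>R axis i 1) - f (x + h *\<^sub>R axis j 1) + f x =
    h * h * partial_deriv j (partial_deriv i f) (x + s *\<^sub>R axis i 1 + t *\<^sub>R axis j 1)"
proof -
  define \<phi> where "\<phi> s = f (x + h *\<^sub>R axis j 1 + s *\<^sub>R axis i 1) - f (x + s *\<^sub>R axis i 1)" for s
  have d1: "(\<phi> has_real_derivative (partial_deriv i f (x + h *\<^sub>R axis j 1 + s *\<^sub>R axis i 1) - partial_deriv i f (x + s *\<^sub>R axis i 1))) (at s)"
    if s: "0 \<le> s" "s \<le> h" for s
  proof -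
    have "x + h *\<^sub>R axis j 1 + s *\<^sub>R axis i 1 \<in> V" "x + s *\<^sub>R axis i 1 \<in> V"
      using V[of s h] V[of s 0] s h by (auto simp: add_ac)
    then show ?thesis unfolding \<phi>_def
      by (intro DERIV_diff partial_deriv_line smooth_differentiable[OF f])
  qed
  obtain s where s: "s > 0" "s < h" "\<phi> h - \<phi> 0 = (h - 0) *
      (partial_deriv i f (x + h *\<^sub>R axis j 1 + s *\<^sub>R axis i 1) - partial_deriv i f (x + s *\<^sub>R axis i 1))"
    using MVT2[OF h d1] by blast
  define \<psi> where "\<psi> t = partial_deriv i f (x + s *\<^sub>R axis i 1 + t *\<^sub>R axis j 1)" for t
  have d2: "(\<psi> has_real_derivative partial_deriv j (partial_deriv i f) (x + s *\<^sub>R axis i 1 + t *\<^sub>R axis j 1)) (at t)"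
    if "0 \<le> t" "t \<le> h" for t
    unfolding \<psi>_def using V[of s t] s that
    by (intro partial_deriv_line smooth_differentiable[OF smooth_partial_deriv[OF f]]) auto
  obtain t where t: "t > 0" "t < h" "\<psi> h - \<psi> 0 = (h - 0) * partial_deriv j (partial_deriv i f) (x + s *\<^sub>R axis i 1 + t *\<^sub>R axis j 1)"
    using MVT2[OF h d2] by blast
  have "\<psi> h = partial_deriv i f (x + h *\<^sub>R axis j 1 + s *\<^sub>R axis i 1)" "\<psi> 0 = partial_deriv i f (x + s *\<^sub>R axis i 1)"
    by (simp_all add: \<psi>_def add_ac)
  then have "\<phi> h - \<phi> 0 = h * h * partial_deriv j (partial_deriv i f) (x + s *\<^sub>R axis i 1 + t *\<^sub>R axis j 1)"
    using s(3) t(3) by (simp add: mult.assoc)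
  moreover have "\<phi> h - \<phi> 0 = f (x + h *\<^sub>R axis i 1 + h *\<^sub>R axis j 1) - f (x + h *\<^sub>R axis i 1) - f (x + h *\<^sub>R axis j 1) + f x"
    by (simp add: \<phi>_def add_ac)
  ultimately show ?thesis using s t by (intro exI[of _ s] exI[of _ t]) auto
qed

lemma partial_deriv_commute_real:
  fixes f :: "real^'n::finite \<Rightarrow> real"
  assumes V: "open V" and f: "smooth_map_on V f" and x: "x \<in> V"
  shows "partial_deriv i (partial_deriv j f) x = partial_deriv j (partial_deriv i f) x"
proof (rule ccontr)
  let ?A = "partial_deriv i (partial_deriv j f)" and ?B = "partial_deriv j (partial_deriv i f)"
  assume ne: "?A x \<noteq> ?B x"
  define \<epsilon> where "\<epsilon> = \<bar>?A x - ?B x\<bar> / 2"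
  have \<epsilon>: "\<epsilon> > 0" using ne by (simp add: \<epsilon>_def)
  have "continuous (at x) ?A" "continuous (at x) ?B"
    by (intro differentiable_imp_continuous_within smooth_differentiable[OF _ x] smooth_partial_deriv f)+
  then obtain d1 d2 where d: "d1 > 0" "d2 > 0" "\<And>y. dist y x < d1 \<Longrightarrow> dist (?A y) (?A x) < \<epsilon>"
    "\<And>y. dist y x < d2 \<Longrightarrow> dist (?B y) (?B x) < \<epsilon>"
    using \<epsilon> unfolding continuous_at_eps_delta by metis
  obtain r where r: "r > 0" "ball x r \<subseteq> V" using V x by (meson openE)
  \<comment> \<open>Points of the square of side \<open>h\<close> have distance at most
    \<open>2 * h\<close> from \<open>x\<close>, strictly less than \<open>3 * h\<close>, hence lie
    within all three radii.\<close>
  define h where "h = min r (min d1 d2) / 3"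
  have h: "h > 0" "3 * h \<le> r" "3 * h \<le> d1" "3 * h \<le> d2" using d r by (auto simp: h_def)
  have dist: "dist (x + s *\<^sub>R axis k 1 + t *\<^sub>R axis l 1) x < 3 * h"
    if "0 \<le> s" "s \<le> h" "0 \<le> t" "t \<le> h" for s t and k l :: 'n
  proof -
    have "norm (s *\<^sub>R axis k 1 + t *\<^sub>R axis l (1::real)) \<le> norm (s *\<^sub>R axis k (1::real)) + norm (t *\<^sub>R axis l (1::real))"
      by (rule norm_triangle_ineq)
    also have "\<dots> = s + t" using that by (simp add: norm_axis_1)
    finally show ?thesis using that h by (simp add: dist_norm add.assoc)
  qed
  have inV: "x + s *\<^sub>R axis k 1 + t *\<^sub>R axis l 1 \<in> V" if "0 \<le> s" "s \<le> h" "0 \<le> t" "t \<le> h" for s t and k l :: 'n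
    using dist[OF that, of k l] r(2) h(2) by (auto simp: dist_commute)
  obtain s t where st: "0 \<le> s" "s \<le> h" "0 \<le> t" "t \<le> h"
    "f (x + h *\<^sub>R axis i 1 + h *\<^sub>R axis j 1) - f (x + h *\<^sub>R axis i 1) - f (x + h *\<^sub>R axis j 1) + f x =
    h * h * ?B (x + s *\<^sub>R axis i 1 + t *\<^sub>R axis j 1)"
    using second_difference[OF f h(1) inV, of i j] by blast
  obtain s' t' where st': "0 \<le> s'" "s' \<le> h" "0 \<le> t'" "t' \<le> h"
    "f (x + h *\<^sub>R axis j 1 + h *\<^sub>R axis i 1) - f (x + h *\<^sub>R axis j 1) - f (x + h *\<^sub>R axis i 1) + f x =
    h * h * ?A (x + s' *\<^sub>R axis j 1 + t' *\<^sub>R axis i 1)"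
    using second_difference[OF f h(1) inV, of j i] by blast
  have "h * h * ?B (x + s *\<^sub>R axis i 1 + t *\<^sub>R axis j 1) = h * h * ?A (x + s' *\<^sub>R axis j 1 + t' *\<^sub>R axis i 1)"
  proof -
    have c: "x + h *\<^sub>R axis j 1 + h *\<^sub>R axis i 1 = x + h *\<^sub>R axis i 1 + h *\<^sub>R axis j 1"
      by (simp add: add_ac)
    show ?thesis using st(5) st'(5)[unfolded c] by linarith
  qed
  then have "?B (x + s *\<^sub>R axis i 1 + t *\<^sub>R axis j 1) = ?A (x + s' *\<^sub>R axis j 1 + t' *\<^sub>R axis i 1)" using h(1) by simp
  moreover have "dist (?B (x + s *\<^sub>R axis i 1 + t *\<^sub>R axis j 1)) (?B x) < \<epsilon>"
    using dist[OF st(1-4), of i j] h(4) by (intro d) auto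
  moreover have "dist (?A (x + s' *\<^sub>R axis j 1 + t' *\<^sub>R axis i 1)) (?A x) < \<epsilon>"
    using dist[OF st'(1-4), of j i] h(3) by (intro d) auto
  ultimately show False unfolding \<epsilon>_def dist_real_def by (auto simp: abs_if split: if_splits)
qed

lemma partial_deriv_commute:
  fixes f :: "real^'n::finite \<Rightarrow> 'b::euclidean_space"
  assumes V: "open V" and f: "smooth_map_on V f" and x: "x \<in> V"
  shows "partial_deriv i (partial_deriv j f) x = partial_deriv j (partial_deriv i f) x"
proof (rule euclidean_eqI)
  fix e :: 'b assume "e \<in> Basis"
  have L: "bounded_linear (\<lambda>v::'b. v \<bullet> e)" by (rule bounded_linear_inner_left)
  have "partial_derivs [k, l] (\<lambda>z. f z \<bullet> e) x = partial_derivs [k, l] f x \<bullet> e" for k l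
    by (rule partial_derivs_bounded_linear[OF V L f x])
  then show "partial_deriv i (partial_deriv j f) x \<bullet> e = partial_deriv j (partial_deriv i f) x \<bullet> e"
    using partial_deriv_commute_real[OF V smooth_bounded_linear[OF V L f] x, of i j] by simp
qed

lemma symf_partial_derivs:
  fixes f :: "real^'n::finite \<Rightarrow> 'b::euclidean_space"
  assumes V: "open V" and f: "smooth_map_on V f" and y: "y \<in> V"
  shows "symf (\<lambda>I. partial_derivs I f y)"
proof (rule symf_adjacent)
  fix xs ys :: "'n list" and a b :: 'n
  have s: "smooth_map_on V (partial_derivs ys f)" by (rule smooth_partial_derivs[OF f])
  show "partial_derivs (xs @ a # b # ys) f y = partial_derivs (xs @ b # a # ys) f y"
    unfolding partial_derivs_append partial_derivs.simps
    by (rule partial_derivs_cong[OF V _ _ y])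
      (auto intro: smooth_partial_deriv s partial_deriv_commute[OF V s])
qed

subsection \<open>Functions vanishing to a given order\<close>

text \<open>Plays the part of the \<open>k\<close>-th power of the ideal of functions vanishing at
  \<open>x\<close>: computing modulo it discards what cannot affect derivatives of order less than
  \<open>k\<close>.\<close>

definition vanishing :: "(real^'n::finite) set \<Rightarrow> real^'n \<Rightarrow> nat \<Rightarrow> (real^'n \<Rightarrow> real) set" where
  "vanishing V x k = {f. smooth_map_on V f \<and> (\<forall>I. length I < k \<longrightarrow> partial_derivs I f x = 0)}"

lemma vanishing_smooth: "f \<in> vanishing V x k \<Longrightarrow> smooth_map_on V f"
  by (simp add: vanishing_def)

lemma vanishing_0: "f \<in> vanishing V x 0 \<longleftrightarrow> smooth_map_on V f"
  by (simp add: vanishing_def)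

lemma vanishing_mono: "f \<in> vanishing V x k \<Longrightarrow> j \<le> k \<Longrightarrow> f \<in> vanishing V x j"
  by (simp add: vanishing_def)

lemma vanishing_Suc:
  "f \<in> vanishing V x (Suc k) \<longleftrightarrow> smooth_map_on V f \<and> f x = 0 \<and> (\<forall>i. partial_deriv i f \<in> vanishing V x k)"
proof
  assume f: "f \<in> vanishing V x (Suc k)"
  have "partial_derivs I (partial_deriv i f) x = 0" if "length I < k" for I i
    using f that unfolding vanishing_def by (auto dest!: spec[of _ "I @ [i]"] simp: partial_derivs_append)
  moreover have "f x = 0" using f by (auto simp: vanishing_def dest: spec[of _ "[]"])
  ultimately show "smooth_map_on V f \<and> f x = 0 \<and> (\<forall>i. partial_deriv i f \<in> vanishing V x k)"
    using f smooth_partial_deriv[of V f] by (auto simp: vanishing_def)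
next
  assume R: "smooth_map_on V f \<and> f x = 0 \<and> (\<forall>i. partial_deriv i f \<in> vanishing V x k)"
  have "partial_derivs I f x = 0" if "length I < Suc k" for I
  proof (cases I rule: rev_cases)
    case (snoc J i)
    then show ?thesis using R that by (auto simp: vanishing_def partial_derivs_append)
  qed (use R in simp)
  then show "f \<in> vanishing V x (Suc k)" using R by (simp add: vanishing_def)
qed

lemma vanishing_partial_deriv: "f \<in> vanishing V x k \<Longrightarrow> partial_deriv i f \<in> vanishing V x (k - 1)"
  using vanishing_Suc[of f V x "k - 1"] smooth_partial_deriv[of V f i] by (cases k) (auto simp: vanishing_0)

context
  fixes V :: "(real^'n::finite) set" and x :: "real^'n"
  assumes V: "open V" and x: "x \<in> V"
begin

lemma vanishing_cong: "f \<in> vanishing V x k \<Longrightarrow> (\<And>z. z \<in> V \<Longrightarrow> f z = g z) \<Longrightarrow> g \<in> vanishing V x k"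
  using partial_derivs_cong[OF V _ _ x, of f g] smooth_cong[OF V, of f g] by (simp add: vanishing_def)

lemma vanishing_add: "f \<in> vanishing V x k \<Longrightarrow> g \<in> vanishing V x k \<Longrightarrow> (\<lambda>z. f z + g z) \<in> vanishing V x k"
  by (simp add: vanishing_def smooth_add[OF V] partial_derivs_add[OF V _ _ x])

text \<open>Leibniz rule and induction on the total order. The derivative of a factor of order 0 has
  order 0 again, so in that case the loss of one order is charged to the other factor.\<close>

lemma vanishing_mult:
  "f \<in> vanishing V x j \<Longrightarrow> g \<in> vanishing V x k \<Longrightarrow> (\<lambda>z. f z * g z) \<in> vanishing V x (j + k)"
proof (induction "j + k" arbitrary: j k f g)
  case 0
  then show ?case by (simp add: vanishing_0 smooth_mult[OF V])
next
  case (Suc m)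
  have s: "smooth_map_on V f" "smooth_map_on V g" using Suc.prems by (auto intro: vanishing_smooth)
  have fg: "f x * g x = 0"
  proof (cases j)
    case 0
    then obtain k' where "k = Suc k'" using Suc.hyps(2) by (cases k) auto
    then show ?thesis using Suc.prems(2) by (simp add: vanishing_Suc)
  next
    case (Suc j')
    then show ?thesis using \<open>f \<in> vanishing V x j\<close> by (simp add: vanishing_Suc)
  qed
  have "partial_deriv i (\<lambda>z. f z * g z) \<in> vanishing V x m" for i
  proof (rule vanishing_cong)
    have 1: "(\<lambda>z. f z * partial_deriv i g z) \<in> vanishing V x m"
    proof (cases k)
      case 0
      then obtain j' where j': "j = Suc j'" "m = j' + 0" using Suc.hyps(2) by (cases j) auto
      show ?thesis unfolding j'(2)
        using Suc.prems(1) 0 j' smooth_partial_deriv[OF s(2)]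
        by (intro Suc.hyps(1)) (auto intro: vanishing_mono simp: vanishing_0)
    next
      case (Suc k')
      have m: "m = j + k'" using Suc.hyps(2) Suc by simp
      show ?thesis unfolding m
        using Suc.prems vanishing_partial_deriv[of g V x k i] Suc m
        by (intro Suc.hyps(1)) auto
    qed
    have 2: "(\<lambda>z. partial_deriv i f z * g z) \<in> vanishing V x m"
    proof (cases j)
      case 0
      then obtain k' where k': "k = Suc k'" "m = 0 + k'" using Suc.hyps(2) by (cases k) auto
      show ?thesis unfolding k'(2)
        using Suc.prems(2) 0 k' smooth_partial_deriv[OF s(1)]
        by (intro Suc.hyps(1)) (auto intro: vanishing_mono simp: vanishing_0)
    next
      case (Suc j')
      have m: "m = j' + k" using Suc.hyps(2) Suc by simp
      show ?thesis unfolding m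
        using Suc.prems vanishing_partial_deriv[of f V x j i] Suc m
        by (intro Suc.hyps(1)) auto
    qed
    show "(\<lambda>z. f z * partial_deriv i g z + partial_deriv i f z * g z) \<in> vanishing V x m"
      by (rule vanishing_add[OF 1 2])
    show "f z * partial_deriv i g z + partial_deriv i f z * g z = partial_deriv i (\<lambda>z. f z * g z) z"
      if "z \<in> V" for z
      using partial_deriv_bilinear(2)[OF bounded_bilinear_mult s[THEN smooth_differentiable[OF _ that]]] by simp
  qed
  then show ?case unfolding Suc.hyps(2)[symmetric] vanishing_Suc
    using fg smooth_mult[OF V s] by simp
qed

lemma vanishing_smult: "smooth_map_on V f \<Longrightarrow> g \<in> vanishing V x k \<Longrightarrow> (\<lambda>z. f z * g z) \<in> vanishing V x k"
  using vanishing_mult[of f 0 g k] by (simp add: vanishing_0)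

lemma vanishing_cmult: "g \<in> vanishing V x k \<Longrightarrow> (\<lambda>z. c * g z) \<in> vanishing V x k"
  using vanishing_smult[OF smooth_const[OF V]] by blast

lemma vanishing_diff: "f \<in> vanishing V x k \<Longrightarrow> g \<in> vanishing V x k \<Longrightarrow> (\<lambda>z. f z - g z) \<in> vanishing V x k"
  using vanishing_add[of f k "\<lambda>z. (-1) * g z"] vanishing_cmult[of g k "-1"] by simp

lemma vanishing_zero: "(\<lambda>z. 0) \<in> vanishing V x k"
proof (induction k)
  case (Suc k)
  then show ?case by (simp add: vanishing_Suc smooth_const[OF V] partial_deriv_const)
qed (simp add: vanishing_0 smooth_const[OF V])

lemma vanishing_sum: "(\<And>s. s \<in> S \<Longrightarrow> f s \<in> vanishing V x k) \<Longrightarrow> (\<lambda>z. \<Sum>s\<in>S. f s z) \<in> vanishing V x k"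
  by (induction S rule: infinite_finite_induct) (auto intro: vanishing_add vanishing_zero)

end

section \<open>The Ricci tensor of a metric in a chart\<close>

lemma matrix_inv_right_left:
  fixes B :: "real^'n::finite^'n"
  assumes "invertible B" shows "B ** matrix_inv B = mat 1" "matrix_inv B ** B = mat 1"
proof -
  have "\<exists>C. B ** C = mat 1 \<and> C ** B = mat 1" using assms by (simp add: invertible_def)
  from someI_ex[OF this] show "B ** matrix_inv B = mat 1" "matrix_inv B ** B = mat 1"
    by (simp_all add: matrix_inv_def)
qed

lemma matrix_inv_unique:
  fixes B :: "real^'n::finite^'n"
  assumes "B ** C = mat 1" "C ** B = mat 1" shows "matrix_inv B = C"
proof -
  have "invertible B" using assms unfolding invertible_def by (intro exI[of _ C] conjI)
  then have "matrix_inv B = matrix_inv B ** (B ** C)" using assms(1) by simp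
  also have "\<dots> = C" by (simp add: matrix_mul_assoc matrix_inv_right_left(2)[OF \<open>invertible B\<close>])
  finally show ?thesis .
qed

text \<open>For an orthonormal basis the dual coframe is \<open>e a *\<^sub>R (B *v b a)\<close>,
  and the inverse of \<open>B\<close> is the sum of the squares of the basis vectors weighted by
  their signs.\<close>

lemma has_signature_orthonormal_frame:
  fixes B :: "real^'n::finite^'n"
  assumes "has_signature B p q" "CARD('n) \<ge> 3"
  shows "\<exists>b \<beta> e. orthonormal_frame (matrix_inv B) b \<beta> e" and "invertible B"
proof -
  obtain b :: "'n \<Rightarrow> real^'n" where "\<forall>i j. i \<noteq> j \<longrightarrow> b i \<bullet> (B *v b j) = 0"
      "\<forall>i. b i \<bullet> (B *v b i) \<in> {1, -1}"
    using assms(1) unfolding has_signature_def by (elim exE conjE) (rule that)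
  then have b: "i \<noteq> j \<Longrightarrow> b i \<bullet> (B *v b j) = 0" "b i \<bullet> (B *v b i) \<in> {1, -1}" for i j
    by (simp_all only: simp_thms)
  define e where "e a = b a \<bullet> (B *v b a)" for a
  have e: "e a * e a = 1" for a using b(2)[of a] by (auto simp: e_def)
  define P :: "real^'n^'n" where "P = (\<chi> a i. b a $ i)"
  define \<beta> where "\<beta> a = e a *\<^sub>R (B *v b a)" for a
  define R :: "real^'n^'n" where "R = (\<chi> i a. \<beta> a $ i)"
  have inv2: "(\<Sum>i\<in>UNIV. b a $ i * \<beta> c $ i) = (if a = c then 1 else 0)" for a c
  proof -
    have "(\<Sum>i\<in>UNIV. b a $ i * \<beta> c $ i) = e c * (b a \<bullet> (B *v b c))"
      by (simp add: \<beta>_def inner_vec_def sum_distrib_left mult_ac)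
    then show ?thesis using b(1)[of a c] e by (auto simp: e_def)
  qed
  then have PR: "P ** R = mat 1"
    by (simp add: P_def R_def matrix_matrix_mult_def mat_def vec_eq_iff)
  then have RP: "R ** P = mat 1" by (simp add: matrix_left_right_inverse)
  then have inv1: "(\<Sum>a\<in>UNIV. \<beta> a $ i * b a $ j) = (if i = j then 1 else 0)" for i j
    by (simp add: P_def R_def matrix_matrix_mult_def mat_def vec_eq_iff)
  define Q :: "real^'n^'n" where "Q = (\<chi> i j. \<Sum>a\<in>UNIV. e a * (b a $ i * b a $ j))"
  have "(B ** Q) $ i $ j = mat 1 $ i $ j" for i j
  proof -
    have "(B ** Q) $ i $ j = (\<Sum>k\<in>UNIV. \<Sum>a\<in>UNIV. e a * (B $ i $ k * b a $ k) * b a $ j)"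
      by (simp add: Q_def matrix_matrix_mult_def sum_distrib_left mult_ac)
    also have "\<dots> = (\<Sum>a\<in>UNIV. \<beta> a $ i * b a $ j)"
      by (subst sum.swap) (simp add: \<beta>_def matrix_vector_mult_def sum_distrib_left sum_distrib_right)
    finally show ?thesis by (simp add: inv1 mat_def)
  qed
  then have BQ: "B ** Q = mat 1" by (simp add: vec_eq_iff)
  then have QB: "Q ** B = mat 1" by (simp add: matrix_left_right_inverse)
  from BQ QB show "invertible B" unfolding invertible_def by blast
  have "matrix_inv B = Q" by (rule matrix_inv_unique[OF BQ QB])
  then have mi: "matrix_inv B $ i $ j = (\<Sum>a\<in>UNIV. e a * (b a $ i * b a $ j))" for i j by (simp add: Q_def)
  have "orthonormal_frame (matrix_inv B) b \<beta> e"
    by (intro orthonormal_frame.intro assms(2) e mi inv1 inv2)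
  then show "\<exists>b \<beta> e. orthonormal_frame (matrix_inv B) b \<beta> e" by (intro exI)
qed

text \<open>Writes the inverse through determinants, from which its smooth dependence on the matrix
  is read off.\<close>

lemma matrix_inv_cramer:
  fixes A :: "real^'n::finite^'n"
  assumes "invertible A"
  shows "matrix_inv A $ k $ l = det (\<chi> i j. if j = k then (if i = l then 1 else 0) else A $ i $ j) * inverse (det A)"
proof -
  have "A *v (matrix_inv A *v axis l 1) = axis l 1"
    by (simp add: matrix_vector_mul_assoc matrix_inv_right_left(1)[OF assms])
  moreover have "det A \<noteq> 0" using assms by (simp add: invertible_det_nz)
  ultimately have "matrix_inv A *v axis l 1 = (\<chi> k. det (\<chi> i j. if j = k then axis l 1 $ i else A $ i $ j) / det A)"
    using cramer by blast
  then have "(matrix_inv A *v axis l 1) $ k = det (\<chi> i j. if j = k then axis l 1 $ i else A $ i $ j) / det A" by simp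
  moreover have "(matrix_inv A *v axis l 1) $ k = matrix_inv A $ k $ l"
    by (simp add: matrix_vector_mult_basis column_def)
  moreover have "(\<chi> i j. if j = k then axis l 1 $ i else A $ i $ j) = (\<chi> i j. if j = k then (if i = l then 1 else 0) else A $ i $ j)"
    by (simp add: axis_def vec_eq_iff)
  ultimately show ?thesis by (simp add: divide_inverse)
qed

lemma smooth_det:
  fixes F :: "real^'n::finite \<Rightarrow> real^'m::finite^'m"
  assumes V: "open V" and F: "\<And>i j. smooth_map_on V (\<lambda>z. F z $ i $ j)"
  shows "smooth_map_on V (\<lambda>z. det (F z))"
  unfolding det_def by (intro smooth_sum[OF V] smooth_cmult[OF V] smooth_prod[OF V] F)

lemma bounded_linear_entry: "bounded_linear (\<lambda>M::real^'n::finite^'m::finite. M $ i $ j)"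
  using bounded_linear_compose[OF bounded_linear_vec_nth bounded_linear_vec_nth] by blast

lemma smooth_vec_iff:
  fixes F :: "real^'n::finite \<Rightarrow> 'b::real_normed_vector^'m::finite"
  assumes V: "open V"
  shows "smooth_map_on V F \<longleftrightarrow> (\<forall>i. smooth_map_on V (\<lambda>z. F z $ i))"
proof
  show "smooth_map_on V F \<Longrightarrow> \<forall>i. smooth_map_on V (\<lambda>z. F z $ i)"
    using smooth_bounded_linear[OF V bounded_linear_vec_nth] by blast
  assume *: "\<forall>i. smooth_map_on V (\<lambda>z. F z $ i)"
  have L: "bounded_linear (\<lambda>v. axis i v :: 'b^'m)" for i :: 'm
  proof (rule bounded_linear_intro[where K=1])
    show "norm (axis i v :: 'b^'m) \<le> norm v * 1" for v :: 'b
      unfolding norm_vec_def axis_def L2_set_def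
      by (simp add: if_distrib[of norm] if_distrib[of "\<lambda>x. x\<^sup>2"] cong: if_cong)
  qed (auto simp: axis_def vec_eq_iff)
  have "smooth_map_on V (\<lambda>z. \<Sum>i\<in>UNIV. axis i (F z $ i))"
    using * by (intro smooth_sum[OF V] smooth_bounded_linear[OF V L]) blast
  moreover have "(\<Sum>i\<in>UNIV. axis i (F z $ i)) = F z" for z
    by (simp add: vec_eq_iff axis_def cong: if_cong)
  ultimately show "smooth_map_on V F" by simp
qed

lemma smooth_entries_iff:
  fixes F :: "real^'n::finite \<Rightarrow> real^'k::finite^'m::finite"
  assumes V: "open V"
  shows "smooth_map_on V F \<longleftrightarrow> (\<forall>i j. smooth_map_on V (\<lambda>z. F z $ i $ j))"
  using smooth_vec_iff[OF V, of F] smooth_vec_iff[OF V, of "\<lambda>z. F z $ i" for i] by simp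

lemma smooth_divide:
  assumes "open V" "smooth_map_on V f" shows "smooth_map_on V (\<lambda>z. f z / (c::real))"
  using smooth_cmult[OF assms, of "1 / c"] by simp

locale chart_metric =
  fixes V :: "(real^'n::finite) set" and g :: "real^'n \<Rightarrow> real^'n^'n"
  assumes V: "open V" and smooth: "smooth_map_on V g"
    and sym: "y \<in> V \<Longrightarrow> g y \<in> sym_matrices" and inv: "y \<in> V \<Longrightarrow> invertible (g y)"
begin

lemma g_swap: "y \<in> V \<Longrightarrow> g y $ i $ j = g y $ j $ i"
  using sym by (simp add: sym_matrices_iff)

lemma g_smooth: "smooth_map_on V (\<lambda>z. g z $ i $ j)"
  using smooth smooth_entries_iff[OF V] by blast

definition Q :: "'n \<Rightarrow> 'n \<Rightarrow> real^'n \<Rightarrow> real" where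
  "Q k l = (\<lambda>y. matrix_inv (g y) $ k $ l)"

lemma Q_g: "y \<in> V \<Longrightarrow> (\<Sum>l\<in>UNIV. Q k l y * g y $ l $ m) = (if k = m then 1 else 0)"
  using matrix_inv_right_left(2)[OF inv, of y]
  by (simp add: Q_def matrix_matrix_mult_def vec_eq_iff mat_def)

lemma g_Q: "y \<in> V \<Longrightarrow> (\<Sum>l\<in>UNIV. g y $ k $ l * Q l m y) = (if k = m then 1 else 0)"
  using matrix_inv_right_left(1)[OF inv, of y]
  by (simp add: Q_def matrix_matrix_mult_def vec_eq_iff mat_def)

lemma Q_swap: assumes "y \<in> V" shows "Q k l y = Q l k y"
proof -
  have "transpose (matrix_inv (g y)) ** g y = mat 1" "g y ** transpose (matrix_inv (g y)) = mat 1"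
    using arg_cong[OF matrix_inv_right_left(1)[OF inv[OF assms]], of transpose]
      arg_cong[OF matrix_inv_right_left(2)[OF inv[OF assms]], of transpose] sym[OF assms]
    by (simp_all add: matrix_transpose_mul transpose_mat sym_matrices_def)
  then have "matrix_inv (g y) = transpose (matrix_inv (g y))" by (metis matrix_inv_unique)
  from arg_cong[OF this, of "\<lambda>M. M $ k $ l"] show ?thesis by (simp add: Q_def transpose_def)
qed

lemma Q_smooth: "smooth_map_on V (Q k l)"
proof (rule smooth_cong[OF V])
  show "smooth_map_on V (\<lambda>z. det (\<chi> i j. if j = k then (if i = l then 1 else 0) else g z $ i $ j) * inverse (det (g z)))"
  proof (rule smooth_mult[OF V smooth_det[OF V] smooth_inverse[OF V smooth_det[OF V g_smooth]]])
    show "smooth_map_on V (\<lambda>z. (\<chi> i j. if j = k then (if i = l then 1 else 0) else g z $ i $ j) $ i $ j)" for i j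
      by (cases "j = k") (simp_all add: smooth_const[OF V] g_smooth)
    show "det (g y) \<noteq> 0" if "y \<in> V" for y using inv[OF that] by (simp add: invertible_det_nz)
  qed
qed (simp add: Q_def matrix_inv_cramer[OF inv])

abbreviation \<Gamma> :: "'n \<Rightarrow> 'n \<Rightarrow> 'n \<Rightarrow> real^'n \<Rightarrow> real" where
  "\<Gamma> \<equiv> christoffel g"

lemma christoffel_eq: "\<Gamma> k i j = (\<lambda>y. (\<Sum>l\<in>UNIV. Q k l y *
        (partial_deriv i (\<lambda>z. g z $ j $ l) y + partial_deriv j (\<lambda>z. g z $ i $ l) y
         - partial_deriv l (\<lambda>z. g z $ i $ j) y)) / 2)"
  by (simp add: christoffel_def Q_def fun_eq_iff)

lemma \<Gamma>_smooth: "smooth_map_on V (\<Gamma> k i j)"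
  unfolding christoffel_eq
  by (intro smooth_divide[OF V] smooth_sum[OF V] smooth_mult[OF V] smooth_diff[OF V] smooth_add[OF V]
      Q_smooth smooth_partial_deriv g_smooth)

lemma riemann_smooth: "smooth_map_on V (riemann g a b c d)"
  unfolding riemann_def[abs_def]
  by (intro smooth_sum[OF V] smooth_mult[OF V] smooth_diff[OF V] smooth_add[OF V]
      smooth_partial_deriv \<Gamma>_smooth)

lemma ricci_smooth: "smooth_map_on V (ricci g b d)"
  unfolding ricci_def[abs_def] by (intro smooth_sum[OF V] riemann_smooth)

end

subsection \<open>Variation of the Ricci tensor\<close>

lemma partial_deriv_sum:
  assumes "\<And>s. s \<in> S \<Longrightarrow> f s differentiable (at y)"
  shows "(\<lambda>z. \<Sum>s\<in>S. f s z) differentiable (at y) \<and> partial_deriv i (\<lambda>z. \<Sum>s\<in>S. f s z) y = (\<Sum>s\<in>S. partial_deriv i (f s) y)"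
  using assms
proof (induction S rule: infinite_finite_induct)
  case (insert s S)
  then show ?case by (auto simp: partial_deriv_add intro: differentiable_add)
qed (simp_all add: partial_deriv_const)

lemma partial_deriv_diff:
  assumes "f differentiable (at y)" "g differentiable (at y)"
  shows "partial_deriv i (\<lambda>z. f z - g z) y = partial_deriv i f y - partial_deriv i g y"
  using partial_deriv_eqI[OF has_derivative_diff[OF assms[unfolded frechet_derivative_works]]]
  by (simp add: partial_deriv_def)

text \<open>The two metrics agree at \<open>x\<close> up to order \<open>k + 1\<close>. Modulo
  functions vanishing to order \<open>k + 1\<close>, the difference of the Ricci tensors then
  consists of the second derivatives of the difference \<open>h\<close>, with coefficients frozen at
  \<open>x\<close>.\<close>

locale metric_pair = g: chart_metric V g + g': chart_metric V g'
  for V :: "(real^'n::finite) set" and g g' +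
  fixes x :: "real^'n" and k :: nat
  assumes x: "x \<in> V"
    and van: "\<And>i j. (\<lambda>z. g' z $ i $ j - g z $ i $ j) \<in> vanishing V x (Suc (Suc k))"
begin

definition h :: "'n \<Rightarrow> 'n \<Rightarrow> real^'n \<Rightarrow> real" where
  "h i j = (\<lambda>z. g' z $ i $ j - g z $ i $ j)"

lemmas V = g.V

lemma h_van: "h i j \<in> vanishing V x (Suc (Suc k))" using van by (simp add: h_def)

lemma h_smooth: "smooth_map_on V (h i j)" using h_van by (rule vanishing_smooth)

lemma dh_van: "partial_deriv l (h i j) \<in> vanishing V x (Suc k)"
  using vanishing_partial_deriv[OF h_van] by simp

lemma h_swap: "y \<in> V \<Longrightarrow> h i j y = h j i y"
  unfolding h_def by (simp add: g.g_swap[of y i] g'.g_swap[of y i])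

lemma dh: "y \<in> V \<Longrightarrow> partial_deriv l (\<lambda>z. g' z $ i $ j) y = partial_deriv l (\<lambda>z. g z $ i $ j) y + partial_deriv l (h i j) y"
  using partial_deriv_diff[OF smooth_differentiable[OF g'.g_smooth] smooth_differentiable[OF g.g_smooth]]
  by (simp add: h_def)

lemma ddh_swap:
  assumes "y \<in> V" shows "partial_deriv a (partial_deriv c (h i j)) y = partial_deriv a (partial_deriv c (h j i)) y"
  using partial_derivs_cong[OF V h_smooth _ assms, of i j "h j i" "[a, c]"] h_swap by simp

lemma ddh_commute:
  assumes "y \<in> V" shows "partial_deriv a (partial_deriv c (h i j)) y = partial_deriv c (partial_deriv a (h i j)) y"
  by (rule partial_deriv_commute[OF V h_smooth assms])

text \<open>Resolvent identity: \<open>Q' - Q = - Q' (g' - g) Q\<close>.\<close>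

lemma Q_van: "(\<lambda>z. g'.Q i j z - g.Q i j z) \<in> vanishing V x (Suc (Suc k))"
proof (rule vanishing_cong[OF V x])
  show "(\<lambda>z. (-1) * (\<Sum>a\<in>UNIV. \<Sum>c\<in>UNIV. (g'.Q i a z * g.Q c j z) * h a c z)) \<in> vanishing V x (Suc (Suc k))"
    by (intro vanishing_cmult[OF V x] vanishing_sum[OF V x] vanishing_smult[OF V x] h_van smooth_mult[OF V]
        g.Q_smooth g'.Q_smooth)
  show "(-1) * (\<Sum>a\<in>UNIV. \<Sum>c\<in>UNIV. (g'.Q i a z * g.Q c j z) * h a c z) = g'.Q i j z - g.Q i j z" if z: "z \<in> V" for z
  proof -
    have 1: "(\<Sum>a\<in>UNIV. \<Sum>c\<in>UNIV. (g'.Q i a z * g.Q c j z) * g z $ a $ c) = g'.Q i j z"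
    proof -
      have "(\<Sum>a\<in>UNIV. \<Sum>c\<in>UNIV. (g'.Q i a z * g.Q c j z) * g z $ a $ c) =
          (\<Sum>a\<in>UNIV. g'.Q i a z * (\<Sum>c\<in>UNIV. g z $ a $ c * g.Q c j z))"
        by (simp add: sum_distrib_left mult_ac)
      then show ?thesis by (simp add: g.g_Q[OF z] if_distrib[of "\<lambda>x. _ * x"] cong: if_cong)
    qed
    have 2: "(\<Sum>a\<in>UNIV. \<Sum>c\<in>UNIV. (g'.Q i a z * g.Q c j z) * g' z $ a $ c) = g.Q i j z"
    proof -
      have "(\<Sum>a\<in>UNIV. \<Sum>c\<in>UNIV. (g'.Q i a z * g.Q c j z) * g' z $ a $ c) =
          (\<Sum>c\<in>UNIV. (\<Sum>a\<in>UNIV. g'.Q i a z * g' z $ a $ c) * g.Q c j z)"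
        by (subst sum.swap) (simp add: sum_distrib_left mult_ac)
      then show ?thesis by (simp add: g'.Q_g[OF z] if_distrib[of "\<lambda>x. x * _"] cong: if_cong)
    qed
    show ?thesis using 1 2 by (simp add: h_def right_diff_distrib sum_subtractf)
  qed
qed

text \<open>The linearised Christoffel symbols, with the inverse metric frozen at
  \<open>x\<close>.\<close>

definition T :: "'n \<Rightarrow> 'n \<Rightarrow> 'n \<Rightarrow> real^'n \<Rightarrow> real" where
  "T a d b = (\<lambda>z. (\<Sum>l\<in>UNIV. g.Q a l x *
     (partial_deriv d (h b l) z + partial_deriv b (h d l) z - partial_deriv l (h d b) z)) / 2)"

lemma T_van: "T a d b \<in> vanishing V x (Suc k)"
proof -
  have "(\<lambda>z. (1 / 2) * (\<Sum>l\<in>UNIV. g.Q a l x *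
     (partial_deriv d (h b l) z + partial_deriv b (h d l) z - partial_deriv l (h d b) z))) \<in> vanishing V x (Suc k)"
    by (intro vanishing_cmult[OF V x] vanishing_sum[OF V x] vanishing_add[OF V x] vanishing_diff[OF V x] dh_van)
  then show ?thesis by (simp add: T_def)
qed

text \<open>With \<open>S' = S + H\<close> for the first derivatives of the metrics,
  \<open>Q' S' - Q S - Q(x) H\<close> is \<open>(Q' - Q) S' + (Q - Q(x)) H\<close>. The first
  product vanishes to order \<open>k + 2\<close> through \<open>Q' - Q\<close>, the second because
  its orders 1 and \<open>k + 1\<close> add.\<close>

lemma \<Gamma>_van: "(\<lambda>z. g'.\<Gamma> a d b z - g.\<Gamma> a d b z - T a d b z) \<in> vanishing V x (Suc (Suc k))"
proof (rule vanishing_cong[OF V x])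
  let ?S' = "\<lambda>l z. partial_deriv d (\<lambda>z. g' z $ b $ l) z + partial_deriv b (\<lambda>z. g' z $ d $ l) z - partial_deriv l (\<lambda>z. g' z $ d $ b) z"
  let ?H = "\<lambda>l z. partial_deriv d (h b l) z + partial_deriv b (h d l) z - partial_deriv l (h d b) z"
  have 1: "(\<lambda>z. ?S' l z * (g'.Q a l z - g.Q a l z)) \<in> vanishing V x (Suc (Suc k))" for l
    by (intro vanishing_smult[OF V x] Q_van smooth_add[OF V] smooth_diff[OF V] smooth_partial_deriv g'.g_smooth)
  have "(\<lambda>z. g.Q a l z - g.Q a l x) \<in> vanishing V x 1" for l
    using smooth_diff[OF V g.Q_smooth[of a l] smooth_const[OF V, of "g.Q a l x"]]
    by (simp add: vanishing_Suc vanishing_0 smooth_partial_deriv)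
  moreover have "?H l \<in> vanishing V x (Suc k)" for l
    by (intro vanishing_add[OF V x] vanishing_diff[OF V x] dh_van)
  ultimately have 2: "(\<lambda>z. (g.Q a l z - g.Q a l x) * ?H l z) \<in> vanishing V x (Suc (Suc k))" for l
    using vanishing_mult[OF V x, of "\<lambda>z. g.Q a l z - g.Q a l x" 1 "?H l" "Suc k"] by simp
  show "(\<lambda>z. (1 / 2) * (\<Sum>l\<in>UNIV. ?S' l z * (g'.Q a l z - g.Q a l z) + (g.Q a l z - g.Q a l x) * ?H l z)) \<in> vanishing V x (Suc (Suc k))"
    by (intro vanishing_cmult[OF V x] vanishing_sum[OF V x] vanishing_add[OF V x] 1 2)
  show "(1 / 2) * (\<Sum>l\<in>UNIV. ?S' l z * (g'.Q a l z - g.Q a l z) + (g.Q a l z - g.Q a l x) * ?H l z) =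
      g'.\<Gamma> a d b z - g.\<Gamma> a d b z - T a d b z" if z: "z \<in> V" for z
    unfolding g.christoffel_eq g'.christoffel_eq T_def dh[OF z]
    by (simp add: sum_subtractf[symmetric] diff_divide_distrib[symmetric])
      (intro sum.cong refl, simp add: algebra_simps)
qed

lemma d\<Gamma>_van:
  "(\<lambda>z. partial_deriv c (g'.\<Gamma> a d b) z - partial_deriv c (g.\<Gamma> a d b) z - partial_deriv c (T a d b) z) \<in> vanishing V x (Suc k)"
proof (rule vanishing_cong[OF V x])
  show "partial_deriv c (\<lambda>z. g'.\<Gamma> a d b z - g.\<Gamma> a d b z - T a d b z) \<in> vanishing V x (Suc k)"
    using vanishing_partial_deriv[OF \<Gamma>_van] by simp
  fix z assume z: "z \<in> V"
  have s: "smooth_map_on V (T a d b)" by (rule vanishing_smooth[OF T_van])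
  show "partial_deriv c (\<lambda>z. g'.\<Gamma> a d b z - g.\<Gamma> a d b z - T a d b z) z =
      partial_deriv c (g'.\<Gamma> a d b) z - partial_deriv c (g.\<Gamma> a d b) z - partial_deriv c (T a d b) z"
    using smooth_differentiable[OF g.\<Gamma>_smooth z] smooth_differentiable[OF g'.\<Gamma>_smooth z] smooth_differentiable[OF s z]
    by (simp add: partial_deriv_diff)
qed

lemma \<Gamma>\<Gamma>_van:
  "(\<lambda>z. g'.\<Gamma> a b c z * g'.\<Gamma> d e f z - g.\<Gamma> a b c z * g.\<Gamma> d e f z) \<in> vanishing V x (Suc k)"
proof (rule vanishing_cong[OF V x])
  have D: "(\<lambda>z. g'.\<Gamma> a b c z - g.\<Gamma> a b c z) \<in> vanishing V x (Suc k)" for a b c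
    using vanishing_add[OF V x vanishing_mono[OF \<Gamma>_van[of a b c], of "Suc k"] T_van[of a b c]] by simp
  show "(\<lambda>z. g'.\<Gamma> d e f z * (g'.\<Gamma> a b c z - g.\<Gamma> a b c z) + g.\<Gamma> a b c z * (g'.\<Gamma> d e f z - g.\<Gamma> d e f z)) \<in> vanishing V x (Suc k)"
    by (intro vanishing_add[OF V x] vanishing_smult[OF V x] D g.\<Gamma>_smooth g'.\<Gamma>_smooth)
qed (simp add: algebra_simps)

lemma riemann_van:
  "(\<lambda>z. riemann g' a b c d z - riemann g a b c d z - (partial_deriv c (T a d b) z - partial_deriv d (T a c b) z)) \<in> vanishing V x (Suc k)"
proof (rule vanishing_cong[OF V x])
  show "(\<lambda>z. (partial_deriv c (g'.\<Gamma> a d b) z - partial_deriv c (g.\<Gamma> a d b) z - partial_deriv c (T a d b) z)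
      - (partial_deriv d (g'.\<Gamma> a c b) z - partial_deriv d (g.\<Gamma> a c b) z - partial_deriv d (T a c b) z)
      + (\<Sum>e\<in>UNIV. (g'.\<Gamma> a c e z * g'.\<Gamma> e d b z - g.\<Gamma> a c e z * g.\<Gamma> e d b z)
          - (g'.\<Gamma> a d e z * g'.\<Gamma> e c b z - g.\<Gamma> a d e z * g.\<Gamma> e c b z))) \<in> vanishing V x (Suc k)"
    by (intro vanishing_add[OF V x] vanishing_diff[OF V x] vanishing_sum[OF V x] d\<Gamma>_van \<Gamma>\<Gamma>_van)
qed (simp add: riemann_def sum_subtractf)

lemma ricci_van:
  "(\<lambda>z. ricci g' i j z - ricci g i j z - (\<Sum>k\<in>UNIV. \<Sum>l\<in>UNIV. g.Q k l x *
     (partial_deriv k (partial_deriv i (h l j)) z + partial_deriv k (partial_deriv j (h l i)) z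
     - partial_deriv k (partial_deriv l (h i j)) z - partial_deriv i (partial_deriv j (h k l)) z)) / 2) \<in> vanishing V x (Suc k)"
proof (rule vanishing_cong[OF V x])
  show "(\<lambda>z. \<Sum>a\<in>UNIV. riemann g' a i a j z - riemann g a i a j z - (partial_deriv a (T a j i) z - partial_deriv j (T a a i) z)) \<in> vanishing V x (Suc k)"
    by (intro vanishing_sum[OF V x] riemann_van)
  fix z assume z: "z \<in> V"
  have d: "(\<lambda>w. c * (partial_deriv p (h q r) w + partial_deriv p' (h q' r') w - partial_deriv p'' (h q'' r'') w)) differentiable (at z)"
    for c p q r p' q' r' p'' q'' r''
    by (intro smooth_differentiable[OF _ z] smooth_cmult[OF V] smooth_diff[OF V] smooth_add[OF V] smooth_partial_deriv h_smooth)
  have dd: "partial_deriv c (\<lambda>w. C * (partial_deriv p (h q r) w + partial_deriv p' (h q' r') w - partial_deriv p'' (h q'' r'') w)) z =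
     C * (partial_deriv c (partial_deriv p (h q r)) z + partial_deriv c (partial_deriv p' (h q' r')) z - partial_deriv c (partial_deriv p'' (h q'' r'')) z)"
    for C c p q r p' q' r' p'' q'' r''
  proof -
    have s: "partial_deriv p (h q r) differentiable (at z)" for p q r
      by (intro smooth_differentiable[OF _ z] smooth_partial_deriv h_smooth)
    show ?thesis
      by (subst partial_deriv_bounded_linear(2)[OF bounded_linear_mult_right])
        (simp_all add: partial_deriv_diff partial_deriv_add differentiable_add differentiable_diff s)
  qed
  have dT: "partial_deriv c (T a d b) z = (\<Sum>l\<in>UNIV. g.Q a l x *
     (partial_deriv c (partial_deriv d (h b l)) z + partial_deriv c (partial_deriv b (h d l)) z - partial_deriv c (partial_deriv l (h d b)) z)) / 2"
    for a b c d
  proof -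
    have "T a d b = (\<lambda>w. \<Sum>l\<in>UNIV. (g.Q a l x / 2) *
        (partial_deriv d (h b l) w + partial_deriv b (h d l) w - partial_deriv l (h d b) w))"
      by (simp add: T_def sum_divide_distrib)
    note T_eq = this
    have "partial_deriv c (T a d b) z = (\<Sum>l\<in>UNIV. (g.Q a l x / 2) *
     (partial_deriv c (partial_deriv d (h b l)) z + partial_deriv c (partial_deriv b (h d l)) z - partial_deriv c (partial_deriv l (h d b)) z))"
      unfolding T_eq partial_deriv_sum[OF d, THEN conjunct2] dd ..
    then show ?thesis by (simp add: sum_divide_distrib)
  qed
  \<comment> \<open>In the trace \<open>T a a i\<close> the first and the third summand cancel after
    the summation indices are exchanged, leaving half the derivative of the trace of
    \<open>h\<close>.\<close>
  have c1: "(\<Sum>a\<in>UNIV. \<Sum>l\<in>UNIV. g.Q a l x * partial_deriv j (partial_deriv l (h a i)) z) =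
      (\<Sum>a\<in>UNIV. \<Sum>l\<in>UNIV. g.Q a l x * partial_deriv j (partial_deriv a (h i l)) z)"
    by (subst sum.swap) (simp add: g.Q_swap[OF x] ddh_swap[OF z, of _ _ _ i])
  have "(\<Sum>a\<in>UNIV. partial_deriv a (T a j i) z - partial_deriv j (T a a i) z) =
    (\<Sum>k\<in>UNIV. \<Sum>l\<in>UNIV. g.Q k l x *
     (partial_deriv k (partial_deriv i (h l j)) z + partial_deriv k (partial_deriv j (h l i)) z
     - partial_deriv k (partial_deriv l (h i j)) z - partial_deriv i (partial_deriv j (h k l)) z)) / 2"
  proof -
    let ?S = "\<lambda>f. \<Sum>a\<in>UNIV. \<Sum>l\<in>UNIV. g.Q a l x * f a l"
    have split: "?S (\<lambda>a l. f a l + f1 a l - f2 a l) = ?S f + ?S f1 - ?S f2" for f f1 f2 :: "'n \<Rightarrow> 'n \<Rightarrow> real"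
      by (simp only: right_diff_distrib distrib_left sum.distrib sum_subtractf)
    have split': "?S (\<lambda>a l. f a l + f1 a l - f2 a l - f3 a l) = ?S f + ?S f1 - ?S f2 - ?S f3"
      for f f1 f2 f3 :: "'n \<Rightarrow> 'n \<Rightarrow> real"
      by (simp only: right_diff_distrib distrib_left sum.distrib sum_subtractf)
    have swap: "?S (\<lambda>a l. partial_deriv (p a l) (partial_deriv (q a l) (h (r a l) (s a l))) z) =
        ?S (\<lambda>a l. partial_deriv (p a l) (partial_deriv (q a l) (h (s a l) (r a l))) z)" for p q r s
      by (intro sum.cong refl arg_cong2[where f="(*)"] ddh_swap[OF z])
    have comm: "?S (\<lambda>a l. partial_deriv j (partial_deriv i (h a l)) z) = ?S (\<lambda>a l. partial_deriv i (partial_deriv j (h a l)) z)"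
      "?S (\<lambda>a l. partial_deriv j (partial_deriv a (h i l)) z) = ?S (\<lambda>a l. partial_deriv a (partial_deriv j (h i l)) z)"
      by (intro sum.cong refl arg_cong2[where f="(*)"] ddh_commute[OF z])+
    have "(\<Sum>a\<in>UNIV. partial_deriv a (T a j i) z - partial_deriv j (T a a i) z) =
        (?S (\<lambda>a l. partial_deriv a (partial_deriv j (h i l)) z + partial_deriv a (partial_deriv i (h j l)) z - partial_deriv a (partial_deriv l (h j i)) z)
       - ?S (\<lambda>a l. partial_deriv j (partial_deriv a (h i l)) z + partial_deriv j (partial_deriv i (h a l)) z - partial_deriv j (partial_deriv l (h a i)) z)) / 2"
      unfolding dT sum_subtractf sum_divide_distrib[symmetric] diff_divide_distrib ..
    also have "\<dots> = (?S (\<lambda>a l. partial_deriv a (partial_deriv i (h l j)) z) + ?S (\<lambda>a l. partial_deriv a (partial_deriv j (h l i)) z)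
        - ?S (\<lambda>a l. partial_deriv a (partial_deriv l (h i j)) z) - ?S (\<lambda>a l. partial_deriv i (partial_deriv j (h a l)) z)) / 2"
      unfolding split c1 comm
        swap[of "\<lambda>a l. a" "\<lambda>a l. j" "\<lambda>a l. i" "\<lambda>a l. l"] swap[of "\<lambda>a l. a" "\<lambda>a l. i" "\<lambda>a l. j" "\<lambda>a l. l"]
        swap[of "\<lambda>a l. a" "\<lambda>a l. l" "\<lambda>a l. j" "\<lambda>a l. i"]
      by simp
    finally show ?thesis unfolding split' .
  qed
  then show "(\<Sum>a\<in>UNIV. riemann g' a i a j z - riemann g a i a j z - (partial_deriv a (T a j i) z - partial_deriv j (T a a i) z)) =
    ricci g' i j z - ricci g i j z - (\<Sum>k\<in>UNIV. \<Sum>l\<in>UNIV. g.Q k l x *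
     (partial_deriv k (partial_deriv i (h l j)) z + partial_deriv k (partial_deriv j (h l i)) z
     - partial_deriv k (partial_deriv l (h i j)) z - partial_deriv i (partial_deriv j (h k l)) z)) / 2"
    by (simp add: ricci_def sum_subtractf)
qed

end

section \<open>The Bianchi identities\<close>

lemma bounded_bilinear_matrix_mult:
  "bounded_bilinear ((**) :: real^'m::finite^'l::finite \<Rightarrow> real^'n::finite^'m \<Rightarrow> real^'n^'l)"
proof -
  have "bilinear ((**) :: real^'m^'l \<Rightarrow> real^'n^'m \<Rightarrow> real^'n^'l)"
    unfolding bilinear_def
    by (auto intro!: linearI simp: matrix_matrix_mult_def vec_eq_iff sum.distrib algebra_simps sum_distrib_left)
  then show ?thesis by (simp add: bilinear_conv_bounded_bilinear)
qed

lemma bounded_linear_transpose: "bounded_linear (transpose :: real^'n::finite^'m::finite \<Rightarrow> real^'m^'n)"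
  by (simp add: linear_conv_bounded_linear[symmetric] linear_iff transpose_def vec_eq_iff)

interpretation mm: bounded_bilinear "(**) :: real^'n::finite^'n \<Rightarrow> real^'n^'n \<Rightarrow> real^'n^'n"
  by (rule bounded_bilinear_matrix_mult)

lemmas mm_simps = mm.add_left mm.add_right mm.diff_left mm.diff_right mm.minus_left mm.minus_right matrix_mul_assoc

lemma transpose_simps:
  fixes A B :: "real^'n::finite^'n"
  shows "transpose (A + B) = transpose A + transpose B" "transpose (A - B) = transpose A - transpose B"
    "transpose (- A) = - transpose A"
  by (simp_all add: transpose_def vec_eq_iff)

lemma partial_deriv_entry:
  fixes F :: "real^'n::finite \<Rightarrow> real^'k::finite^'m::finite"
  assumes "F differentiable (at y)"
  shows "partial_deriv i F y $ a $ b = partial_deriv i (\<lambda>z. F z $ a $ b) y"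
  using partial_deriv_bounded_linear(2)[OF bounded_linear_entry assms] by metis

context chart_metric
begin

definition Qm :: "real^'n \<Rightarrow> real^'n^'n" where "Qm = (\<lambda>z. matrix_inv (g z))"

text \<open>Connection matrices. They turn the curvature into a matrix commutator formula and spare
  index computations in the Bianchi identities.\<close>

definition C :: "'n \<Rightarrow> real^'n \<Rightarrow> real^'n^'n" where "C c = (\<lambda>z. \<chi> a b. \<Gamma> a c b z)"

definition R :: "'n \<Rightarrow> 'n \<Rightarrow> real^'n \<Rightarrow> real^'n^'n" where "R c d = (\<lambda>z. \<chi> a b. riemann g a b c d z)"

text \<open>The curvature with its second index raised. Its matrices are skew, and it can be
  contracted without any further use of the metric.\<close>

definition Y :: "'n \<Rightarrow> 'n \<Rightarrow> real^'n \<Rightarrow> real^'n^'n" where "Y c d = (\<lambda>z. R c d z ** Qm z)"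

lemma C_smooth: "smooth_map_on V (C c)"
  unfolding smooth_entries_iff[OF V] C_def by (simp add: \<Gamma>_smooth)

lemma Qm_smooth: "smooth_map_on V Qm"
  unfolding smooth_entries_iff[OF V] Qm_def using Q_smooth by (simp add: Q_def)

lemma R_smooth: "smooth_map_on V (R c d)"
  unfolding smooth_entries_iff[OF V] R_def by (simp add: riemann_smooth)

lemma Y_smooth: "smooth_map_on V (Y c d)"
  unfolding Y_def by (intro smooth_bilinear[OF V bounded_bilinear_matrix_mult] R_smooth Qm_smooth)

lemma \<Gamma>_swap: assumes "z \<in> V" shows "\<Gamma> k i j z = \<Gamma> k j i z"
proof -
  have "partial_deriv l (\<lambda>z. g z $ i $ j) z = partial_deriv l (\<lambda>z. g z $ j $ i) z" for l
    by (rule partial_deriv_cong[OF V assms g_swap smooth_differentiable[OF g_smooth assms]])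
  then show ?thesis by (simp add: christoffel_eq add.commute)
qed

lemma R_eq:
  assumes "z \<in> V"
  shows "R c d z = partial_deriv c (C d) z - partial_deriv d (C c) z + C c z ** C d z - C d z ** C c z"
  unfolding vec_eq_iff
proof (intro allI)
  fix a b
  have "partial_deriv c (C d) z $ a $ b = partial_deriv c (\<Gamma> a d b) z" for c d
    using partial_deriv_entry[OF smooth_differentiable[OF C_smooth assms], of c d a b] by (simp add: C_def)
  then show "R c d z $ a $ b = (partial_deriv c (C d) z - partial_deriv d (C c) z + C c z ** C d z - C d z ** C c z) $ a $ b"
    by (simp add: R_def riemann_def matrix_matrix_mult_def sum_subtractf) (simp add: C_def)
qed

text \<open>Metric compatibility of the Levi-Civita connection. Lowering the upper index gives the
  Christoffel symbols of the first kind (\<open>low\<close>), and two of these add up to a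
  derivative of the metric.\<close>

lemma partial_deriv_g:
  assumes "z \<in> V" shows "partial_deriv c g z = g z ** C c z + transpose (g z ** C c z)"
  unfolding vec_eq_iff
proof (intro allI)
  fix a b
  let ?d = "\<lambda>l i j. partial_deriv l (\<lambda>z. g z $ i $ j) z"
  have sw: "?d l i j = ?d l j i" for l i j
    by (rule partial_deriv_cong[OF V assms g_swap smooth_differentiable[OF g_smooth assms]])
  have low: "(\<Sum>f\<in>UNIV. g z $ m $ f * \<Gamma> f i j z) = (?d i j m + ?d j i m - ?d m i j) / 2" for m i j
  proof -
    have "(\<Sum>f\<in>UNIV. g z $ m $ f * \<Gamma> f i j z) =
        (\<Sum>f\<in>UNIV. \<Sum>l\<in>UNIV. g z $ m $ f * Q f l z * (?d i j l + ?d j i l - ?d l i j) / 2)"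
      by (simp add: christoffel_eq sum_distrib_left sum_divide_distrib mult.assoc)
    also have "\<dots> = (\<Sum>l\<in>UNIV. (\<Sum>f\<in>UNIV. g z $ m $ f * Q f l z) * (?d i j l + ?d j i l - ?d l i j) / 2)"
      by (subst sum.swap) (simp add: sum_distrib_right sum_divide_distrib)
    also have "\<dots> = (\<Sum>l\<in>UNIV. (if m = l then (?d i j l + ?d j i l - ?d l i j) / 2 else 0))"
      by (intro sum.cong refl) (simp add: g_Q[OF assms])
    finally show ?thesis by simp
  qed
  have "(g z ** C c z) $ m $ j = (?d c j m + ?d j c m - ?d m c j) / 2" for m j
    using low[of m c j] by (simp add: matrix_matrix_mult_def C_def)
  from this[of a b] this[of b a] have "(g z ** C c z) $ a $ b + (g z ** C c z) $ b $ a = ?d c a b"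
    using sw[of c a b] by simp
  then show "partial_deriv c g z $ a $ b = (g z ** C c z + transpose (g z ** C c z)) $ a $ b"
    unfolding partial_deriv_entry[OF smooth_differentiable[OF smooth assms]]
    by (simp add: transpose_def)
qed

lemma Qm_g: "z \<in> V \<Longrightarrow> Qm z ** g z = mat 1" "z \<in> V \<Longrightarrow> g z ** Qm z = mat 1"
  unfolding Qm_def using matrix_inv_right_left[OF inv] by auto

lemma Qm_transpose: "z \<in> V \<Longrightarrow> transpose (Qm z) = Qm z"
  using Q_swap by (simp add: Qm_def transpose_def vec_eq_iff Q_def)

lemma g_transpose: "z \<in> V \<Longrightarrow> transpose (g z) = g z"
  using sym by (simp add: sym_matrices_def)

text \<open>Obtained by differentiating \<open>Qm z ** g z = mat 1\<close>: the inverse metric is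
  parallel too.\<close>

lemma partial_deriv_Qm:
  assumes z: "z \<in> V" shows "partial_deriv c Qm z = - (C c z ** Qm z) - Qm z ** transpose (C c z)"
proof -
  note d = smooth_differentiable[OF Qm_smooth z] smooth_differentiable[OF smooth z]
  have "partial_deriv c (\<lambda>z. Qm z ** g z) z = partial_deriv c (\<lambda>z. mat 1 :: real^'n^'n) z"
    by (rule partial_deriv_cong[OF V z Qm_g(1)])
      (assumption, rule partial_deriv_bilinear(1)[OF bounded_bilinear_matrix_mult d])
  then have "Qm z ** partial_deriv c g z + partial_deriv c Qm z ** g z = 0"
    unfolding partial_deriv_bilinear(2)[OF bounded_bilinear_matrix_mult d] partial_deriv_const .
  then have "Qm z ** (g z ** C c z) + Qm z ** (transpose (C c z) ** g z) + partial_deriv c Qm z ** g z = 0"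
    unfolding partial_deriv_g[OF z] matrix_transpose_mul g_transpose[OF z] mm.add_right .
  then have "(C c z + Qm z ** transpose (C c z) ** g z + partial_deriv c Qm z ** g z) ** Qm z = 0 ** Qm z"
    by (simp add: matrix_mul_assoc Qm_g[OF z])
  then have "C c z ** Qm z + Qm z ** transpose (C c z) ** (g z ** Qm z) + partial_deriv c Qm z ** (g z ** Qm z) = 0"
    by (simp add: mm.add_left mm.zero_left matrix_mul_assoc)
  then have "C c z ** Qm z + Qm z ** transpose (C c z) + partial_deriv c Qm z = 0"
    by (simp add: Qm_g[OF z])
  then show ?thesis by (simp add: eq_neg_iff_add_eq_0 algebra_simps)
qed

text \<open>The integrability condition of the equation for a parallel inverse metric: equating its
  mixed second derivatives gives \<open>R Q + Q R^T = 0\<close>.\<close>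

lemma Y_antisym:
  assumes z: "z \<in> V" shows "transpose (Y d c z) = - Y d c z"
proof -
  have ddQ: "partial_deriv d (partial_deriv c Qm) z =
      - (C c z ** partial_deriv d Qm z + partial_deriv d (C c) z ** Qm z)
      - (Qm z ** transpose (partial_deriv d (C c) z) + partial_deriv d Qm z ** transpose (C c z))" for c d
  proof -
    note dC = smooth_differentiable[OF C_smooth z] and dQ = smooth_differentiable[OF Qm_smooth z]
    note dT = partial_deriv_bounded_linear[OF bounded_linear_transpose dC]
    note p1 = partial_deriv_bilinear[OF bounded_bilinear_matrix_mult dC dQ]
    note p2 = partial_deriv_bilinear[OF bounded_bilinear_matrix_mult dQ dT(1)]
    have "partial_deriv d (partial_deriv c Qm) z =
        partial_deriv d (\<lambda>z. - (C c z ** Qm z) - Qm z ** transpose (C c z)) z"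
      by (rule partial_deriv_cong[OF V z partial_deriv_Qm smooth_differentiable[OF smooth_partial_deriv[OF Qm_smooth] z]])
    also have "\<dots> = partial_deriv d (\<lambda>z. - (C c z ** Qm z)) z - partial_deriv d (\<lambda>z. Qm z ** transpose (C c z)) z"
      by (intro partial_deriv_diff differentiable_minus p1 p2)
    also have "partial_deriv d (\<lambda>z. - (C c z ** Qm z)) z = - partial_deriv d (\<lambda>z. C c z ** Qm z) z"
      by (rule partial_deriv_bounded_linear(2)[OF bounded_linear_minus[OF bounded_linear_ident] p1(1)])
    finally show ?thesis unfolding p1(2) p2(2) dT(2) .
  qed
  have "partial_deriv d (partial_deriv c Qm) z = partial_deriv c (partial_deriv d Qm) z"
    by (rule partial_deriv_commute[OF V Qm_smooth z])
  then have "R d c z ** Qm z + Qm z ** transpose (R d c z) = 0"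
    unfolding ddQ partial_deriv_Qm[OF z] R_eq[OF z]
    by (simp add: mm_simps transpose_simps matrix_transpose_mul) (simp add: algebra_simps)
  then show ?thesis unfolding Y_def by (simp add: matrix_transpose_mul Qm_transpose[OF z] eq_neg_iff_add_eq_0 add.commute)
qed

lemma Y_swap: "z \<in> V \<Longrightarrow> Y c d z = - Y d c z"
  unfolding Y_def by (simp add: R_eq mm_simps)

text \<open>After the curvature is expanded, second derivatives of the connection matrices cancel
  since they commute, and the products cancel in the cyclic sum. Only the matrix indices are
  differentiated covariantly.\<close>

lemma second_bianchi:
  assumes z: "z \<in> V"
  shows "(partial_deriv e (R c d) z + C e z ** R c d z - R c d z ** C e z)
    + (partial_deriv c (R d e) z + C c z ** R d e z - R d e z ** C c z)
    + (partial_deriv d (R e c) z + C d z ** R e c z - R e c z ** C d z) = 0"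
proof -
  have dR: "partial_deriv e (R c d) z = partial_deriv e (partial_deriv c (C d)) z - partial_deriv e (partial_deriv d (C c)) z
      + (C c z ** partial_deriv e (C d) z + partial_deriv e (C c) z ** C d z)
      - (C d z ** partial_deriv e (C c) z + partial_deriv e (C d) z ** C c z)" for e c d
  proof -
    note dC = smooth_differentiable[OF C_smooth z]
    note p = partial_deriv_bilinear[OF bounded_bilinear_matrix_mult dC dC]
    note ddC = smooth_differentiable[OF smooth_partial_deriv[OF C_smooth] z]
    have "partial_deriv e (R c d) z = partial_deriv e (\<lambda>z. partial_deriv c (C d) z - partial_deriv d (C c) z + C c z ** C d z - C d z ** C c z) z"
      by (rule partial_deriv_cong[OF V z R_eq smooth_differentiable[OF R_smooth z]])
    then show ?thesis
      by (simp add: partial_deriv_diff partial_deriv_add differentiable_add differentiable_diff ddC p)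
  qed
  have comm: "partial_deriv a (partial_deriv b (C f)) z = partial_deriv b (partial_deriv a (C f)) z" for a b f
    by (rule partial_deriv_commute[OF V C_smooth z])
  show ?thesis
    unfolding dR R_eq[OF z] comm[of e c] comm[of d e] comm[of d c]
    by (simp add: mm_simps algebra_simps)
qed

text \<open>Since the inverse metric is parallel, raising an index commutes with covariant
  differentiation, so the identity is multiplied by \<open>Qm\<close> on the right.\<close>

lemma second_bianchi_Y:
  assumes z: "z \<in> V"
  shows "(partial_deriv e (Y c d) z + C e z ** Y c d z + Y c d z ** transpose (C e z))
    + (partial_deriv c (Y d e) z + C c z ** Y d e z + Y d e z ** transpose (C c z))
    + (partial_deriv d (Y e c) z + C d z ** Y e c z + Y e c z ** transpose (C d z)) = 0"
proof -
  have dY: "partial_deriv e (Y c d) z + C e z ** Y c d z + Y c d z ** transpose (C e z) =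
     (partial_deriv e (R c d) z + C e z ** R c d z - R c d z ** C e z) ** Qm z" for e c d
  proof -
    have "partial_deriv e (Y c d) z = R c d z ** partial_deriv e Qm z + partial_deriv e (R c d) z ** Qm z"
      unfolding Y_def
      by (rule partial_deriv_bilinear(2)[OF bounded_bilinear_matrix_mult
            smooth_differentiable[OF R_smooth z] smooth_differentiable[OF Qm_smooth z]])
    then show ?thesis unfolding partial_deriv_Qm[OF z] Y_def by (simp add: mm_simps algebra_simps)
  qed
  show ?thesis unfolding dY mm.add_left[symmetric] second_bianchi[OF z] by (rule mm.zero_left)
qed

text \<open>The Ricci tensor with one index raised; its trace is the scalar curvature.\<close>

definition P :: "'n \<Rightarrow> 'n \<Rightarrow> real^'n \<Rightarrow> real" where
  "P b e = (\<lambda>z. \<Sum>f\<in>UNIV. ricci g f e z * Q f b z)"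

lemma Y_trace: "(\<Sum>a\<in>UNIV. Y a e z $ a $ b) = P b e z"
proof -
  have "(\<Sum>a\<in>UNIV. Y a e z $ a $ b) = (\<Sum>a\<in>UNIV. \<Sum>f\<in>UNIV. riemann g a f a e z * Q f b z)"
    by (simp add: Y_def R_def Qm_def Q_def matrix_matrix_mult_def)
  also have "\<dots> = P b e z"
    by (subst sum.swap) (simp add: P_def ricci_def sum_distrib_right)
  finally show ?thesis .
qed

lemma P_smooth: "smooth_map_on V (P b e)"
  unfolding P_def by (intro smooth_sum[OF V] smooth_mult[OF V] ricci_smooth Q_smooth)

text \<open>The matrix indices are contracted with two of the three form indices. The derivative
  terms \<open>t1\<close>, \<open>t4\<close>, \<open>t7\<close> give the differential of the scalar
  curvature and twice the divergence. Of the connection terms, \<open>t2\<close>, \<open>t3\<close>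
  and \<open>t5\<close>, \<open>t9\<close> agree in pairs, while \<open>t6\<close> and
  \<open>t8\<close> pair the symmetric lower indices of \<open>\<Gamma>\<close> with skew indices of
  \<open>Y\<close> and vanish.\<close>

lemma contracted_bianchi:
  assumes z: "z \<in> V"
  shows "(\<Sum>b\<in>UNIV. partial_deriv e (P b b) z) + 2 * (\<Sum>a\<in>UNIV. \<Sum>f\<in>UNIV. \<Gamma> a e f z * P f a z)
    = 2 * (\<Sum>a\<in>UNIV. partial_deriv a (P a e) z) + 2 * (\<Sum>a\<in>UNIV. \<Sum>f\<in>UNIV. \<Gamma> a a f z * P f e z)"
proof -
  have anti: "Y c d w $ a $ b = - Y c d w $ b $ a" if "w \<in> V" for a b c d w
    using arg_cong[OF Y_antisym[OF that, of c d], of "\<lambda>M. M $ b $ a"] by (simp add: transpose_def)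
  have anti': "Y c d w $ a $ b = - Y d c w $ a $ b" if "w \<in> V" for a b c d w
    using arg_cong[OF Y_swap[OF that, of c d], of "\<lambda>M. M $ a $ b"] by simp
  have tr1: "(\<Sum>b\<in>UNIV. Y b e w $ a $ b) = - P a e w" if "w \<in> V" for a e w
    using Y_trace[of e w a] anti[OF that, of _ e a] by (simp add: sum_negf)
  have tr2: "(\<Sum>a\<in>UNIV. Y e a w $ a $ b) = - P b e w" if "w \<in> V" for b e w
    using Y_trace[of e w b] anti'[OF that, of e] by (simp add: sum_negf)
  have tr3: "(\<Sum>b\<in>UNIV. Y a b w $ f $ b) = P f a w" if "w \<in> V" for a f w
    using tr1[OF that, of a f] anti'[OF that, of a] by (simp add: sum_negf)
  have dY: "partial_deriv i (Y c d) z $ a $ b = partial_deriv i (\<lambda>w. Y c d w $ a $ b) z" for i a b c d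
    by (rule partial_deriv_entry[OF smooth_differentiable[OF Y_smooth z]])
  have Ydiff: "(\<lambda>w. Y c d w $ a $ b) differentiable (at z)" for a b c d
    using Y_smooth smooth_entries_iff[OF V] smooth_differentiable[OF _ z] by blast
  have dsum: "(\<Sum>a\<in>UNIV. partial_deriv i (f a) z) = partial_deriv i F z"
    if "\<And>a. f a differentiable (at z)" "\<And>w. w \<in> V \<Longrightarrow> (\<Sum>a\<in>UNIV. f a w) = F w" for i and f :: "'n \<Rightarrow> real^'n \<Rightarrow> real" and F
  proof -
    have "(\<Sum>a\<in>UNIV. partial_deriv i (f a) z) = partial_deriv i (\<lambda>w. \<Sum>a\<in>UNIV. f a w) z"
      using partial_deriv_sum[of UNIV f z i] that(1) by simp
    also have "\<dots> = partial_deriv i F z"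
      using partial_deriv_sum[of UNIV f z i] that(1) by (intro partial_deriv_cong[OF V z that(2)]) auto
    finally show ?thesis .
  qed
  have neg: "partial_deriv i (\<lambda>w. - P a b w) z = - partial_deriv i (P a b) z" for i a b
    by (rule partial_deriv_bounded_linear(2)[OF bounded_linear_minus[OF bounded_linear_ident]
          smooth_differentiable[OF P_smooth z]])
  have t1: "(\<Sum>a\<in>UNIV. \<Sum>b\<in>UNIV. partial_deriv e (Y a b) z $ a $ b) = (\<Sum>b\<in>UNIV. partial_deriv e (P b b) z)"
    unfolding dY by (intro sum.cong refl dsum Ydiff tr3)
  have t2: "(\<Sum>a\<in>UNIV. \<Sum>b\<in>UNIV. (C e z ** Y a b z) $ a $ b) = (\<Sum>a\<in>UNIV. \<Sum>f\<in>UNIV. \<Gamma> a e f z * P f a z)"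
  proof (rule sum.cong[OF refl])
    fix a
    have "(\<Sum>b\<in>UNIV. (C e z ** Y a b z) $ a $ b) = (\<Sum>f\<in>UNIV. \<Gamma> a e f z * (\<Sum>b\<in>UNIV. Y a b z $ f $ b))"
      unfolding matrix_matrix_mult_def sum_distrib_left by (simp add: C_def, rule sum.swap)
    then show "(\<Sum>b\<in>UNIV. (C e z ** Y a b z) $ a $ b) = (\<Sum>f\<in>UNIV. \<Gamma> a e f z * P f a z)"
      by (simp add: tr3[OF z])
  qed
  have t3: "(\<Sum>a\<in>UNIV. \<Sum>b\<in>UNIV. (Y a b z ** transpose (C e z)) $ a $ b) = (\<Sum>a\<in>UNIV. \<Sum>f\<in>UNIV. \<Gamma> a e f z * P f a z)"
  proof (subst sum.swap, rule sum.cong[OF refl])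
    fix b
    have "(\<Sum>a\<in>UNIV. (Y a b z ** transpose (C e z)) $ a $ b) = (\<Sum>f\<in>UNIV. \<Gamma> b e f z * (\<Sum>a\<in>UNIV. Y a b z $ a $ f))"
      unfolding matrix_matrix_mult_def sum_distrib_left by (simp add: C_def transpose_def mult.commute, rule sum.swap)
    then show "(\<Sum>a\<in>UNIV. (Y a b z ** transpose (C e z)) $ a $ b) = (\<Sum>f\<in>UNIV. \<Gamma> b e f z * P f b z)"
      by (simp add: Y_trace)
  qed
  have t4: "(\<Sum>a\<in>UNIV. \<Sum>b\<in>UNIV. partial_deriv a (Y b e) z $ a $ b) = - (\<Sum>a\<in>UNIV. partial_deriv a (P a e) z)"
    unfolding dY sum_negf[symmetric] neg[symmetric] by (intro sum.cong refl dsum Ydiff tr1)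
  have t5: "(\<Sum>a\<in>UNIV. \<Sum>b\<in>UNIV. (C a z ** Y b e z) $ a $ b) = - (\<Sum>a\<in>UNIV. \<Sum>f\<in>UNIV. \<Gamma> a a f z * P f e z)"
    unfolding sum_negf[symmetric]
  proof (rule sum.cong[OF refl])
    fix a
    have "(\<Sum>b\<in>UNIV. (C a z ** Y b e z) $ a $ b) = (\<Sum>f\<in>UNIV. \<Gamma> a a f z * (\<Sum>b\<in>UNIV. Y b e z $ f $ b))"
      unfolding matrix_matrix_mult_def sum_distrib_left by (simp add: C_def, rule sum.swap)
    then show "(\<Sum>b\<in>UNIV. (C a z ** Y b e z) $ a $ b) = (\<Sum>f\<in>UNIV. - (\<Gamma> a a f z * P f e z))"
      by (simp add: tr1[OF z])
  qed
  have cancel: "(\<Sum>a\<in>UNIV. \<Sum>f\<in>UNIV. \<Gamma> b a f z * Y c d z $ a $ f) = 0" for b c d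
  proof -
    have "(\<Sum>a\<in>UNIV. \<Sum>f\<in>UNIV. \<Gamma> b a f z * Y c d z $ a $ f) = (\<Sum>f\<in>UNIV. \<Sum>a\<in>UNIV. \<Gamma> b a f z * Y c d z $ a $ f)"
      by (rule sum.swap)
    also have "\<dots> = (\<Sum>f\<in>UNIV. \<Sum>a\<in>UNIV. - (\<Gamma> b f a z * Y c d z $ f $ a))"
    proof (intro sum.cong refl)
      fix a f
      show "\<Gamma> b a f z * Y c d z $ a $ f = - (\<Gamma> b f a z * Y c d z $ f $ a)"
        using \<Gamma>_swap[OF z, of b a f] anti[OF z, of c d a f] by simp
    qed
    finally show ?thesis by (simp add: sum_negf)
  qed
  have t6: "(\<Sum>a\<in>UNIV. \<Sum>b\<in>UNIV. (Y b e z ** transpose (C a z)) $ a $ b) = 0"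
  proof (subst sum.swap, rule sum.neutral, rule ballI)
    fix b
    show "(\<Sum>a\<in>UNIV. (Y b e z ** transpose (C a z)) $ a $ b) = 0"
      using cancel[of b b e] by (simp add: matrix_matrix_mult_def C_def transpose_def mult.commute)
  qed
  have t7: "(\<Sum>a\<in>UNIV. \<Sum>b\<in>UNIV. partial_deriv b (Y e a) z $ a $ b) = - (\<Sum>a\<in>UNIV. partial_deriv a (P a e) z)"
    unfolding dY sum_negf[symmetric] neg[symmetric] by (subst sum.swap, intro sum.cong refl dsum Ydiff tr2)
  have t8: "(\<Sum>a\<in>UNIV. \<Sum>b\<in>UNIV. (C b z ** Y e a z) $ a $ b) = 0"
  proof (rule sum.neutral, rule ballI)
    fix a
    have "(\<Sum>b\<in>UNIV. (C b z ** Y e a z) $ a $ b) = (\<Sum>b\<in>UNIV. \<Sum>f\<in>UNIV. - (\<Gamma> a b f z * Y e a z $ b $ f))"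
      unfolding matrix_matrix_mult_def
    proof (simp only: vec_lambda_beta, intro sum.cong refl)
      fix b f
      show "C b z $ a $ f * Y e a z $ f $ b = - (\<Gamma> a b f z * Y e a z $ b $ f)"
        using anti[OF z, of e a f b] by (simp add: C_def)
    qed
    then show "(\<Sum>b\<in>UNIV. (C b z ** Y e a z) $ a $ b) = 0" using cancel[of a e a] by (simp add: sum_negf)
  qed
  have t9: "(\<Sum>a\<in>UNIV. \<Sum>b\<in>UNIV. (Y e a z ** transpose (C b z)) $ a $ b) = - (\<Sum>a\<in>UNIV. \<Sum>f\<in>UNIV. \<Gamma> a a f z * P f e z)"
    unfolding sum_negf[symmetric]
  proof (subst sum.swap, rule sum.cong[OF refl])
    fix b
    have "(\<Sum>a\<in>UNIV. (Y e a z ** transpose (C b z)) $ a $ b) = (\<Sum>f\<in>UNIV. \<Gamma> b b f z * (\<Sum>a\<in>UNIV. Y e a z $ a $ f))"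
      unfolding matrix_matrix_mult_def sum_distrib_left by (simp add: C_def transpose_def mult.commute, rule sum.swap)
    then show "(\<Sum>a\<in>UNIV. (Y e a z ** transpose (C b z)) $ a $ b) = (\<Sum>f\<in>UNIV. - (\<Gamma> b b f z * P f e z))"
      by (simp add: tr2[OF z])
  qed
  have "(\<Sum>a\<in>UNIV. \<Sum>b\<in>UNIV. ((partial_deriv e (Y a b) z + C e z ** Y a b z + Y a b z ** transpose (C e z))
    + (partial_deriv a (Y b e) z + C a z ** Y b e z + Y b e z ** transpose (C a z))
    + (partial_deriv b (Y e a) z + C b z ** Y e a z + Y e a z ** transpose (C b z))) $ a $ b) = 0"
    unfolding second_bianchi_Y[OF z] by simp
  then show ?thesis
    by (simp only: vector_add_component sum.distrib t1 t2 t3 t4 t5 t6 t7 t8 t9)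
qed

text \<open>Trace of the first Bianchi identity: its middle term is the trace of the curvature
  endomorphism, which vanishes because \<open>Y\<close> is skew and \<open>g\<close>
  symmetric.\<close>

lemma ricci_sym:
  assumes z: "z \<in> V" shows "ricci g b d z = ricci g d b z"
proof -
  have d\<Gamma>: "partial_deriv c (\<Gamma> a i j) z = partial_deriv c (\<Gamma> a j i) z" for a c i j
    by (rule partial_deriv_cong[OF V z \<Gamma>_swap smooth_differentiable[OF \<Gamma>_smooth z]])
  have first: "riemann g a b c d z + riemann g a c d b z + riemann g a d b c z = 0" for a c
    by (simp add: riemann_def d\<Gamma>[of _ a d b] d\<Gamma>[of _ a c b] d\<Gamma>[of _ a d c] \<Gamma>_swap[OF z, of _ d b] \<Gamma>_swap[OF z, of _ c b]
        \<Gamma>_swap[OF z, of _ d c] flip: sum.distrib)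
  have anti: "riemann g a d b c z = - riemann g a d c b z" for a c
    by (simp add: riemann_def flip: sum_negf)
  have tr: "(\<Sum>a\<in>UNIV. riemann g a a d b z) = 0"
  proof -
    have "R d b z = Y d b z ** g z" unfolding Y_def by (simp add: Qm_g[OF z] flip: matrix_mul_assoc)
    then have "(\<Sum>a\<in>UNIV. riemann g a a d b z) = (\<Sum>a\<in>UNIV. \<Sum>f\<in>UNIV. Y d b z $ a $ f * g z $ f $ a)"
      by (simp add: R_def matrix_matrix_mult_def vec_eq_iff)
    also have "\<dots> = (\<Sum>f\<in>UNIV. \<Sum>a\<in>UNIV. Y d b z $ a $ f * g z $ f $ a)" by (rule sum.swap)
    also have "\<dots> = (\<Sum>f\<in>UNIV. \<Sum>a\<in>UNIV. - (Y d b z $ f $ a * g z $ a $ f))"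
    proof (intro sum.cong refl)
      fix f a
      have "Y d b z $ a $ f = - Y d b z $ f $ a"
        using arg_cong[OF Y_antisym[OF z, of d b], of "\<lambda>M. M $ f $ a"] by (simp add: transpose_def)
      then show "Y d b z $ a $ f * g z $ f $ a = - (Y d b z $ f $ a * g z $ a $ f)"
        using g_swap[OF z, of a f] by simp
    qed
    finally have s: "(\<Sum>a\<in>UNIV. riemann g a a d b z) = - (\<Sum>f\<in>UNIV. \<Sum>a\<in>UNIV. Y d b z $ f $ a * g z $ a $ f)"
      by (simp add: sum_negf)
    then show ?thesis using \<open>(\<Sum>a\<in>UNIV. riemann g a a d b z) = (\<Sum>a\<in>UNIV. \<Sum>f\<in>UNIV. Y d b z $ a $ f * g z $ f $ a)\<close> by linarith
  qed
  have "(\<Sum>a\<in>UNIV. riemann g a b a d z + riemann g a a d b z + riemann g a d b a z) = 0"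
    unfolding first by simp
  then show ?thesis using tr by (simp add: ricci_def anti sum.distrib sum_subtractf)
qed

end

section \<open>Reduction of the Einstein equation to its trace-adjusted form\<close>

lemma partial_derivs_cmult:
  fixes f :: "real^'n::finite \<Rightarrow> real"
  assumes "open V" "y \<in> V" "smooth_map_on V f"
  shows "partial_derivs I (\<lambda>z. c * f z) y = c * partial_derivs I f y"
  by (rule partial_derivs_bounded_linear[OF assms(1) bounded_linear_mult_right assms(3,2)])

lemma partial_derivs_diff:
  fixes f g :: "real^'n::finite \<Rightarrow> real"
  assumes "open V" "y \<in> V" "smooth_map_on V f" "smooth_map_on V g"
  shows "partial_derivs I (\<lambda>z. f z - g z) y = partial_derivs I f y - partial_derivs I g y"
  using partial_derivs_add[OF assms(1,3) smooth_cmult[OF assms(1,4), of "-1"] assms(2), of I]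
    partial_derivs_cmult[OF assms(1,2,4), of I "-1"] by simp

lemmas partial_derivs_real_linear = partial_derivs_cmult partial_derivs_diff

lemma partial_derivs_sum:
  fixes f :: "'a \<Rightarrow> real^'n::finite \<Rightarrow> real"
  assumes V: "open V" and y: "y \<in> V" and f: "\<And>s. s \<in> S \<Longrightarrow> smooth_map_on V (f s)"
  shows "partial_derivs I (\<lambda>z. \<Sum>s\<in>S. f s z) y = (\<Sum>s\<in>S. partial_derivs I (f s) y)"
  using f
proof (induction S rule: infinite_finite_induct)
  case (insert s S)
  have "partial_derivs I (\<lambda>z. f s z + (\<Sum>s\<in>S. f s z)) y = partial_derivs I (f s) y + partial_derivs I (\<lambda>z. \<Sum>s\<in>S. f s z) y"
    using insert.prems by (intro partial_derivs_add[OF V _ _ y] smooth_sum[OF V]) auto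
  then show ?case using insert by simp
next
  case (infinite S)
  have "partial_derivs I (\<lambda>z. 0 * (0::real)) y = 0 * partial_derivs I (\<lambda>z. 0) y"
    by (rule partial_derivs_real_linear(1)[OF V y smooth_const[OF V]])
  then show ?case using infinite by simp
next
  case empty
  have "partial_derivs I (\<lambda>z. 0 * (0::real)) y = 0 * partial_derivs I (\<lambda>z. 0) y"
    by (rule partial_derivs_real_linear(1)[OF V y smooth_const[OF V]])
  then show ?case by simp
qed

text \<open>Since \<open>Ric - R g / 2 + \<Lambda> g\<close> and \<open>Ric - 2 \<Lambda> / (n - 2) g\<close> determine each other by taking traces, the
  Einstein equation may be replaced by the vanishing of the latter tensor.\<close>

definition ricci_defect :: "real \<Rightarrow> (real^'n::finite \<Rightarrow> real^'n^'n) \<Rightarrow> 'n \<Rightarrow> 'n \<Rightarrow> real^'n \<Rightarrow> real" where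
  "ricci_defect \<Lambda> g i j = (\<lambda>z. ricci g i j z - 2 * \<Lambda> / (real CARD('n) - 2) * g z $ i $ j)"

context chart_metric
begin

lemma ricci_defect_smooth: "smooth_map_on V (ricci_defect \<Lambda> g i j)"
  unfolding ricci_defect_def by (intro smooth_diff[OF V] smooth_cmult[OF V] ricci_smooth g_smooth)

lemma trace_g: "z \<in> V \<Longrightarrow> (\<Sum>i\<in>UNIV. \<Sum>j\<in>UNIV. Q i j z * g z $ i $ j) = real CARD('n)"
  using Q_g[of z] g_swap[of z] by simp

lemma trace_defect:
  assumes "z \<in> V"
  shows "(\<Sum>i\<in>UNIV. \<Sum>j\<in>UNIV. Q i j z * ricci_defect \<Lambda> g i j z) =
    scalar_curvature g z - 2 * \<Lambda> / (real CARD('n) - 2) * real CARD('n)"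
proof -
  have "(\<Sum>i\<in>UNIV. \<Sum>j\<in>UNIV. Q i j z * ricci_defect \<Lambda> g i j z) =
      (\<Sum>i\<in>UNIV. \<Sum>j\<in>UNIV. Q i j z * ricci g i j z) -
      (2 * \<Lambda> / (real CARD('n) - 2)) * (\<Sum>i\<in>UNIV. \<Sum>j\<in>UNIV. Q i j z * g z $ i $ j)"
    unfolding sum_distrib_left sum_subtractf[symmetric]
    by (intro sum.cong refl) (simp only: ricci_defect_def right_diff_distrib mult.left_commute)
  then show ?thesis by (simp only: trace_g[OF assms]) (simp add: scalar_curvature_def Q_def)
qed

lemma einstein_eq_defect:
  assumes "z \<in> V" "CARD('n) \<ge> 3"
  shows "einstein_operator \<Lambda> g z $ i $ j =
    ricci_defect \<Lambda> g i j z - (1 / 2) * ((\<Sum>i\<in>UNIV. \<Sum>j\<in>UNIV. Q i j z * ricci_defect \<Lambda> g i j z) * g z $ i $ j)"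
proof -
  define c where "c = 2 * \<Lambda> / (real CARD('n) - 2)"
  have L: "\<Lambda> = c * (real CARD('n) - 2) / 2" using assms(2) by (simp add: c_def)
  have "einstein_operator \<Lambda> g z $ i $ j = ricci g i j z - scalar_curvature g z * g z $ i $ j / 2 + \<Lambda> * g z $ i $ j"
    by (simp add: einstein_operator_def)
  also have "\<dots> = (ricci g i j z - c * g z $ i $ j) - (1 / 2) * ((scalar_curvature g z - c * real CARD('n)) * g z $ i $ j)"
    by (subst L) (simp add: algebra_simps add_divide_distrib diff_divide_distrib)
  finally show ?thesis unfolding trace_defect[OF assms(1)] unfolding ricci_defect_def c_def .
qed

text \<open>The trace of the Einstein tensor is \<open>- (n - 2) / 2\<close> times that of the
  defect, so the relation of \<open>einstein_eq_defect\<close> can be inverted for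
  \<open>n \<ge> 3\<close>.\<close>

lemma defect_eq_einstein:
  assumes "z \<in> V" "CARD('n) \<ge> 3"
  shows "ricci_defect \<Lambda> g i j z = einstein_operator \<Lambda> g z $ i $ j -
    (1 / (real CARD('n) - 2)) * ((\<Sum>i\<in>UNIV. \<Sum>j\<in>UNIV. Q i j z * einstein_operator \<Lambda> g z $ i $ j) * g z $ i $ j)"
proof -
  let ?t = "\<Sum>i\<in>UNIV. \<Sum>j\<in>UNIV. Q i j z * ricci_defect \<Lambda> g i j z"
  have n: "real CARD('n) - 2 \<noteq> 0" using assms(2) by simp
  have "(\<Sum>i\<in>UNIV. \<Sum>j\<in>UNIV. Q i j z * einstein_operator \<Lambda> g z $ i $ j) =
     ?t - (1 / 2 * ?t) * (\<Sum>i\<in>UNIV. \<Sum>j\<in>UNIV. Q i j z * g z $ i $ j)"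
    unfolding sum_distrib_left[of "1 / 2 * ?t"] sum_subtractf[symmetric] einstein_eq_defect[OF assms]
    by (intro sum.cong refl) (simp only: right_diff_distrib mult.left_commute mult.assoc)
  also have "\<dots> = - (real CARD('n) - 2) / 2 * ?t" unfolding trace_g[OF assms(1)] by (simp add: field_simps)
  finally have t: "(\<Sum>i\<in>UNIV. \<Sum>j\<in>UNIV. Q i j z * einstein_operator \<Lambda> g z $ i $ j) =
    - (real CARD('n) - 2) / 2 * ?t" .
  show ?thesis unfolding t unfolding einstein_eq_defect[OF assms] using n by (simp add: field_simps)
qed

lemma einstein_smooth: "smooth_map_on V (einstein_operator \<Lambda> g)"
proof -
  have "smooth_map_on V (\<lambda>z. ricci g i j z - (\<Sum>i\<in>UNIV. \<Sum>j\<in>UNIV. Q i j z * ricci g i j z) * (g z $ i $ j) / 2 + \<Lambda> * (g z $ i $ j))" for i j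
    by (intro smooth_add[OF V] smooth_diff[OF V] smooth_divide[OF V] smooth_mult[OF V] smooth_sum[OF V] smooth_cmult[OF V]
        ricci_smooth g_smooth Q_smooth)
  then show ?thesis
    unfolding smooth_entries_iff[OF V] by (simp add: einstein_operator_def scalar_curvature_def Q_def)
qed

text \<open>Each of the two tensors is a combination of components of the other with smooth
  coefficients, so both vanish to the same order.\<close>

lemma einstein_vanishing_iff:
  assumes x: "x \<in> V" and card: "CARD('n) \<ge> 3"
  shows "(\<forall>K. length K < m \<longrightarrow> partial_derivs K (einstein_operator \<Lambda> g) x = 0) \<longleftrightarrow>
    (\<forall>i j. ricci_defect \<Lambda> g i j \<in> vanishing V x m)"
proof -
  let ?E = "\<lambda>i j z. einstein_operator \<Lambda> g z $ i $ j"
  have sE: "smooth_map_on V (?E i j)" for i j using einstein_smooth smooth_entries_iff[OF V] by blast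
  have "partial_derivs K (einstein_operator \<Lambda> g) x $ i $ j = partial_derivs K (?E i j) x" for K i j
    using partial_derivs_bounded_linear[OF V bounded_linear_entry einstein_smooth x] by metis
  then have "(\<forall>K. length K < m \<longrightarrow> partial_derivs K (einstein_operator \<Lambda> g) x = 0) \<longleftrightarrow>
      (\<forall>i j. ?E i j \<in> vanishing V x m)"
    using sE by (auto simp: vec_eq_iff vanishing_def)
  also have "\<dots> \<longleftrightarrow> (\<forall>i j. ricci_defect \<Lambda> g i j \<in> vanishing V x m)"
  proof (intro iffI allI)
    fix i j assume E: "\<forall>i j. ?E i j \<in> vanishing V x m"
    have "(\<lambda>z. ?E i j z - (1 / (real CARD('n) - 2)) * ((\<Sum>i\<in>UNIV. \<Sum>j\<in>UNIV. Q i j z * ?E i j z) * g z $ i $ j)) \<in> vanishing V x m"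
      using vanishing_smult[OF V x g_smooth vanishing_sum[OF V x vanishing_sum[OF V x vanishing_smult[OF V x Q_smooth E[rule_format]]]]]
      by (intro vanishing_diff[OF V x] vanishing_cmult[OF V x] E[rule_format]) (simp add: mult.commute)
    then show "ricci_defect \<Lambda> g i j \<in> vanishing V x m"
      by (rule vanishing_cong[OF V x]) (simp only: defect_eq_einstein[OF _ card])
  next
    fix i j assume Z: "\<forall>i j. ricci_defect \<Lambda> g i j \<in> vanishing V x m"
    have "(\<lambda>z. ricci_defect \<Lambda> g i j z - (1 / 2) * ((\<Sum>i\<in>UNIV. \<Sum>j\<in>UNIV. Q i j z * ricci_defect \<Lambda> g i j z) * g z $ i $ j)) \<in> vanishing V x m"
      using vanishing_smult[OF V x g_smooth vanishing_sum[OF V x vanishing_sum[OF V x vanishing_smult[OF V x Q_smooth Z[rule_format]]]]]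
      by (intro vanishing_diff[OF V x] vanishing_cmult[OF V x] Z[rule_format]) (simp add: mult.commute)
    then show "?E i j \<in> vanishing V x m"
      by (rule vanishing_cong[OF V x]) (simp only: einstein_eq_defect[OF _ card])
  qed
  finally show ?thesis .
qed

lemma ricci_defect_sym: "z \<in> V \<Longrightarrow> ricci_defect \<Lambda> g i j z = ricci_defect \<Lambda> g j i z"
  using ricci_sym[of z i j] g_swap[of z i j] by (simp add: ricci_defect_def)

text \<open>The Christoffel symbols drop out of the contracted Bianchi identity where \<open>Ric\<close> is a multiple of \<open>g\<close>.\<close>

lemma bianchi_defect:
  assumes x: "x \<in> V" and Z: "\<And>i j. ricci_defect \<Lambda> g i j x = 0"
  shows "(\<Sum>k\<in>UNIV. \<Sum>l\<in>UNIV. Q k l x *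
    (partial_deriv k (ricci_defect \<Lambda> g l j) x - partial_deriv j (ricci_defect \<Lambda> g k l) x / 2)) = 0"
proof -
  define c where "c = 2 * \<Lambda> / (real CARD('n) - 2)"
  let ?Z = "ricci_defect \<Lambda> g"
  have P_eq: "P b e z = (\<Sum>f\<in>UNIV. Q f b z * ?Z f e z) + c * (if b = e then 1 else 0)" if "z \<in> V" for b e z
  proof -
    have "P b e z = (\<Sum>f\<in>UNIV. Q f b z * ?Z f e z) + c * (\<Sum>f\<in>UNIV. Q b f z * g z $ f $ e)"
      unfolding P_def sum_distrib_left sum.distrib[symmetric]
      by (intro sum.cong refl) (simp add: ricci_defect_def c_def Q_swap[OF that, of _ b] algebra_simps)
    then show ?thesis by (simp only: Q_g[OF that])
  qed
  have Px: "P b e x = c * (if b = e then 1 else 0)" for b e using P_eq[OF x] Z by simp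
  have dP: "partial_deriv a (P b e) x = (\<Sum>f\<in>UNIV. Q f b x * partial_deriv a (?Z f e) x)" for a b e
  proof -
    note d = smooth_differentiable[OF Q_smooth x] smooth_differentiable[OF ricci_defect_smooth x]
    note p = partial_deriv_bilinear[OF bounded_bilinear_mult d]
    have "partial_deriv a (P b e) x = partial_deriv a (\<lambda>z. (\<Sum>f\<in>UNIV. Q f b z * ?Z f e z) + c * (if b = e then 1 else 0)) x"
      by (rule partial_deriv_cong[OF V x P_eq smooth_differentiable[OF P_smooth x]])
    also have "\<dots> = partial_deriv a (\<lambda>z. \<Sum>f\<in>UNIV. Q f b z * ?Z f e z) x"
      using partial_deriv_sum[of UNIV "\<lambda>f z. Q f b z * ?Z f e z" x a] p(1)
      by (subst partial_deriv_add) (auto simp: partial_deriv_const)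
    \<comment> \<open>Derivatives of \<open>Q\<close> do not appear since they are multiplied by the
      defect at \<open>x\<close>, which is 0.\<close>
    also have "\<dots> = (\<Sum>f\<in>UNIV. Q f b x * partial_deriv a (?Z f e) x)"
      using partial_deriv_sum[of UNIV "\<lambda>f z. Q f b z * ?Z f e z" x a] p by (simp add: Z)
    finally show ?thesis .
  qed
  have "(\<Sum>a\<in>UNIV. \<Sum>f\<in>UNIV. \<Gamma> a j f x * P f a x) = (\<Sum>a\<in>UNIV. \<Sum>f\<in>UNIV. \<Gamma> a a f x * P f j x)"
    by (simp add: Px if_distrib[of "\<lambda>x. _ * x"] \<Gamma>_swap[OF x, of _ j] cong: if_cong)
  then have b: "(\<Sum>b\<in>UNIV. partial_deriv j (P b b) x) = 2 * (\<Sum>a\<in>UNIV. partial_deriv a (P a j) x)"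
    using contracted_bianchi[OF x, of j] by simp
  have 1: "(\<Sum>b\<in>UNIV. partial_deriv j (P b b) x) = (\<Sum>k\<in>UNIV. \<Sum>l\<in>UNIV. Q k l x * partial_deriv j (?Z k l) x)"
    unfolding dP by (rule sum.swap)
  have 2: "(\<Sum>a\<in>UNIV. partial_deriv a (P a j) x) = (\<Sum>k\<in>UNIV. \<Sum>l\<in>UNIV. Q k l x * partial_deriv k (?Z l j) x)"
    unfolding dP by (simp add: Q_swap[OF x])
  have "(\<Sum>k\<in>UNIV. \<Sum>l\<in>UNIV. Q k l x * (partial_deriv k (?Z l j) x - partial_deriv j (?Z k l) x / 2)) =
     (\<Sum>k\<in>UNIV. \<Sum>l\<in>UNIV. Q k l x * partial_deriv k (?Z l j) x) - (\<Sum>k\<in>UNIV. \<Sum>l\<in>UNIV. Q k l x * partial_deriv j (?Z k l) x) / 2"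
    by (simp add: right_diff_distrib sum_subtractf sum_divide_distrib)
  then show ?thesis using b 1 2 by simp
qed

end

context metric_pair
begin

text \<open>The term with \<open>\<Lambda>\<close> contributes nothing, since both metrics have the
  same derivatives at \<open>x\<close> up to order \<open>k + 1\<close>; the rest is
  \<open>ricci_van\<close> differentiated at \<open>x\<close>.\<close>

lemma ricci_defect_variation:
  assumes K: "length K \<le> k"
  shows "partial_derivs K (ricci_defect \<Lambda> g' i j) x = partial_derivs K (ricci_defect \<Lambda> g i j) x +
    ric_symbol (matrix_inv (g x)) (\<lambda>I. partial_derivs I (\<lambda>z. g' z - g z) x) K $ i $ j"
proof -
  define H where "H = (\<lambda>I. partial_derivs I (\<lambda>z. g' z - g z) x)"
  have s: "smooth_map_on V (\<lambda>z. g' z - g z)" by (intro smooth_diff[OF V] g.smooth g'.smooth)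
  have H: "symf H" unfolding H_def by (rule symf_partial_derivs[OF V s x])
  have Hh: "partial_derivs I (h a b) x = H I $ a $ b" for I a b
    using partial_derivs_bounded_linear[OF V bounded_linear_entry[of a b] s x, of I] by (simp add: H_def h_def)
  have dd: "partial_derivs K (partial_deriv p (partial_deriv q (h a b))) x = H (p # q # K) $ a $ b" for p q a b
  proof -
    have "partial_derivs K (partial_deriv p (partial_deriv q (h a b))) x = H (K @ [p, q]) $ a $ b"
      unfolding Hh[symmetric] partial_derivs_append by simp
    also have "H (K @ [p, q]) = H (p # q # K)" by (rule symfD[OF H]) simp
    finally show ?thesis .
  qed
  note sdd = smooth_partial_deriv[OF smooth_partial_deriv[OF h_smooth]]
  define T where "T = (\<lambda>z. (\<Sum>k\<in>UNIV. \<Sum>l\<in>UNIV. g.Q k l x *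
     (partial_deriv k (partial_deriv i (h l j)) z + partial_deriv k (partial_deriv j (h l i)) z
     - partial_deriv k (partial_deriv l (h i j)) z - partial_deriv i (partial_deriv j (h k l)) z)))"
  have sT: "smooth_map_on V T" unfolding T_def
    by (intro smooth_sum[OF V] smooth_cmult[OF V] smooth_diff[OF V] smooth_add[OF V] sdd)
  have "partial_derivs K T x = (\<Sum>k\<in>UNIV. \<Sum>l\<in>UNIV. g.Q k l x *
     (H (k # i # K) $ l $ j + H (k # j # K) $ l $ i - H (k # l # K) $ i $ j - H (i # j # K) $ k $ l))"
    unfolding T_def
    by (simp add: partial_derivs_sum[OF V x] partial_derivs_real_linear[OF V x] partial_derivs_add[OF V _ _ x]
        smooth_sum[OF V] smooth_cmult[OF V] smooth_diff[OF V] smooth_add[OF V] sdd dd)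
  then have T: "(1 / 2) * partial_derivs K T x = ric_symbol (matrix_inv (g x)) H K $ i $ j"
    by (simp add: ric_symbol_def g.Q_def)
  have "(\<lambda>z. ricci g' i j z - ricci g i j z - (1 / 2) * T z) \<in> vanishing V x (Suc k)"
    using ricci_van[of i j] by (simp add: T_def)
  then have "partial_derivs K (\<lambda>z. ricci g' i j z - ricci g i j z - (1 / 2) * T z) x = 0"
    using K by (simp add: vanishing_def)
  then have r: "partial_derivs K (ricci g' i j) x = partial_derivs K (ricci g i j) x + (1 / 2) * partial_derivs K T x"
    by (simp only: partial_derivs_real_linear[OF V x] smooth_diff[OF V] smooth_cmult[OF V] g.ricci_smooth g'.ricci_smooth sT)
  have "partial_derivs K (h i j) x = 0" using h_van[of i j] K by (simp add: vanishing_def)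
  then have e: "partial_derivs K (\<lambda>z. g' z $ i $ j) x = partial_derivs K (\<lambda>z. g z $ i $ j) x"
    unfolding h_def by (simp add: partial_derivs_real_linear(2)[OF V x g'.g_smooth g.g_smooth])
  have d: "partial_derivs K (ricci_defect \<Lambda> gg i j) x =
      partial_derivs K (ricci gg i j) x - 2 * \<Lambda> / (real CARD('n) - 2) * partial_derivs K (\<lambda>z. gg z $ i $ j) x"
    if "chart_metric V gg" for gg
    unfolding ricci_defect_def
    using chart_metric.ricci_smooth[OF that, of i j] chart_metric.g_smooth[OF that, of i j]
    by (simp only: partial_derivs_real_linear[OF V x] smooth_cmult[OF V])
  show ?thesis unfolding d[OF g.chart_metric_axioms] d[OF g'.chart_metric_axioms] r e T[unfolded H_def] by simp
qed

end

section \<open>Metrics with prescribed jets\<close>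

text \<open>The homogeneous polynomial of degree \<open>t\<close> around \<open>x\<close> with
  derivatives \<open>v\<close>, built by Euler's relation from its own partial derivatives.\<close>

primrec jet_field :: "real^'n::finite \<Rightarrow> nat \<Rightarrow> 'n jet \<Rightarrow> real^'n \<Rightarrow> real^'n^'n" where
  "jet_field x 0 v = (\<lambda>y. v [])"
| "jet_field x (Suc t) v = (\<lambda>y. (1 / real (Suc t)) *\<^sub>R (\<Sum>a\<in>UNIV. (y - x) $ a *\<^sub>R jet_field x t (\<lambda>I. v (a # I)) y))"

lemma coordinate_deriv:
  "(\<lambda>y. (y - x) $ a) differentiable (at y)"
  "partial_deriv b (\<lambda>y. (y - x) $ a) y = (if a = b then 1 else 0)"
proof -
  have "((\<lambda>y. (y - x) $ a) has_derivative (\<lambda>h. h $ a)) (at y)"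
    by (auto intro!: derivative_eq_intros bounded_linear_imp_has_derivative bounded_linear.has_derivative[OF bounded_linear_vec_nth])
  then show "(\<lambda>y. (y - x) $ a) differentiable (at y)"
    "partial_deriv b (\<lambda>y. (y - x) $ a) y = (if a = b then 1 else 0)"
    by (auto simp: differentiable_def partial_deriv_eqI axis_def)
qed

lemma jet_field_differentiable: "jet_field x t v differentiable (at y)"
proof (induction t arbitrary: v)
  case (Suc t)
  show ?case unfolding jet_field.simps
    using partial_deriv_sum[of UNIV "\<lambda>a y. (y - x) $ a *\<^sub>R jet_field x t (\<lambda>I. v (a # I)) y" y]
      partial_deriv_bilinear(1)[OF bounded_bilinear_scaleR coordinate_deriv(1) Suc.IH]
    by (intro partial_deriv_bounded_linear(1)[OF bounded_linear_scaleR_right]) blast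
qed simp

text \<open>In the product rule the induction hypothesis and Euler's relation for the derivative
  produce its degree many copies, and the coordinate factor produces one more; together they cancel
  the leading coefficient.\<close>

lemma jet_field_partial_deriv:
  assumes "symf v" shows "partial_deriv b (jet_field x (Suc t) v) y = jet_field x t (\<lambda>I. v (b # I)) y"
  using assms
proof (induction t arbitrary: v)
  have step: "partial_deriv b (jet_field x (Suc t) v) y = (1 / real (Suc t)) *\<^sub>R
     (\<Sum>a\<in>UNIV. (y - x) $ a *\<^sub>R partial_deriv b (jet_field x t (\<lambda>I. v (a # I))) y
       + (if a = b then 1 else 0) *\<^sub>R jet_field x t (\<lambda>I. v (a # I)) y)" for t v
  proof -
    note p = partial_deriv_bilinear[OF bounded_bilinear_scaleR coordinate_deriv(1) jet_field_differentiable]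
    note s = partial_deriv_sum[of UNIV "\<lambda>a y. (y - x) $ a *\<^sub>R jet_field x t (\<lambda>I. v (a # I)) y" y b, OF p(1)]
    show ?thesis unfolding jet_field.simps
      partial_deriv_bounded_linear(2)[OF bounded_linear_scaleR_right conjunct1[OF s]] conjunct2[OF s] p(2) coordinate_deriv(2) ..
  qed
  have delta: "(\<Sum>a\<in>UNIV. (if a = b then 1 else 0) *\<^sub>R f a) = f b" for f :: "'a \<Rightarrow> real^'a^'a"
    by (simp add: if_distrib[of "\<lambda>x. x *\<^sub>R _"] cong: if_cong)
  {
    case 0
    show ?case unfolding step sum.distrib delta by (simp add: partial_deriv_const)
  next
    case (Suc t)
    have "partial_deriv b (jet_field x (Suc t) (\<lambda>I. v (a # I))) y = jet_field x t (\<lambda>I. v (a # b # I)) y" for a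
      by (rule Suc.IH[OF symf_shift[OF Suc.prems]])
    then have "(\<Sum>a\<in>UNIV. (y - x) $ a *\<^sub>R partial_deriv b (jet_field x (Suc t) (\<lambda>I. v (a # I))) y) =
        (\<Sum>a\<in>UNIV. (y - x) $ a *\<^sub>R jet_field x t (\<lambda>I. v (b # a # I)) y)"
      using symf_swap[OF Suc.prems] by (simp del: jet_field.simps)
    also have "\<dots> = real (Suc t) *\<^sub>R jet_field x (Suc t) (\<lambda>I. v (b # I)) y"
      by simp
    finally have A: "(\<Sum>a\<in>UNIV. (y - x) $ a *\<^sub>R partial_deriv b (jet_field x (Suc t) (\<lambda>I. v (a # I))) y) =
      real (Suc t) *\<^sub>R jet_field x (Suc t) (\<lambda>I. v (b # I)) y" .
    have "(\<Sum>a\<in>UNIV. (y - x) $ a *\<^sub>R partial_deriv b (jet_field x (Suc t) (\<lambda>I. v (a # I))) y)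
      + jet_field x (Suc t) (\<lambda>I. v (b # I)) y = real (Suc (Suc t)) *\<^sub>R jet_field x (Suc t) (\<lambda>I. v (b # I)) y"
      unfolding A by (subst of_nat_Suc[of "Suc t"]) (simp only: scaleR_add_left scaleR_one add.commute)
    then show ?case unfolding step[of "Suc t" v] sum.distrib delta by (simp del: jet_field.simps)
  }
qed

lemma jet_field_smooth: "symf v \<Longrightarrow> smooth_map_on V (jet_field x t v)"
proof -
  have "symf v \<Longrightarrow> smooth_upto V k (jet_field x t v)" for k
  proof (induction k arbitrary: t v)
    case 0
    then show ?case by (simp add: jet_field_differentiable)
  next
    case (Suc k)
    have "smooth_upto V k (partial_deriv i (jet_field x t v))" for i
    proof (cases t)
      case 0
      then show ?thesis using Suc.IH[of "\<lambda>I. 0" 0] by (simp add: partial_deriv_const symf_const)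
    next
      case (Suc t')
      have "partial_deriv i (jet_field x t v) = jet_field x t' (\<lambda>I. v (i # I))"
        unfolding Suc by (intro ext jet_field_partial_deriv Suc.prems)
      then show ?thesis using Suc.IH[OF symf_shift[OF Suc.prems]] by simp
    qed
    then show ?case by (simp add: jet_field_differentiable)
  qed
  then show "symf v \<Longrightarrow> smooth_map_on V (jet_field x t v)" by (simp add: smooth_iff_upto)
qed

lemma jet_field_partial_derivs:
  assumes "symf v" shows "partial_derivs I (jet_field x t v) x = (if length I = t then v I else 0)"
  using assms
proof (induction I arbitrary: t v rule: rev_induct)
  case Nil
  then show ?case by (cases t) simp_all
next
  case (snoc i I)
  show ?case
  proof (cases t)
    case 0
    have "partial_derivs I (jet_field x 1 (\<lambda>I. 0)) x = (0 :: real^'a^'a)"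
      using snoc.IH[of "\<lambda>I. 0" 1] by (simp add: symf_const)
    moreover have "jet_field x 1 (\<lambda>I. 0) = (\<lambda>y. 0 :: real^'a^'a)" by simp
    ultimately show ?thesis using 0 by (simp add: partial_derivs_append partial_deriv_const)
  next
    case (Suc t')
    have "partial_deriv i (jet_field x t v) = jet_field x t' (\<lambda>I. v (i # I))"
      unfolding Suc by (intro ext jet_field_partial_deriv snoc.prems)
    moreover have "v (i # I) = v (I @ [i])" by (rule symfD[OF snoc.prems]) simp
    ultimately show ?thesis using snoc.IH[OF symf_shift[OF snoc.prems], of t' i] Suc
      by (simp add: partial_derivs_append)
  qed
qed

lemma jet_field_sym: "(\<And>I. v I \<in> sym_matrices) \<Longrightarrow> jet_field x t v y \<in> sym_matrices"
  by (induction t arbitrary: v)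
    (auto intro!: subspace_scale[OF subspace_sym_matrices] subspace_sum[OF subspace_sym_matrices])

text \<open>Gram-Schmidt starting from an orthonormal basis of the limit form. In an indefinite
  setting it could meet a null vector, but here the orthogonalised vector \<open>d\<close> still
  tends to \<open>b k\<close>, so its square tends to \<open>e k\<close> and eventually has that
  sign.\<close>

lemma orthonormal_family_nearby:
  fixes B :: "real^'n::finite^'n" and M :: "'a \<Rightarrow> real^'n^'n" and e :: "'n \<Rightarrow> real"
  assumes b: "\<And>i j. i \<noteq> j \<Longrightarrow> b i \<bullet> (B *v b j) = 0" "\<And>i. b i \<bullet> (B *v b i) = e i"
    and e: "\<And>i. e i = 1 \<or> e i = -1" and M: "(M \<longlongrightarrow> B) F"
    and sym: "\<forall>\<^sub>F z in F. transpose (M z) = M z" and S: "finite S"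
  shows "\<exists>c. (\<forall>i. (c i \<longlongrightarrow> b i) F) \<and>
    (\<forall>\<^sub>F z in F. \<forall>i\<in>S. \<forall>j\<in>S. c i z \<bullet> (M z *v c j z) = (if i = j then e i else 0))"
  using S
proof induction
  case empty
  show ?case by (intro exI[of _ "\<lambda>i z. b i"]) simp
next
  case (insert k S)
  then obtain c where c: "\<And>i. (c i \<longlongrightarrow> b i) F"
    and orth: "\<forall>\<^sub>F z in F. \<forall>i\<in>S. \<forall>j\<in>S. c i z \<bullet> (M z *v c j z) = (if i = j then e i else 0)" by blast
  have bil: "bounded_bilinear ((*v) :: real^'n^'n \<Rightarrow> real^'n \<Rightarrow> real^'n)"
    unfolding bilinear_conv_bounded_bilinear[symmetric] bilinear_def
    by (auto intro!: linearI simp: matrix_vector_mult_def vec_eq_iff sum.distrib algebra_simps sum_distrib_left)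
  define d where "d z = c k z - (\<Sum>i\<in>S. (e i * (c i z \<bullet> (M z *v c k z))) *\<^sub>R c i z)" for z
  define s where "s z = d z \<bullet> (M z *v d z)" for z
  define n where "n z = (1 / sqrt \<bar>s z\<bar>) *\<^sub>R d z" for z
  have "(d \<longlongrightarrow> b k - (\<Sum>i\<in>S. (e i * (b i \<bullet> (B *v b k))) *\<^sub>R b i)) F"
    unfolding d_def by (intro tendsto_intros c bounded_bilinear.tendsto[OF bil] M)
  moreover have "(\<Sum>i\<in>S. (e i * (b i \<bullet> (B *v b k))) *\<^sub>R b i) = 0"
    using insert.hyps by (intro sum.neutral ballI) (metis b(1) mult_zero_right scale_zero_left)
  ultimately have d: "(d \<longlongrightarrow> b k) F" by simp
  have s: "(s \<longlongrightarrow> e k) F"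
    unfolding s_def b(2)[symmetric] by (intro tendsto_intros d bounded_bilinear.tendsto[OF bil] M)
  have "(n \<longlongrightarrow> (1 / sqrt \<bar>e k\<bar>) *\<^sub>R b k) F"
    unfolding n_def using e[of k] by (intro tendsto_intros d s) auto
  then have n: "(n \<longlongrightarrow> b k) F" using e[of k] by auto
  \<comment> \<open>Positivity of this product says that \<open>s z\<close> is nonzero with the sign
    of \<open>e k\<close>, so dividing by the root of its absolute value yields square
    \<open>e k\<close>.\<close>
  have "((\<lambda>z. s z * e k) \<longlongrightarrow> e k * e k) F" by (intro tendsto_intros s)
  moreover have "e k * e k > 0" using e[of k] by auto
  ultimately have pos: "\<forall>\<^sub>F z in F. s z * e k > 0" by (rule order_tendstoD(1))
  define c' where "c' i = (if i = k then n else c i)" for i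
  have "\<forall>\<^sub>F z in F. \<forall>i\<in>insert k S. \<forall>j\<in>insert k S. c' i z \<bullet> (M z *v c' j z) = (if i = j then e i else 0)"
    using orth sym pos
  proof eventually_elim
    case (elim z)
    have lin: "linear (\<lambda>w. v \<bullet> (M z *v w))" for v
      by (intro bounded_linear.linear bounded_linear_compose[OF bounded_linear_inner_right matrix_vector_mul_bounded_linear])
    have swap: "v \<bullet> (M z *v w) = w \<bullet> (M z *v v)" for v w
      using dot_lmul_matrix[of v "M z" w] elim(2) by (metis inner_commute transpose_matrix_vector)
    have cd: "c j z \<bullet> (M z *v d z) = 0" if "j \<in> S" for j
    proof -
      have "c j z \<bullet> (M z *v d z) = c j z \<bullet> (M z *v c k z)
          - (\<Sum>i\<in>S. (e i * (c i z \<bullet> (M z *v c k z))) * (c j z \<bullet> (M z *v c i z)))"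
        unfolding d_def linear_diff[OF lin] linear_sum[OF lin] linear_scale[OF lin] by simp
      also have "(\<Sum>i\<in>S. (e i * (c i z \<bullet> (M z *v c k z))) * (c j z \<bullet> (M z *v c i z))) =
          (\<Sum>i\<in>S. if j = i then (e i * e i) * (c i z \<bullet> (M z *v c k z)) else 0)"
        using elim(1) that by (intro sum.cong refl) auto
      also have "\<dots> = c j z \<bullet> (M z *v c k z)"
        using that insert.hyps(1) e[of j] by auto
      finally show ?thesis by simp
    qed
    have cn: "c j z \<bullet> (M z *v n z) = 0" if "j \<in> S" for j
      unfolding n_def linear_scale[OF lin] using cd[OF that] by simp
    have "n z \<bullet> (M z *v n z) = (1 / sqrt \<bar>s z\<bar>) * ((1 / sqrt \<bar>s z\<bar>) * s z)"
      unfolding n_def linear_scale[OF lin] s_def by simp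
    also have "\<dots> = s z / \<bar>s z\<bar>" by (simp add: real_sqrt_mult_self flip: real_sqrt_mult)
    also have "\<dots> = e k" using elim(3) e[of k] by (auto simp: abs_if)
    finally have nn: "n z \<bullet> (M z *v n z) = e k" .
    have nc: "n z \<bullet> (M z *v c j z) = 0" if "j \<in> S" for j
      using cn[OF that] swap[of "n z" "c j z"] by (simp only:)
    show ?case
    proof (intro ballI)
      fix i j assume "i \<in> insert k S" "j \<in> insert k S"
      then show "c' i z \<bullet> (M z *v c' j z) = (if i = j then e i else 0)"
        using elim(1) insert.hyps(2) cn nc nn by (cases "i = k"; cases "j = k") (auto simp: c'_def)
    qed
  qed
  moreover have "\<forall>i. (c' i \<longlongrightarrow> b i) F" using c n by (simp add: c'_def)
  ultimately show ?case by blast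
qed

lemma has_signature_nearby:
  fixes B :: "real^'n::finite^'n"
  assumes B: "has_signature B p q" and M: "(M \<longlongrightarrow> B) F"
    and sym: "\<forall>\<^sub>F z in F. transpose (M z) = M z"
  shows "\<forall>\<^sub>F z in F. has_signature (M z) p q"
proof -
  obtain b :: "'n \<Rightarrow> real^'n" where b: "\<forall>i j. i \<noteq> j \<longrightarrow> b i \<bullet> (B *v b j) = 0"
      "\<forall>i. b i \<bullet> (B *v b i) \<in> {1, -1}" "card {i. b i \<bullet> (B *v b i) = 1} = p" "card {i. b i \<bullet> (B *v b i) = -1} = q"
    using B unfolding has_signature_def by (elim exE conjE) (rule that)
  define e where "e i = b i \<bullet> (B *v b i)" for i
  have e: "e i = 1 \<or> e i = -1" for i using b(2)[rule_format, of i] by (simp add: e_def)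
  obtain c where "\<forall>\<^sub>F z in F. \<forall>i\<in>UNIV. \<forall>j\<in>UNIV. c i z \<bullet> (M z *v c j z) = (if i = j then e i else 0)"
    using orthonormal_family_nearby[where b=b and e=e, OF b(1)[rule_format] e_def[symmetric] e M sym finite_class.finite_UNIV] by blast
  then show ?thesis
  proof eventually_elim
    case (elim z)
    show ?case unfolding has_signature_def
    proof (intro exI[of _ "\<lambda>i. c i z"] conjI)
      show "card {i. c i z \<bullet> (M z *v c i z) = 1} = p" "card {i. c i z \<bullet> (M z *v c i z) = -1} = q"
        using elim b(3,4) by (simp_all add: e_def)
    qed (use elim e in auto)
  qed
qed

lemma metric_on_chart_metric:
  fixes g :: "real^'n::finite \<Rightarrow> real^'n^'n"
  assumes "open V" "metric_on p q V g" "CARD('n) \<ge> 3"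
  shows "chart_metric V g"
proof
  show "invertible (g y)" if "y \<in> V" for y
    using assms that has_signature_orthonormal_frame(2) unfolding metric_on_def by blast
qed (use assms in \<open>auto simp: metric_on_def\<close>)

text \<open>The polynomial with derivatives \<open>w\<close> is added to \<open>g\<close>. Lower
  derivatives at \<open>x\<close> are unchanged, and the signature persists on a smaller
  neighbourhood. With \<open>k = 0\<close> this realises the directions in the symbol, with
  \<open>k = 1\<close> it corrects third derivatives.\<close>

lemma perturb_metric:
  fixes g :: "real^'n::finite \<Rightarrow> real^'n^'n"
  assumes V: "open V" and x: "x \<in> V" and g: "metric_on p q V g" and card: "CARD('n) \<ge> 3"
    and w: "w \<in> sym_tensors (Suc (Suc k))"
  shows "\<exists>V' g'. open V' \<and> x \<in> V' \<and> V' \<subseteq> V \<and> metric_on p q V' g' \<and>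
    (\<forall>I. partial_derivs I g' x = partial_derivs I g x + w I) \<and>
    (\<forall>K i j. length K \<le> k \<longrightarrow> partial_derivs K (ricci_defect \<Lambda> g' i j) x =
       partial_derivs K (ricci_defect \<Lambda> g i j) x + ric_symbol (matrix_inv (g x)) w K $ i $ j)"
proof -
  have w': "symf w" "\<And>I. w I \<in> sym_matrices" "\<And>I. length I \<noteq> Suc (Suc k) \<Longrightarrow> w I = 0"
    using w by (auto simp: sym_tensors_iff)
  interpret chart_metric V g by (rule metric_on_chart_metric[OF V g card])
  define f where "f = jet_field x (Suc (Suc k)) w"
  define g' where "g' = (\<lambda>z. g z + f z)"
  have sf: "smooth_map_on W f" for W unfolding f_def by (rule jet_field_smooth[OF w'(1)])
  have sg': "smooth_map_on V g'" unfolding g'_def by (rule smooth_add[OF V smooth sf])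
  have df: "partial_derivs I f x = w I" for I
    unfolding f_def using jet_field_partial_derivs[OF w'(1), of I x "Suc (Suc k)"] w'(3) by simp
  have sym': "g' z \<in> sym_matrices" if "z \<in> V" for z
    unfolding g'_def f_def by (intro subspace_add[OF subspace_sym_matrices] sym[OF that] jet_field_sym w')
  have "continuous (at x) g'"
    by (intro differentiable_imp_continuous_within smooth_differentiable[OF sg' x])
  then have "(g' \<longlongrightarrow> g' x) (nhds x)" by (simp add: continuous_at tendsto_at_iff_tendsto_nhds)
  moreover have "g' x = g x" using df[of "[]"] w'(3)[of "[]"] by (simp add: g'_def)
  ultimately have lim: "(g' \<longlongrightarrow> g x) (nhds x)" by simp
  have "\<forall>\<^sub>F z in nhds x. z \<in> V" by (rule eventually_nhds_in_open[OF V x])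
  then have "\<forall>\<^sub>F z in nhds x. transpose (g' z) = g' z"
    by eventually_elim (use sym' in \<open>simp add: sym_matrices_def\<close>)
  moreover have "has_signature (g x) p q" using g x by (simp add: metric_on_def)
  ultimately have "\<forall>\<^sub>F z in nhds x. has_signature (g' z) p q" using has_signature_nearby[OF _ lim] by blast
  then obtain S where S: "open S" "x \<in> S" "\<forall>z\<in>S. has_signature (g' z) p q" unfolding eventually_nhds by blast
  define V' where "V' = V \<inter> S"
  have V': "open V'" "x \<in> V'" "V' \<subseteq> V" using V S x by (auto simp: V'_def)
  have m': "metric_on p q V' g'"
    using smooth_subset[OF sg' V'(3)] sym' S(3) by (auto simp: metric_on_def V'_def)
  have m: "metric_on p q V' g" using g smooth_subset[OF _ V'(3)] V'(3) by (auto simp: metric_on_def)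
  have "(\<lambda>z. f z $ i $ j) \<in> vanishing V' x (Suc (Suc k))" for i j
    using partial_derivs_bounded_linear[OF V'(1) bounded_linear_entry sf V'(2)]
      smooth_bounded_linear[OF V'(1) bounded_linear_entry sf, of i j]
    by (simp add: vanishing_def df w'(3))
  then interpret pair: metric_pair V' g g' x k
    using metric_on_chart_metric[OF V'(1) m card] metric_on_chart_metric[OF V'(1) m' card] V'(2)
    by (auto simp: metric_pair_def metric_pair_axioms_def g'_def)
  have "(\<lambda>z. g' z - g z) = f" by (simp add: g'_def)
  then have "(\<lambda>I. partial_derivs I (\<lambda>z. g' z - g z) x) = w" using df by simp
  then have "partial_derivs K (ricci_defect \<Lambda> g' i j) x =
       partial_derivs K (ricci_defect \<Lambda> g i j) x + ric_symbol (matrix_inv (g x)) w K $ i $ j" if "length K \<le> k" for K i j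
    using pair.ricci_defect_variation[OF that, of \<Lambda> i j] by simp
  moreover have "partial_derivs I g' x = partial_derivs I g x + w I" for I
    unfolding g'_def partial_derivs_add[OF V smooth sf x] df ..
  ultimately show ?thesis using V' m' by (intro exI[of _ V'] exI[of _ g']) simp
qed

lemma metric_partial_derivs_sym:
  assumes V: "open V" and x: "x \<in> V" and g: "metric_on p q V g"
  shows "partial_derivs I g x \<in> sym_matrices"
  unfolding sym_matrices_iff
proof (intro allI)
  fix i j
  have s: "smooth_map_on V g" using g by (simp add: metric_on_def)
  have e: "partial_derivs I (\<lambda>z. g z $ i $ j) x = partial_derivs I g x $ i $ j" for i j
    by (rule partial_derivs_bounded_linear[OF V bounded_linear_entry s x])
  have "partial_derivs I (\<lambda>z. g z $ i $ j) x = partial_derivs I (\<lambda>z. g z $ j $ i) x"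
    using g by (intro partial_derivs_cong[OF V smooth_bounded_linear[OF V bounded_linear_entry s] _ x])
      (auto simp: metric_on_def sym_matrices_iff)
  then show "partial_derivs I g x $ i $ j = partial_derivs I g x $ j $ i" by (simp add: e)
qed

section \<open>The Einstein equation and its symbol\<close>

lemma einstein_equation_iff:
  fixes \<phi> :: "'m \<Rightarrow> real^'n::finite"
  assumes card: "CARD('n) \<ge> 3" and l: "l \<ge> 2"
  shows "\<theta> \<in> einstein_equation \<Lambda> p q (U, \<phi>) x l \<longleftrightarrow> (\<exists>g V. \<theta> = jet l g (\<phi> x) \<and> open V \<and> \<phi> x \<in> V \<and> V \<subseteq> \<phi> ` U \<and>
    metric_on p q V g \<and> (\<forall>K i j. length K \<le> l - 2 \<longrightarrow> partial_derivs K (ricci_defect \<Lambda> g i j) (\<phi> x) = 0))"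
proof -
  have "(\<forall>K. length K \<le> l - 2 \<longrightarrow> partial_derivs K (einstein_operator \<Lambda> g) (\<phi> x) = 0) \<longleftrightarrow>
      (\<forall>K i j. length K \<le> l - 2 \<longrightarrow> partial_derivs K (ricci_defect \<Lambda> g i j) (\<phi> x) = 0)"
    if "open V" "\<phi> x \<in> V" "metric_on p q V g" for g V
  proof -
    interpret chart_metric V g by (rule metric_on_chart_metric[OF that(1,3) card])
    \<comment> \<open>\<open>vanishing\<close> counts orders strictly below its bound, hence the
      shift by one.\<close>
    have "length K \<le> l - 2 \<longleftrightarrow> length K < Suc (l - 2)" for K :: "'n list" by auto
    then show ?thesis
      using einstein_vanishing_iff[OF that(2) card, of "Suc (l - 2)" \<Lambda>] ricci_defect_smooth
      by (auto simp: vanishing_def)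
  qed
  then show ?thesis unfolding einstein_equation_def by auto blast+
qed

lemma eventually_const_derivative:
  fixes f :: "real \<Rightarrow> real"
  assumes "(f has_real_derivative D) (at 0)" "\<forall>\<^sub>F s in nhds 0. f s = c"
  shows "D = 0"
proof -
  have "((\<lambda>s. c) has_real_derivative D) (at 0)"
    using DERIV_cong_ev[OF refl assms(2) refl] assms(1) by blast
  then show ?thesis using DERIV_unique DERIV_const by blast
qed

text \<open>The conditions on \<open>\<gamma> s - \<theta>\<close> are linear equations between
  components, hence constant along the curve; differentiating each of them gives the same equation
  for the velocity.\<close>

lemma tangent_vectors_ric_kernel:
  fixes S :: "'n::finite jet set"
  assumes S: "\<And>\<eta>. \<eta> \<in> S \<Longrightarrow> \<eta> - \<theta> \<in> {v \<in> sym_tensors 2. ric_symbol Q v = 0}"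
    and v: "v \<in> tangent_vectors S \<theta>"
  shows "v \<in> {v \<in> sym_tensors 2. ric_symbol Q v = 0}"
proof -
  obtain \<gamma> :: "real \<Rightarrow> 'n jet" where \<gamma>: "\<gamma> 0 = \<theta>" "\<forall>\<^sub>F s in nhds 0. \<gamma> s \<in> S"
      "\<And>I. ((\<lambda>s. \<gamma> s I) has_vector_derivative v I) (at 0)"
    using v unfolding tangent_vectors_def by blast
  have E: "((\<lambda>s. \<gamma> s I $ i $ j) has_real_derivative v I $ i $ j) (at 0)" for I i j
    using bounded_linear.has_vector_derivative[OF bounded_linear_entry \<gamma>(3)]
    by (simp add: has_real_derivative_iff_has_vector_derivative)
  have ev: "\<forall>\<^sub>F s in nhds 0. \<gamma> s - \<theta> \<in> sym_tensors 2 \<and> ric_symbol Q (\<gamma> s - \<theta>) = 0"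
    using \<gamma>(2) by eventually_elim (use S in blast)
  have eventually_eq: "D = 0" if "(f has_real_derivative D) (at 0)"
    "\<And>s. \<gamma> s - \<theta> \<in> sym_tensors 2 \<and> ric_symbol Q (\<gamma> s - \<theta>) = 0 \<Longrightarrow> f s = c" for f D c
  proof (rule eventually_const_derivative[OF that(1), of c])
    show "\<forall>\<^sub>F s in nhds 0. f s = c" using ev by eventually_elim (rule that(2))
  qed
  have "symf v"
  proof (rule symfI)
    fix I J :: "'n list" assume m: "mset I = mset J"
    have "v I $ i $ j - v J $ i $ j = 0" for i j
    proof (rule eventually_eq[OF DERIV_diff[OF E E]])
      fix s assume "\<gamma> s - \<theta> \<in> sym_tensors 2 \<and> ric_symbol Q (\<gamma> s - \<theta>) = 0"
      then have "symf (\<gamma> s - \<theta>)" by (simp add: sym_tensors_iff)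
      from symfD[OF this m] have "(\<gamma> s I - \<theta> I) $ i $ j = (\<gamma> s J - \<theta> J) $ i $ j" by simp
      then show "\<gamma> s I $ i $ j - \<gamma> s J $ i $ j = \<theta> I $ i $ j - \<theta> J $ i $ j" by simp
    qed
    then show "v I = v J" by (simp add: vec_eq_iff)
  qed
  moreover have "v I \<in> sym_matrices" for I
  proof -
    have "v I $ i $ j - v I $ j $ i = 0" for i j
    proof (rule eventually_eq[OF DERIV_diff[OF E E]])
      fix s assume "\<gamma> s - \<theta> \<in> sym_tensors 2 \<and> ric_symbol Q (\<gamma> s - \<theta>) = 0"
      then have "(\<gamma> s - \<theta>) I \<in> sym_matrices" by (simp add: sym_tensors_iff)
      then have "(\<gamma> s I - \<theta> I) $ i $ j = (\<gamma> s I - \<theta> I) $ j $ i" unfolding sym_matrices_iff by simp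
      then show "\<gamma> s I $ i $ j - \<gamma> s I $ j $ i = \<theta> I $ i $ j - \<theta> I $ j $ i" by simp
    qed
    then show ?thesis by (simp add: sym_matrices_iff)
  qed
  moreover have "v I = 0" if "length I \<noteq> 2" for I
  proof -
    have "v I $ i $ j = 0" for i j
    proof (rule eventually_eq[OF E])
      fix s assume "\<gamma> s - \<theta> \<in> sym_tensors 2 \<and> ric_symbol Q (\<gamma> s - \<theta>) = 0"
      then have "(\<gamma> s - \<theta>) I = 0" using that unfolding sym_tensors_iff by blast
      then show "\<gamma> s I $ i $ j = \<theta> I $ i $ j" by simp
    qed
    then show ?thesis by (simp add: vec_eq_iff)
  qed
  moreover have "ric_symbol Q v J $ i $ j = 0" for J i j
  proof (rule eventually_eq)
    show "((\<lambda>s. ric_symbol Q (\<gamma> s) J $ i $ j) has_real_derivative ric_symbol Q v J $ i $ j) (at 0)"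
      unfolding ric_symbol_def vec_lambda_beta
      by (intro DERIV_cdivide DERIV_sum DERIV_cmult DERIV_add DERIV_diff E)
    fix s assume "\<gamma> s - \<theta> \<in> sym_tensors 2 \<and> ric_symbol Q (\<gamma> s - \<theta>) = 0"
    then show "ric_symbol Q (\<gamma> s) J $ i $ j = ric_symbol Q \<theta> J $ i $ j"
      using fun_cong[OF ric_symbol_diff[of Q "\<gamma> s" \<theta>], of J] by simp
  qed
  ultimately show ?thesis by (simp add: sym_tensors_iff fun_eq_iff vec_eq_iff)
qed

lemma sym_tensors_scale: "v \<in> sym_tensors t \<Longrightarrow> (\<lambda>I. c *\<^sub>R v I) \<in> sym_tensors t"
  using graded_tensors_scale[OF subspace_sym_matrices, of v t c]
  by (auto simp: graded_tensors_def sym_tensors_iff)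

text \<open>The fibre over a 1-jet is the affine space through \<open>jet 2 g (\<phi> x)\<close>
  directed by the kernel. The variation formula with \<open>k = 0\<close> shows that it contains
  nothing else, and straight lines in that space, realised by \<open>perturb_metric\<close>, give
  all tangent vectors.\<close>

lemma vertical_symbol_einstein:
  fixes \<phi> :: "'m \<Rightarrow> real^'n::finite" and g :: "real^'n \<Rightarrow> real^'n^'n"
  assumes card: "CARD('n) \<ge> 3"
    and V: "open V" "\<phi> x \<in> V" "V \<subseteq> \<phi> ` U" and g: "metric_on p q V g"
    and Z: "\<And>i j. ricci_defect \<Lambda> g i j (\<phi> x) = 0"
  shows "vertical_symbol 2 (einstein_equation \<Lambda> p q (U, \<phi>) x 2) (jet 2 g (\<phi> x)) =
    {v \<in> sym_tensors 2. ric_symbol (matrix_inv (g (\<phi> x))) v = 0}"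
proof -
  let ?y = "\<phi> x" and ?\<theta> = "jet 2 g (\<phi> x)" and ?E = "einstein_equation \<Lambda> p q (U, \<phi>) x 2"
  define Q where "Q = matrix_inv (g ?y)"
  define S where "S = {\<eta> \<in> ?E. jet_proj 1 \<eta> = jet_proj 1 ?\<theta>}"
  note iff = einstein_equation_iff[OF card order_refl, of _ \<Lambda> p q U \<phi> x]
  have sg: "smooth_map_on V g" using g by (simp add: metric_on_def)
  have "\<eta> - ?\<theta> \<in> {v \<in> sym_tensors 2. ric_symbol Q v = 0}" if \<eta>: "\<eta> \<in> S" for \<eta>
  proof -
    have "\<eta> \<in> ?E" "jet_proj 1 \<eta> = jet_proj 1 ?\<theta>" using \<eta> by (auto simp: S_def)
    then obtain g' V' where g': "\<eta> = jet 2 g' ?y" "open V'" "?y \<in> V'" "metric_on p q V' g'"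
        "\<And>K i j. length K \<le> 0 \<Longrightarrow> partial_derivs K (ricci_defect \<Lambda> g' i j) ?y = 0"
      unfolding iff by auto
    have Z': "ricci_defect \<Lambda> g' i j ?y = 0" for i j using g'(5)[of "[]"] by simp
    define W where "W = V \<inter> V'"
    have W: "open W" "?y \<in> W" using V g' by (auto simp: W_def)
    have mW: "metric_on p q W g" "metric_on p q W g'"
      using g g'(4) smooth_subset[of V g W] smooth_subset[of V' g' W] by (auto simp: metric_on_def W_def)
    have s: "smooth_map_on W g" "smooth_map_on W g'" using mW by (auto simp: metric_on_def)
    have sd: "smooth_map_on W (\<lambda>z. g' z - g z)" by (intro smooth_diff[OF W(1)] s)
    define H where "H = (\<lambda>I. partial_derivs I (\<lambda>z. g' z - g z) ?y)"
    have H: "H I = partial_derivs I g' ?y - partial_derivs I g ?y" for I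
      using partial_derivs_add[OF W(1) s(2) smooth_bounded_linear[OF W(1) bounded_linear_minus[OF bounded_linear_ident] s(1)] W(2), of I]
        partial_derivs_bounded_linear[OF W(1) bounded_linear_minus[OF bounded_linear_ident] s(1) W(2), of I]
      by (simp add: H_def)
    \<comment> \<open>Both jets agree in orders 0 and 1 and are padded by 0 above order 2, so only
      the second derivatives remain.\<close>
    have eq: "\<eta> I - ?\<theta> I = truncate 2 H I" for I
    proof -
      have "\<eta> I = ?\<theta> I" if "length I \<le> 1"
        using fun_cong[OF \<open>jet_proj 1 \<eta> = jet_proj 1 ?\<theta>\<close>, of I] that by (simp add: jet_proj_def)
      then show ?thesis by (cases "length I \<le> 1") (auto simp: truncate_def H g'(1) jet_def)
    qed
    have low: "H I = 0" if "length I < 2" for I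
      using fun_cong[OF \<open>jet_proj 1 \<eta> = jet_proj 1 ?\<theta>\<close>, of I] that
      by (auto simp: jet_proj_def jet_def H g'(1))
    have "(\<lambda>z. g' z $ i $ j - g z $ i $ j) \<in> vanishing W ?y (Suc (Suc 0))" for i j
    proof -
      have "partial_derivs I (\<lambda>z. (g' z - g z) $ i $ j) ?y = H I $ i $ j" for I
        unfolding H_def by (rule partial_derivs_bounded_linear[OF W(1) bounded_linear_entry sd W(2)])
      moreover have "smooth_map_on W (\<lambda>z. (g' z - g z) $ i $ j)"
        by (rule smooth_bounded_linear[OF W(1) bounded_linear_entry sd])
      ultimately show ?thesis by (simp add: vanishing_def low)
    qed
    then interpret pair: metric_pair W g g' ?y 0
      using metric_on_chart_metric[OF W(1) mW(1) card] metric_on_chart_metric[OF W(1) mW(2) card] W(2)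
      by (simp add: metric_pair_def metric_pair_axioms_def)
    have symH: "symf H" unfolding H_def by (rule symf_partial_derivs[OF W(1) sd W(2)])
    have "H I \<in> sym_matrices" for I
      unfolding H
      by (intro subspace_diff[OF subspace_sym_matrices] metric_partial_derivs_sym[OF W mW(1)] metric_partial_derivs_sym[OF W mW(2)])
    then have w: "truncate 2 H \<in> graded_tensors sym_matrices 2"
      by (intro truncate_graded subspace_sym_matrices symH)
    have "ric_symbol Q H [] $ i $ j = 0" for i j
      using pair.ricci_defect_variation[of "[]" \<Lambda> i j] Z Z' by (simp add: H_def Q_def)
    then have "ric_symbol Q (truncate 2 H) [] = 0"
      by (simp add: ric_symbol_def truncate_def vec_eq_iff)
    moreover have "ric_symbol Q (truncate 2 H) I = 0" if "I \<noteq> []" for I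
      using graded_tensorsD(3)[OF ric_symbol_graded, of "truncate 2 H" 0 I Q] w that by (simp add: numeral_2_eq_2)
    ultimately have "ric_symbol Q (truncate 2 H) = 0" by (intro ext) (metis zero_fun_apply)
    moreover have "\<eta> - ?\<theta> = truncate 2 H" using eq by (intro ext) simp
    ultimately show ?thesis using w by (simp add: graded_tensors_def sym_tensors_iff)
  qed
  then have "tangent_vectors S ?\<theta> \<subseteq> {v \<in> sym_tensors 2. ric_symbol Q v = 0}"
    using tangent_vectors_ric_kernel[of S ?\<theta> Q] by blast
  moreover have "v \<in> tangent_vectors S ?\<theta>" if v: "v \<in> sym_tensors 2" "ric_symbol Q v = 0" for v
    unfolding tangent_vectors_def mem_Collect_eq
  proof (intro exI[of _ "\<lambda>s I. ?\<theta> I + s *\<^sub>R v I"] conjI allI)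
    show "(\<lambda>I. ?\<theta> I + 0 *\<^sub>R v I) = ?\<theta>" by simp
    show "((\<lambda>s. ?\<theta> I + s *\<^sub>R v I) has_vector_derivative v I) (at 0)" for I
      by (auto intro!: derivative_eq_intros)
    have v0: "v I = 0" if "length I \<noteq> 2" for I using v(1) that by (simp add: sym_tensors_iff)
    have "(\<lambda>I. ?\<theta> I + s *\<^sub>R v I) \<in> S" for s
    proof -
      have sv: "(\<lambda>I. s *\<^sub>R v I) \<in> sym_tensors (Suc (Suc 0))"
        using sym_tensors_scale[OF v(1), of s] by (simp add: numeral_2_eq_2)
      obtain V' g' where g': "open V'" "?y \<in> V'" "V' \<subseteq> V" "metric_on p q V' g'"
          "\<forall>I. partial_derivs I g' ?y = partial_derivs I g ?y + s *\<^sub>R v I"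
          "\<forall>K i j. length K \<le> 0 \<longrightarrow> partial_derivs K (ricci_defect \<Lambda> g' i j) ?y =
            partial_derivs K (ricci_defect \<Lambda> g i j) ?y + ric_symbol (matrix_inv (g ?y)) (\<lambda>I. s *\<^sub>R v I) K $ i $ j"
        using perturb_metric[OF V(1,2) g card sv, of \<Lambda>] by blast
      have j: "(\<lambda>I. ?\<theta> I + s *\<^sub>R v I) = jet 2 g' ?y"
        using g'(5) v0 by (auto simp: jet_def)
      have "ric_symbol (matrix_inv (g ?y)) (\<lambda>I. s *\<^sub>R v I) = 0"
        using v(2) by (simp add: ric_symbol_scale Q_def fun_eq_iff)
      then have "\<forall>K i j. length K \<le> 0 \<longrightarrow> partial_derivs K (ricci_defect \<Lambda> g' i j) ?y = 0"
        using g'(6) Z by simp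
      then have "(\<lambda>I. ?\<theta> I + s *\<^sub>R v I) \<in> ?E"
        unfolding iff j using g' V(3) by (intro exI[of _ g'] exI[of _ V']) auto
      moreover have "jet_proj 1 (\<lambda>I. ?\<theta> I + s *\<^sub>R v I) = jet_proj 1 ?\<theta>"
        using v0 by (auto simp: jet_proj_def)
      ultimately show ?thesis by (simp add: S_def)
    qed
    then show "\<forall>\<^sub>F s in nhds 0. (\<lambda>I. ?\<theta> I + s *\<^sub>R v I) \<in> S" by simp
  qed
  moreover have "vertical_symbol 2 ?E ?\<theta> = tangent_vectors S ?\<theta>"
    by (simp add: vertical_symbol_def S_def)
  ultimately show ?thesis unfolding Q_def[symmetric] by blast
qed

lemma einstein_prolongation_surj:
  fixes \<phi> :: "'m \<Rightarrow> real^'n::finite"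
  assumes card: "CARD('n) \<ge> 3"
  shows "jet_proj 2 ` einstein_equation \<Lambda> p q (U, \<phi>) x (Suc 2) = einstein_equation \<Lambda> p q (U, \<phi>) x 2"
proof (intro equalityI subsetI)
  let ?y = "\<phi> x"
  note iff2 = einstein_equation_iff[OF card order_refl, of _ \<Lambda> p q U \<phi> x]
  have "2 \<le> Suc 2" by simp
  note iff3 = einstein_equation_iff[OF card this, of _ \<Lambda> p q U \<phi> x]
  have proj: "jet_proj 2 (jet (Suc 2) g ?y) = jet 2 g ?y" for g :: "real^'n \<Rightarrow> real^'n^'n"
    by (auto simp: jet_proj_def jet_def)
  {
    fix \<eta> assume "\<eta> \<in> jet_proj 2 ` einstein_equation \<Lambda> p q (U, \<phi>) x (Suc 2)"
    then obtain \<zeta> where \<zeta>: "\<eta> = jet_proj 2 \<zeta>" "\<zeta> \<in> einstein_equation \<Lambda> p q (U, \<phi>) x (Suc 2)"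
      by (rule imageE)
    from \<zeta>(2)[unfolded iff3] obtain g V where "\<zeta> = jet (Suc 2) g ?y" "open V" "?y \<in> V" "V \<subseteq> \<phi> ` U" "metric_on p q V g"
        "\<forall>K i j. length K \<le> Suc 2 - 2 \<longrightarrow> partial_derivs K (ricci_defect \<Lambda> g i j) ?y = 0"
      by blast
    with \<zeta>(1) show "\<eta> \<in> einstein_equation \<Lambda> p q (U, \<phi>) x 2"
      unfolding iff2 by (intro exI[of _ g] exI[of _ V]) (auto simp: proj[simplified] dest!: spec[of _ "[]"])
  next
    fix \<theta> assume "\<theta> \<in> einstein_equation \<Lambda> p q (U, \<phi>) x 2"
    then obtain g V where g: "\<theta> = jet 2 g ?y" "open V" "?y \<in> V" "V \<subseteq> \<phi> ` U" "metric_on p q V g"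
        "\<forall>K i j. length K \<le> 2 - 2 \<longrightarrow> partial_derivs K (ricci_defect \<Lambda> g i j) ?y = 0"
      unfolding iff2 by blast
    interpret chart_metric V g by (rule metric_on_chart_metric[OF g(2,5) card])
    have Z: "ricci_defect \<Lambda> g i j ?y = 0" for i j using g(6)[rule_format, of "[]"] by simp
    define Q0 where "Q0 = matrix_inv (g ?y)"
    obtain b \<beta> e where "orthonormal_frame Q0 b \<beta> e"
      using has_signature_orthonormal_frame(1)[OF _ card, of "g ?y" p q] g(3,5)
      unfolding Q0_def metric_on_def by blast
    then interpret fr: orthonormal_frame Q0 b \<beta> e .
    \<comment> \<open>To be cancelled by the symbol of \<open>w\<close>. As \<open>r\<close> has
      degree 1, \<open>w\<close> has degree 3 and leaves the 2-jet of \<open>g\<close>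
      untouched.\<close>
    define r where "r = (\<lambda>K. if length K = 1 then - (\<chi> i j. partial_derivs K (ricci_defect \<Lambda> g i j) ?y) else 0)"
    have r: "r \<in> graded_tensors sym_matrices 1"
    proof (rule graded_tensorsI)
      show "symf r"
      proof (rule symfI)
        fix I J :: "'n list" assume m: "mset I = mset J"
        show "r I = r J"
        proof (cases "length I = 1")
          case True
          then obtain a where "I = [a]" by (cases I) auto
          then have "J = I" using m by simp
          then show ?thesis by simp
        next
          case False
          moreover have "length I = length J" using m by (metis size_mset)
          ultimately show ?thesis by (simp add: r_def)
        qed
      qed
      show "r K \<in> sym_matrices" for K
      proof -
        have "partial_derivs K (ricci_defect \<Lambda> g i j) ?y = partial_derivs K (ricci_defect \<Lambda> g j i) ?y" for i j
          by (rule partial_derivs_cong[OF V ricci_defect_smooth ricci_defect_sym g(3)])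
        then show ?thesis by (simp add: sym_matrices_iff r_def)
      qed
    qed (simp add: r_def)
    have "bianchi_symbol Q0 r I $ j = 0" for I j
    proof (cases "I = []")
      case True
      have "bianchi_symbol Q0 r [] $ j = - (\<Sum>k\<in>UNIV. \<Sum>l\<in>UNIV. Q k l ?y *
        (partial_deriv k (ricci_defect \<Lambda> g l j) ?y - partial_deriv j (ricci_defect \<Lambda> g k l) ?y / 2))"
        unfolding sum_negf[symmetric] bianchi_symbol_def
        by (simp add: r_def Q_def Q0_def right_diff_distrib)
      then show ?thesis using True bianchi_defect[OF g(3) Z] by simp
    next
      case False
      then show ?thesis by (simp add: bianchi_symbol_def r_def)
    qed
    then have "bianchi_symbol Q0 r = 0" by (simp add: fun_eq_iff vec_eq_iff)
    from fr.ric_symbol_graded_exact[OF r this]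
    obtain w where w: "w \<in> graded_tensors sym_matrices (Suc (Suc 1))" "ric_symbol Q0 w = r" by blast
    then have w': "w \<in> sym_tensors (Suc (Suc 1))" by (simp add: graded_tensors_def sym_tensors_iff)
    obtain V' g' where g': "open V'" "?y \<in> V'" "V' \<subseteq> V" "metric_on p q V' g'"
        "\<forall>I. partial_derivs I g' ?y = partial_derivs I g ?y + w I"
        "\<forall>K i j. length K \<le> 1 \<longrightarrow> partial_derivs K (ricci_defect \<Lambda> g' i j) ?y =
            partial_derivs K (ricci_defect \<Lambda> g i j) ?y + ric_symbol (matrix_inv (g ?y)) w K $ i $ j"
      using perturb_metric[OF g(2,3,5) card w', of \<Lambda>] by blast
    \<comment> \<open>Order 0 persists since \<open>r [] = 0\<close>; in order 1 the symbol of
      \<open>w\<close> cancels the derivative of the old defect.\<close>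
    have "partial_derivs K (ricci_defect \<Lambda> g' i j) ?y = 0" if K: "length K \<le> 1" for K i j
    proof (cases "K = []")
      case True
      then show ?thesis using g'(6)[rule_format, OF K, of i j] w(2) Z by (simp add: Q0_def[symmetric] r_def)
    next
      case False
      then have "length K = 1" using K by (cases K) auto
      then show ?thesis using g'(6)[rule_format, OF K, of i j] w(2) by (simp add: Q0_def[symmetric] r_def)
    qed
    then have "jet (Suc 2) g' ?y \<in> einstein_equation \<Lambda> p q (U, \<phi>) x (Suc 2)"
      unfolding iff3 using g' g(4) by (intro exI[of _ g'] exI[of _ V']) auto
    moreover have "jet 2 g' ?y = \<theta>"
      using g'(5) graded_tensorsD(3)[OF w(1)] by (auto simp: g(1) jet_def)
    ultimately show "\<theta> \<in> jet_proj 2 ` einstein_equation \<Lambda> p q (U, \<phi>) x (Suc 2)"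
      using proj[of g'] by (metis imageI)
  }
qed

lemma einstein_symbol_frame:
  fixes \<phi> :: "'m \<Rightarrow> real^'n::finite"
  assumes card: "CARD('n) \<ge> 3" and \<theta>: "\<theta> \<in> einstein_equation \<Lambda> p q (U, \<phi>) x 2"
  shows "\<exists>Q b \<beta> e. orthonormal_frame Q b \<beta> e \<and>
    vertical_symbol 2 (einstein_equation \<Lambda> p q (U, \<phi>) x 2) \<theta> = orthonormal_frame.ric_kernel Q"
proof -
  obtain g V where g: "\<theta> = jet 2 g (\<phi> x)" "open V" "\<phi> x \<in> V" "V \<subseteq> \<phi> ` U" "metric_on p q V g"
      "\<forall>K i j. length K \<le> 2 - 2 \<longrightarrow> partial_derivs K (ricci_defect \<Lambda> g i j) (\<phi> x) = 0"
    using \<theta> unfolding einstein_equation_iff[OF card order_refl, of _ \<Lambda> p q U \<phi> x] by blast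
  obtain b \<beta> e where fr: "orthonormal_frame (matrix_inv (g (\<phi> x))) b \<beta> e"
    using has_signature_orthonormal_frame(1)[OF _ card, of "g (\<phi> x)" p q] g(3,5)
    unfolding metric_on_def by blast
  have "ricci_defect \<Lambda> g i j (\<phi> x) = 0" for i j using g(6)[rule_format, of "[]"] by simp
  from vertical_symbol_einstein[OF card g(2-5) this] show ?thesis
    unfolding g(1) using fr orthonormal_frame.ric_kernel_def[OF fr] by metis
qed

theorem theorem1:
  fixes X :: "'m topology" and A :: "('m, 'n::finite) chart set"
    and \<Lambda> :: real and p q :: nat
  assumes "smooth_manifold X A"
    and "CARD('n) \<ge> 3"
    and "p + q = CARD('n)"
  shows "(\<forall>c\<in>A. \<forall>x\<in>fst c. \<forall>\<theta>\<in>einstein_equation \<Lambda> p q c x 2.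
            let G = vertical_symbol 2 (einstein_equation \<Lambda> p q c x 2) \<theta> in
              spencer_cohomology_iso 2 G 0 0 (sym_matrices :: (real^'n^'n) set) \<and>
              spencer_cohomology_iso 2 G 1 1 (sym_matrices :: (real^'n^'n) set) \<and>
              spencer_cohomology_iso 2 G 1 2 (UNIV :: (real^'n) set) \<and>
              (\<forall>i j. (i, j) \<notin> {(0, 0), (1, 1), (1, 2)} \<longrightarrow> spencer_cohomology_zero 2 G i j))
         \<and> involutive_equation A 2 (einstein_equation \<Lambda> p q)"
proof (intro conjI ballI)
  fix c :: "('m, 'n) chart" and x \<theta> assume \<theta>: "\<theta> \<in> einstein_equation \<Lambda> p q c x 2"
  obtain U \<phi> where c: "c = (U, \<phi>)" by (cases c)
  obtain Q b \<beta> e where fr: "orthonormal_frame Q b \<beta> e"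
    and G: "vertical_symbol 2 (einstein_equation \<Lambda> p q c x 2) \<theta> = orthonormal_frame.ric_kernel Q"
    using einstein_symbol_frame[OF assms(2) \<theta>[unfolded c]] unfolding c by blast
  interpret orthonormal_frame Q b \<beta> e by (rule fr)
  show "let G = vertical_symbol 2 (einstein_equation \<Lambda> p q c x 2) \<theta> in
              spencer_cohomology_iso 2 G 0 0 (sym_matrices :: (real^'n^'n) set) \<and>
              spencer_cohomology_iso 2 G 1 1 (sym_matrices :: (real^'n^'n) set) \<and>
              spencer_cohomology_iso 2 G 1 2 (UNIV :: (real^'n) set) \<and>
              (\<forall>i j. (i, j) \<notin> {(0, 0), (1, 1), (1, 2)} \<longrightarrow> spencer_cohomology_zero 2 G i j)"
    unfolding Let_def G
    using ric_kernel_cohomology_00 ric_kernel_cohomology_11 ric_kernel_cohomology_12 ric_kernel_cohomology_zero by blast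
next
  show "involutive_equation A 2 (einstein_equation \<Lambda> p q)"
    unfolding involutive_equation_def
  proof (intro ballI conjI)
    fix c :: "('m, 'n) chart" and x \<theta> assume \<theta>: "\<theta> \<in> einstein_equation \<Lambda> p q c x 2"
    obtain U \<phi> where c: "c = (U, \<phi>)" by (cases c)
    obtain Q b \<beta> e where fr: "orthonormal_frame Q b \<beta> e"
      and G: "vertical_symbol 2 (einstein_equation \<Lambda> p q c x 2) \<theta> = orthonormal_frame.ric_kernel Q"
      using einstein_symbol_frame[OF assms(2) \<theta>[unfolded c]] unfolding c by blast
    show "involutive_symbol 2 (vertical_symbol 2 (einstein_equation \<Lambda> p q c x 2) \<theta>)"
      unfolding G by (rule orthonormal_frame.involutive_ric_kernel[OF fr])
  next
    fix c :: "('m, 'n) chart" and x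
    obtain U \<phi> where c: "c = (U, \<phi>)" by (cases c)
    show "jet_proj 2 ` einstein_equation \<Lambda> p q c x (Suc 2) = einstein_equation \<Lambda> p q c x 2"
      unfolding c by (rule einstein_prolongation_surj[OF assms(2)])
  qed
qed

end
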